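(* Stallings' group $B_3$, i.e. the kernel of the homomorphism $F_2\times F_2\times F_2\to\mathbb Z$ sending each of the six standard generators to the generator $1\in\mathbb Z$, is simply connected at infinity ($1$-connected at infinity).
   Context: $F_2$ is the free group on two generators. The standard generators of $F_2\times F_2\times F_2$ are the six elements consisting of the two free generators of each factor. The group $B_3$ is known to be finitely presented (Stallings) and one-ended. A one-ended finitely presented group $G$ is simply connected at infinity ($1$-connected at infinity) if for some (equivalently, any) finite connected CW-complex $A$ with $\pi_1(A)\cong G$, the universal cover $\tilde A$ has the following property: for any finite subcomplex $C\subset\tilde A$ there is a finite subcomplex $D\subset \tilde A$ such that every loop in $\tilde A-D$ is homotopically trivial in $\tilde A-C$. *)

theory Defs
  imports "HOL-Analysis.Analysis" "HOL-Algebra.Elementary_Groups"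
begin

section \<open>Free groups and Stallings' group\<close>

text \<open>The letter \<open>(x, True)\<close> stands for the generator \<open>x\<close>, the letter \<open>(x, False)\<close> for its inverse.\<close>

type_synonym 'x letter = "'x \<times> bool"

definition inv_letter :: "'x letter \<Rightarrow> 'x letter" where
  "inv_letter l = (fst l, \<not> snd l)"

definition reduced :: "'x letter list \<Rightarrow> bool" where
  "reduced w \<longleftrightarrow> successively (\<lambda>l m. m \<noteq> inv_letter l) w"

definition cancel_cons :: "'x letter \<Rightarrow> 'x letter list \<Rightarrow> 'x letter list" where
  "cancel_cons l w = (if w \<noteq> [] \<and> hd w = inv_letter l then tl w else l # w)"

definition free_group :: "'x set \<Rightarrow> 'x letter list monoid" where
  "free_group X =
     \<lparr>carrier = {w. reduced w \<and> fst ` set w \<subseteq> X}, monoid.mult = foldr cancel_cons, one = []\<rparr>"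

abbreviation F2 :: "nat letter list monoid" where
  "F2 \<equiv> free_group {0, 1}"

type_synonym F2_cubed = "nat letter list \<times> nat letter list \<times> nat letter list"

abbreviation F2_cubed :: "F2_cubed monoid" where
  "F2_cubed \<equiv> F2 \<times>\<times> (F2 \<times>\<times> F2)"

definition standard_generators :: "F2_cubed set" where
  "standard_generators =
     (\<Union>i\<in>{0, 1}. {([(i, True)], [], []), ([], [(i, True)], []), ([], [], [(i, True)])})"

definition exponent_sum :: "'x letter list \<Rightarrow> int" where
  "exponent_sum w = (\<Sum>l\<leftarrow>w. if snd l then 1 else - 1)"

text \<open>
  This is the homomorphism that sends every standard generator to \<open>1\<close>; see
  \<open>stallings_hom_hom\<close>, \<open>stallings_hom_standard_generators\<close> and \<open>stallings_hom_unique\<close> below.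
\<close>

definition stallings_hom :: "F2_cubed \<Rightarrow> int" where
  "stallings_hom = (\<lambda>(u, v, w). exponent_sum u + exponent_sum v + exponent_sum w)"

definition stallings_group :: "F2_cubed monoid" where
  "stallings_group = F2_cubed\<lparr>carrier := kernel F2_cubed integer_group stallings_hom\<rparr>"

lemma inv_letter_inv_letter [simp]: "inv_letter (inv_letter l) = l"
  by (simp add: inv_letter_def)

lemma inv_letter_neq [simp]: "inv_letter l \<noteq> l" "l \<noteq> inv_letter l"
  by (auto simp: inv_letter_def prod_eq_iff)

lemma fst_inv_letter [simp]: "fst (inv_letter l) = fst l"
  by (simp add: inv_letter_def)

lemma reduced_Nil [simp]: "reduced []"
  by (simp add: reduced_def)

lemma reduced_Cons: "reduced (l # w) \<longleftrightarrow> reduced w \<and> (w \<noteq> [] \<longrightarrow> hd w \<noteq> inv_letter l)"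
  by (cases w) (auto simp: reduced_def)

lemma reduced_cancel_cons: "reduced w \<Longrightarrow> reduced (cancel_cons l w)"
  by (cases w) (auto simp: cancel_cons_def reduced_Cons)

lemma reduced_foldr: "reduced w \<Longrightarrow> reduced (foldr cancel_cons u w)"
  by (induction u) (auto intro: reduced_cancel_cons)

lemma set_cancel_cons: "set (cancel_cons l w) \<subseteq> insert l (set w)"
  by (cases w) (auto simp: cancel_cons_def)

lemma set_foldr: "set (foldr cancel_cons u w) \<subseteq> set u \<union> set w"
  using set_cancel_cons by (induction u) fastforce+

lemma cancel_cons_inverse:
  assumes "reduced w" shows "cancel_cons l (cancel_cons (inv_letter l) w) = w"
  using assms by (cases w) (auto simp: cancel_cons_def reduced_Cons)

lemma foldr_cancel_cons:
  assumes "reduced w"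
  shows "foldr cancel_cons (cancel_cons l u) w = cancel_cons l (foldr cancel_cons u w)"
proof (cases "u \<noteq> [] \<and> hd u = inv_letter l")
  case True
  then obtain v where u: "u = inv_letter l # v" by (cases u) auto
  then show ?thesis
    using cancel_cons_inverse[OF reduced_foldr[OF assms]] by (simp add: cancel_cons_def)
qed (auto simp: cancel_cons_def)

lemma foldr_assoc:
  assumes "reduced w"
  shows "foldr cancel_cons (foldr cancel_cons u v) w = foldr cancel_cons u (foldr cancel_cons v w)"
  by (induction u) (simp_all add: foldr_cancel_cons[OF assms])

lemma foldr_Nil_right: "reduced w \<Longrightarrow> foldr cancel_cons w [] = w"
  by (induction w) (auto simp: reduced_Cons cancel_cons_def)

lemma group_free_group: "group (free_group X)"
proof (rule groupI)
  fix u v w assume "u \<in> carrier (free_group X)" "v \<in> carrier (free_group X)"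
    "w \<in> carrier (free_group X)"
  then show "u \<otimes>\<^bsub>free_group X\<^esub> v \<otimes>\<^bsub>free_group X\<^esub> w = u \<otimes>\<^bsub>free_group X\<^esub> (v \<otimes>\<^bsub>free_group X\<^esub> w)"
    by (simp add: free_group_def foldr_assoc)
next
  fix u v assume "u \<in> carrier (free_group X)" "v \<in> carrier (free_group X)"
  then show "u \<otimes>\<^bsub>free_group X\<^esub> v \<in> carrier (free_group X)"
    using set_foldr[of u v] by (fastforce simp: free_group_def intro: reduced_foldr)
next
  fix w assume w: "w \<in> carrier (free_group X)"
  define u where "u = foldr cancel_cons (map inv_letter (rev w)) []"
  have "foldr cancel_cons (map inv_letter (rev v)) v = []" for v :: "'a letter list"
    by (induction v) (simp_all add: cancel_cons_def)
  then have "foldr cancel_cons u w = []"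
    using w by (simp add: u_def foldr_assoc free_group_def)
  moreover have "u \<in> carrier (free_group X)"
    using w set_foldr[of "map inv_letter (rev w)" "[]"]
    by (fastforce simp: u_def free_group_def intro: reduced_foldr)
  ultimately show "\<exists>u\<in>carrier (free_group X). u \<otimes>\<^bsub>free_group X\<^esub> w = \<one>\<^bsub>free_group X\<^esub>"
    by (auto simp: free_group_def)
qed (auto simp: free_group_def)

lemma exponent_sum_Cons: "exponent_sum (l # w) = (if snd l then 1 else - 1) + exponent_sum w"
  by (simp add: exponent_sum_def)

lemma exponent_sum_cancel_cons:
  "exponent_sum (cancel_cons l w) = (if snd l then 1 else - 1) + exponent_sum w"
  by (cases w) (auto simp: cancel_cons_def exponent_sum_Cons inv_letter_def)

lemma exponent_sum_foldr:
  "exponent_sum (foldr cancel_cons u w) = exponent_sum u + exponent_sum w"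
  by (induction u) (simp_all add: exponent_sum_cancel_cons exponent_sum_Cons, simp add: exponent_sum_def)

lemma group_F2_cubed: "group F2_cubed"
  by (intro DirProd_group group_free_group)

lemma stallings_hom_hom: "stallings_hom \<in> hom F2_cubed integer_group"
  by (auto simp: hom_def stallings_hom_def DirProd_def free_group_def integer_group_def
      exponent_sum_foldr)

lemma stallings_hom_standard_generators: "g \<in> standard_generators \<Longrightarrow> stallings_hom g = 1"
  by (auto simp: standard_generators_def stallings_hom_def exponent_sum_def)

lemma free_group_hom_eq_exponent_sum:
  assumes h: "h \<in> hom (free_group X) integer_group"
    and gen: "\<And>x. x \<in> X \<Longrightarrow> h [(x, True)] = (1::int)"
    and w: "w \<in> carrier (free_group X)"
  shows "h w = exponent_sum w"
proof -
  interpret group_hom "free_group X" integer_group h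
    using h by (simp add: group_hom_def group_hom_axioms_def group_free_group)
  have one: "h [] = 0"
    using hom_one by (simp add: free_group_def integer_group_def)
  have mult: "h (foldr cancel_cons u v) = h u + h v"
    if "u \<in> carrier (free_group X)" "v \<in> carrier (free_group X)" for u v
    using hom_mult[OF that] by (simp add: free_group_def integer_group_def)
  have inv_gen: "h [(x, False)] = - 1" if "x \<in> X" for x
  proof -
    have "h (foldr cancel_cons [(x, False)] [(x, True)]) = h [(x, False)] + h [(x, True)]"
      using that by (intro mult) (auto simp: free_group_def reduced_Cons)
    then show ?thesis
      using that by (simp add: cancel_cons_def inv_letter_def one gen)
  qed
  show ?thesis
    using w
  proof (induction w)
    case Nil
    then show ?case by (simp add: one exponent_sum_def)
  next
    case (Cons l w)
    from Cons.prems have l: "[l] \<in> carrier (free_group X)" and w: "w \<in> carrier (free_group X)"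
      and red: "reduced (l # w)" and X: "fst l \<in> X"
      by (auto simp: free_group_def reduced_Cons)
    have "cancel_cons l w = l # w"
      using red by (auto simp: cancel_cons_def reduced_Cons)
    then have "h (l # w) = h [l] + h w"
      using mult[OF l w] by simp
    moreover have "h [l] = (if snd l then 1 else - 1)"
      using gen[OF X] inv_gen[OF X] by (cases l; cases "snd l") auto
    ultimately show ?case
      using Cons.IH[OF w] by (simp add: exponent_sum_Cons)
  qed
qed

lemma stallings_hom_unique:
  assumes h: "h \<in> hom F2_cubed integer_group"
    and gen: "\<And>g. g \<in> standard_generators \<Longrightarrow> h g = 1"
    and g: "g \<in> carrier F2_cubed"
  shows "h g = stallings_hom g"
proof -
  obtain u v w where g_eq: "g = (u, v, w)" by (metis prod.exhaust)
  have nil: "[] \<in> carrier F2" and nil_l: "foldr cancel_cons [] x = x" for x :: "nat letter list"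
    by (auto simp: free_group_def)
  have nil_r: "foldr cancel_cons x [] = x" if "x \<in> carrier F2" for x
    using that by (simp add: free_group_def foldr_Nil_right)
  have uvw: "u \<in> carrier F2" "v \<in> carrier F2" "w \<in> carrier F2"
    using g by (auto simp: g_eq)
  have mult: "h (foldr cancel_cons a a', foldr cancel_cons b b', foldr cancel_cons c c')
      = h (a, b, c) + h (a', b', c')"
    if "a \<in> carrier F2" "b \<in> carrier F2" "c \<in> carrier F2"
      "a' \<in> carrier F2" "b' \<in> carrier F2" "c' \<in> carrier F2" for a b c a' b' c'
    using hom_mult[OF h, of "(a, b, c)" "(a', b', c')"] that
    by (simp add: DirProd_def free_group_def integer_group_def)
  have homs: "(\<lambda>x. h (x, [], [])) \<in> hom F2 integer_group"
    "(\<lambda>x. h ([], x, [])) \<in> hom F2 integer_group"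
    "(\<lambda>x. h ([], [], x)) \<in> hom F2 integer_group"
    using mult[OF _ nil nil _ nil nil] mult[OF nil _ nil nil _ nil] mult[OF nil nil _ nil nil _]
    by (auto simp: hom_def integer_group_def) (simp_all add: free_group_def)
  have "h (u, [], []) = exponent_sum u" "h ([], v, []) = exponent_sum v"
    "h ([], [], w) = exponent_sum w"
    by (rule free_group_hom_eq_exponent_sum[OF homs(1) _ uvw(1)]
             free_group_hom_eq_exponent_sum[OF homs(2) _ uvw(2)]
             free_group_hom_eq_exponent_sum[OF homs(3) _ uvw(3)],
        rule gen, force simp: standard_generators_def)+
  moreover have "h (u, v, w) = h (u, [], []) + h ([], v, []) + h ([], [], w)"
    using mult[OF uvw(1) nil nil nil uvw(2,3)] mult[OF nil uvw(2) nil nil nil uvw(3)]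
    by (simp add: nil_r[OF uvw(1)] nil_r[OF uvw(2)])
  ultimately show ?thesis
    by (simp add: g_eq stallings_hom_def)
qed


section \<open>One-ended groups\<close>

text \<open>
  The vertex sets of the connected components of the (right) Cayley graph of \<open>G\<close> with respect to
  \<open>S\<close> after removal of the vertices in \<open>K\<close>.
\<close>

definition cayley_components :: "('g, 'm) monoid_scheme \<Rightarrow> 'g set \<Rightarrow> 'g set \<Rightarrow> 'g set set" where
  "cayley_components G S K =
     (let V = carrier G - K;
          R = {(x, y). x \<in> V \<and> y \<in> V \<and> (\<exists>s\<in>S. y = x \<otimes>\<^bsub>G\<^esub> s \<or> x = y \<otimes>\<^bsub>G\<^esub> s)}
      in (\<lambda>x. R\<^sup>* `` {x}) ` V)"

definition one_ended :: "('g, 'm) monoid_scheme \<Rightarrow> bool" where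
  "one_ended G \<longleftrightarrow>
     (\<exists>S. finite S \<and> S \<subseteq> carrier G \<and> generate G S = carrier G \<and>
        (\<forall>K. finite K \<and> K \<subseteq> carrier G \<longrightarrow> (\<exists>!C. C \<in> cayley_components G S K \<and> infinite C)))"


section \<open>CW complexes\<close>

definition cw_disc :: "nat \<Rightarrow> (nat \<Rightarrow> real) set" where
  "cw_disc n = {x \<in> topspace (Euclidean_space n). (\<Sum>i<n. (x i)\<^sup>2) \<le> 1}"

definition cw_open_disc :: "nat \<Rightarrow> (nat \<Rightarrow> real) set" where
  "cw_open_disc n = {x \<in> topspace (Euclidean_space n). (\<Sum>i<n. (x i)\<^sup>2) < 1}"

text \<open>A cell is given by its dimension and its characteristic map, defined on the closed disc.\<close>

type_synonym 'a cell = "nat \<times> ((nat \<Rightarrow> real) \<Rightarrow> 'a)"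

definition closed_cell :: "'a cell \<Rightarrow> 'a set" where
  "closed_cell e = snd e ` cw_disc (fst e)"

definition open_cell :: "'a cell \<Rightarrow> 'a set" where
  "open_cell e = snd e ` cw_open_disc (fst e)"

definition cell_boundary :: "'a cell \<Rightarrow> 'a set" where
  "cell_boundary e = snd e ` (cw_disc (fst e) - cw_open_disc (fst e))"

definition cw_complex :: "'a::topological_space set \<Rightarrow> 'a cell set \<Rightarrow> bool" where
  "cw_complex X E \<longleftrightarrow>
     Hausdorff_space (top_of_set X) \<and>
     (\<forall>e\<in>E. continuous_on (cw_disc (fst e)) (snd e) \<and>
        (\<exists>g. homeomorphism (cw_open_disc (fst e)) (open_cell e) (snd e) g)) \<and>
     \<Union> (open_cell ` E) = X \<and>
     (\<forall>e\<in>E. \<forall>e'\<in>E. e \<noteq> e' \<longrightarrow> open_cell e \<inter> open_cell e' = {}) \<and>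
     (\<forall>e\<in>E. \<exists>F. finite F \<and> F \<subseteq> {e'\<in>E. fst e' < fst e} \<and> cell_boundary e \<subseteq> \<Union> (open_cell ` F)) \<and>
     (\<forall>e\<in>E. closed_cell e \<subseteq> X) \<and>
     (\<forall>T\<subseteq>X. closedin (top_of_set X) T \<longleftrightarrow>
        (\<forall>e\<in>E. closedin (top_of_set (closed_cell e)) (T \<inter> closed_cell e)))"

definition finite_subcomplex :: "'a cell set \<Rightarrow> 'a set \<Rightarrow> bool" where
  "finite_subcomplex E C \<longleftrightarrow>
     (\<exists>F. finite F \<and> F \<subseteq> E \<and> C = \<Union> (open_cell ` F) \<and> (\<forall>e\<in>F. closed_cell e \<subseteq> C))"

text \<open>
  The cells of the induced CW structure on a covering space \<open>p : Y \<rightarrow> X\<close>: the lifts of the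
  characteristic maps of \<open>X\<close>.  They are taken to be \<open>undefined\<close> off the disc, so that every cell is
  listed only once.
\<close>

definition lifted_cells ::
  "'b::topological_space set \<Rightarrow> ('b \<Rightarrow> 'a) \<Rightarrow> 'a cell set \<Rightarrow> 'b cell set" where
  "lifted_cells Y p E =
     {(n, \<psi>). continuous_on (cw_disc n) \<psi> \<and> \<psi> ` cw_disc n \<subseteq> Y \<and> \<psi> \<in> extensional (cw_disc n) \<and>
        (\<exists>\<phi>. (n, \<phi>) \<in> E \<and> (\<forall>x\<in>cw_disc n. p (\<psi> x) = \<phi> x))}"


section \<open>Fundamental group and simple connectivity at infinity\<close>

definition loops_at :: "'a::topological_space set \<Rightarrow> 'a \<Rightarrow> (real \<Rightarrow> 'a) set" where
  "loops_at X a = {\<gamma>. path \<gamma> \<and> path_image \<gamma> \<subseteq> X \<and> pathstart \<gamma> = a \<and> pathfinish \<gamma> = a}"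

definition homotopy_class :: "'a::topological_space set \<Rightarrow> (real \<Rightarrow> 'a) \<Rightarrow> (real \<Rightarrow> 'a) set" where
  "homotopy_class X \<gamma> = {\<delta>. homotopic_paths X \<gamma> \<delta>}"

definition fundamental_group ::
  "'a::topological_space set \<Rightarrow> 'a \<Rightarrow> (real \<Rightarrow> 'a) set monoid" where
  "fundamental_group X a =
     \<lparr>carrier = homotopy_class X ` loops_at X a,
      monoid.mult = (\<lambda>P Q. \<Union>\<gamma>\<in>P. \<Union>\<delta>\<in>Q. homotopy_class X (\<gamma> +++ \<delta>)),
      one = homotopy_class X (\<lambda>_. a)\<rparr>"

definition universal_covering ::
  "'b::topological_space set \<Rightarrow> ('b \<Rightarrow> 'a) \<Rightarrow> 'a::topological_space set \<Rightarrow> bool" where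
  "universal_covering Y p X \<longleftrightarrow> covering_space Y p X \<and> simply_connected Y"

definition loops_trivial_at_infinity :: "'a::topological_space set \<Rightarrow> 'a cell set \<Rightarrow> bool" where
  "loops_trivial_at_infinity Y E \<longleftrightarrow>
     (\<forall>C. finite_subcomplex E C \<longrightarrow>
        (\<exists>D. finite_subcomplex E D \<and>
           (\<forall>\<gamma>. path \<gamma> \<and> pathfinish \<gamma> = pathstart \<gamma> \<and> path_image \<gamma> \<subseteq> Y - D \<longrightarrow>
              homotopic_paths (Y - C) \<gamma> (\<lambda>_. pathstart \<gamma>))))"

text \<open>
  HOL cannot quantify over all types of points, so all spaces are taken inside
  \<open>\<ell>\<^sup>\<infinity>\<close>.  This is no loss of generality: every separable metric space embeds isometrically in
  \<open>\<ell>\<^sup>\<infinity>\<close>, and finite connected CW complexes and their universal covers (which are countable and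
  locally finite) are separable and metrizable.
\<close>

type_synonym linfty = "nat \<Rightarrow>\<^sub>C real"

text \<open>
  Finite presentability of \<open>G\<close> needs no separate clause: it is equivalent to the existence of a
  finite connected CW complex with fundamental group isomorphic to \<open>G\<close>.
\<close>

definition simply_connected_at_infinity :: "('g, 'm) monoid_scheme \<Rightarrow> bool" where
  "simply_connected_at_infinity G \<longleftrightarrow>
     one_ended G \<and>
     (\<exists>(A :: linfty set) E.
        cw_complex A E \<and> finite E \<and> connected A \<and>
        (\<exists>a\<in>A. fundamental_group A a \<cong> G) \<and>
        (\<exists>(Y :: linfty set) p.
           universal_covering Y p A \<and> loops_trivial_at_infinity Y (lifted_cells Y p E)))"

end

theory Submission
  imports Defs
begin

text \<open>
  Let \<open>T\<close> be the Cayley tree of the free group on two generators and \<open>h : T \<rightarrow> \<real>\<close> its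
  height.  Stallings' group acts freely and cocompactly on the level set
  \<open>Y = {(x, y, z) \<in> T\<^sup>3. h x + h y + h z = 0}\<close>, a triangle complex whose vertices are the
  elements of the group.  Over a line of \<open>T\<close> on which \<open>h\<close> is bijective, \<open>Y\<close> is a copy of
  \<open>T\<^sup>2\<close>, and every edge of \<open>T\<close> lies on such a line; as the fibres of \<open>Y \<rightarrow> T\<close> over
  vertices are connected, \<open>Y\<close> is a tree of simply connected pieces glued along connected ones,
  hence simply connected.

  The same argument applies to the part of \<open>Y\<close> in a product of branches \<open>S\<^sub>1 \<times> S\<^sub>2 \<times> S\<^sub>3\<close> of \<open>T\<close>.
  Outside the product of three balls of radius \<open>n\<close>, \<open>Y\<close> is covered by the sets where the \<open>i\<close>-th
  coordinate lies in a given branch beyond the ball.  These sets are simply connected, they meet in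
  connected sets, and their nerve is the join of three finite sets, which is simply connected.  So
  already the complement of the product of the balls is simply connected.
\<close>

section \<open>Local systems on simplicial complexes\<close>

text \<open>The connectivity arguments rest on a balance of heights: deleting the last letter of one
  coordinate and appending a letter of the same sign to another keeps a point on the level set. In
  rank two such a letter always exists, since a reduced word can be prolonged by a letter of either
  sign. Fixing one of the three coordinates leaves a level set in a product of two trees, which is
  connected; with two factors it would be discrete. Simple connectivity is first expressed by flat
  sections over vertex sets and turned into homotopies of paths only once, in
  \<open>body_loop_nullhomotopic\<close>. The notion is relative to an ambient set \<open>W\<close>:
  the pieces beyond a ball contain both ends of an edge only one step further out, so that loops in
  \<open>far (Suc n)\<close> are contracted in \<open>far n\<close>, which is enough at infinity.
  The level complex and its quotient must both be concrete subsets of \<open>linfty\<close>. The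
  former is spanned by unit vectors; the latter consists of sequences of distances to orbits, and
  its covering property comes from a uniform lower bound on displacements.\<close>

definition links :: "('v set \<Rightarrow> bool) \<Rightarrow> 'v set \<Rightarrow> ('v \<times> 'v) set" where
  "links sx U = {(u, v). u \<in> U \<and> v \<in> U \<and> sx {u, v}}"

abbreviation tree_adjacent :: "'l list \<Rightarrow> 'l list \<Rightarrow> bool" where
  "tree_adjacent x y \<equiv> y = x \<or> (\<exists>l. y = x @ [l]) \<or> (\<exists>l. x = y @ [l])"

definition conn :: "('v set \<Rightarrow> bool) \<Rightarrow> 'v set \<Rightarrow> bool" where
  "conn sx U \<longleftrightarrow> (\<forall>u\<in>U. \<forall>v\<in>U. (u, v) \<in> (links sx U)\<^sup>*)"

lemma sym_links: "sym (links sx U)"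
  by (auto simp: sym_def links_def insert_commute)

lemma links_rtrancl_sym: "(u, v) \<in> (links sx U)\<^sup>* \<Longrightarrow> (v, u) \<in> (links sx U)\<^sup>*"
  by (meson sym_links sym_rtrancl symD)

lemma links_rtrancl_mono: "(u, v) \<in> (links sx U)\<^sup>* \<Longrightarrow> U \<subseteq> U' \<Longrightarrow> (u, v) \<in> (links sx U')\<^sup>*"
  by (erule rev_subsetD, rule rtrancl_mono) (auto simp: links_def)

lemma connI_base:
  assumes "\<And>u. u \<in> U \<Longrightarrow> (u, c) \<in> (links sx U)\<^sup>*" shows "conn sx U"
  unfolding conn_def by (meson assms links_rtrancl_sym rtrancl_trans)

text \<open>Each vertex is moved inside its connected fibre to the outer end of a linking edge and
  across it into the parent fibre. After finitely many letters everything has arrived in the fibre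
  over the root \<open>r\<close>, which is connected too.\<close>

lemma conn_tree:
  fixes \<pi> :: "'v \<Rightarrow> 'l list"
  assumes root: "\<And>u. u \<in> U \<Longrightarrow> \<exists>w. \<pi> u = r @ w"
    and fibre: "\<And>w. conn sx {u \<in> U. \<pi> u = w}"
    and link: "\<And>u w l. u \<in> U \<Longrightarrow> \<pi> u = r @ w @ [l] \<Longrightarrow>
      \<exists>v\<in>U. \<exists>v'\<in>U. \<pi> v = r @ w \<and> \<pi> v' = \<pi> u \<and> sx {v, v'}"
  shows "conn sx U"
proof -
  have fib: "(u, v) \<in> (links sx U)\<^sup>*" if "u \<in> U" "v \<in> U" "\<pi> u = \<pi> v" for u v
  proof (rule links_rtrancl_mono)
    show "(u, v) \<in> (links sx {x \<in> U. \<pi> x = \<pi> v})\<^sup>*"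
      using fibre[of "\<pi> v"] that unfolding conn_def by blast
  qed auto
  have *: "u \<in> U \<Longrightarrow> \<pi> u = r @ w \<Longrightarrow> \<exists>c\<in>U. \<pi> c = r \<and> (u, c) \<in> (links sx U)\<^sup>*" for w u
  proof (induction w arbitrary: u rule: rev_induct)
    case (snoc l w)
    obtain v v' where v: "v \<in> U" "v' \<in> U" "\<pi> v = r @ w" "\<pi> v' = \<pi> u" "sx {v, v'}"
      using link[of u w l] snoc.prems by blast
    obtain c where c: "c \<in> U" "\<pi> c = r" "(v, c) \<in> (links sx U)\<^sup>*"
      using snoc.IH[OF v(1,3)] by blast
    have "(u, v') \<in> (links sx U)\<^sup>*" using fib[of u v'] snoc.prems v by simp
    moreover have "(v', v) \<in> links sx U" using v by (simp add: links_def insert_commute)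
    ultimately have "(u, c) \<in> (links sx U)\<^sup>*"
      by (rule rtrancl_trans[OF rtrancl_into_rtrancl c(3)])
    then show ?case using c by blast
  qed auto
  show ?thesis
    unfolding conn_def
  proof (intro ballI)
    fix u v assume uv: "u \<in> U" "v \<in> U"
    obtain w w' where w: "\<pi> u = r @ w" "\<pi> v = r @ w'" using root uv by meson
    obtain c where c: "c \<in> U" "\<pi> c = r" "(u, c) \<in> (links sx U)\<^sup>*"
      using *[OF uv(1) w(1)] by blast
    obtain d where d: "d \<in> U" "\<pi> d = r" "(v, d) \<in> (links sx U)\<^sup>*"
      using *[OF uv(2) w(2)] by blast
    have "(c, d) \<in> (links sx U)\<^sup>*" using fib[of c d] c d by simp
    then show "(u, v) \<in> (links sx U)\<^sup>*"
      using c(3) links_rtrancl_sym[OF d(3)] by (blast intro: rtrancl_trans)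
  qed
qed

section \<open>Flat sections and their gluing\<close>

locale local_system =
  fixes sx :: "'v set \<Rightarrow> bool" and W :: "'v set" and F :: "'v \<Rightarrow> 'h set" and t :: "'v \<Rightarrow> 'v \<Rightarrow> 'h \<Rightarrow> 'h"
  assumes t_in: "\<lbrakk>u \<in> W; v \<in> W; sx {u, v}; a \<in> F u\<rbrakk> \<Longrightarrow> t u v a \<in> F v"
    and t_triangle: "\<lbrakk>u \<in> W; v \<in> W; w \<in> W; sx {u, v, w}; a \<in> F u\<rbrakk> \<Longrightarrow> t v w (t u v a) = t u w a"
    and t_refl: "\<lbrakk>u \<in> W; a \<in> F u\<rbrakk> \<Longrightarrow> t u u a = a"
begin

definition flat_section :: "'v set \<Rightarrow> ('v \<Rightarrow> 'h) \<Rightarrow> bool" where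
  "flat_section U \<sigma> \<longleftrightarrow> (\<forall>u\<in>U. \<sigma> u \<in> F u) \<and> (\<forall>u\<in>U. \<forall>v\<in>U. sx {u, v} \<longrightarrow> t u v (\<sigma> u) = \<sigma> v)"

text \<open>
  For the local system of homotopy classes of paths in \<open>W\<close> this says that the inclusion of \<open>U\<close> in
  \<open>W\<close> is trivial on fundamental groups.  Sections over connected sets are unique, so they glue;
  this replaces van Kampen's theorem below.
\<close>

definition good :: "'v set \<Rightarrow> bool" where
  "good U \<longleftrightarrow> U \<subseteq> W \<and> (\<forall>v\<in>U. \<forall>a\<in>F v. \<exists>\<sigma>. flat_section U \<sigma> \<and> \<sigma> v = a)"

lemma flat_section_subset: "flat_section U \<sigma> \<Longrightarrow> U' \<subseteq> U \<Longrightarrow> flat_section U' \<sigma>"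
  by (auto simp: flat_section_def)

lemma good_subset: "good U \<Longrightarrow> U' \<subseteq> U \<Longrightarrow> good U'"
  unfolding good_def by (meson flat_section_subset subset_trans subsetD)

lemma t_inverse: "\<lbrakk>u \<in> W; v \<in> W; sx {u, v}; a \<in> F u\<rbrakk> \<Longrightarrow> t v u (t u v a) = a"
  using t_triangle[of u v u a] t_refl[of u a] by (simp add: insert_commute)

lemma flat_section_unique:
  assumes U: "conn sx U" "flat_section U \<sigma>" "flat_section U \<tau>" "u \<in> U" "\<sigma> u = \<tau> u" "v \<in> U"
  shows "\<sigma> v = \<tau> v"
proof -
  have "(u, v) \<in> (links sx U)\<^sup>*" using U by (auto simp: conn_def)
  then show ?thesis
  proof (induction rule: rtrancl_induct)
    case (step y z)
    then have "t y z (\<sigma> y) = \<sigma> z" "t y z (\<tau> y) = \<tau> z"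
      using U(2,3) by (auto simp: links_def flat_section_def)
    then show ?case using step by simp
  qed (use U in auto)
qed

text \<open>Along a path from \<open>v\<close>, a prescribed value at the next vertex is carried
  back over the last edge, extended from there by induction, and returns unchanged by
  \<open>t_inverse\<close>.\<close>

lemma good_connI:
  assumes U: "conn sx U" "U \<subseteq> W" and v: "v \<in> U" "\<And>a. a \<in> F v \<Longrightarrow> \<exists>\<sigma>. flat_section U \<sigma> \<and> \<sigma> v = a"
  shows "good U"
  unfolding good_def
proof (intro conjI ballI)
  fix w a assume w: "w \<in> U" and a: "a \<in> F w"
  have "(v, w) \<in> (links sx U)\<^sup>*" using U w v by (auto simp: conn_def)
  then have "\<forall>a\<in>F w. \<exists>\<sigma>. flat_section U \<sigma> \<and> \<sigma> w = a"
  proof (induction rule: rtrancl_induct)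
    case (step y z)
    then have yz: "y \<in> U" "z \<in> U" "sx {y, z}" "sx {z, y}" by (auto simp: links_def insert_commute)
    show ?case
    proof
      fix a assume a: "a \<in> F z"
      then have "t z y a \<in> F y" using t_in yz U(2) by blast
      then obtain \<sigma> where "flat_section U \<sigma>" "\<sigma> y = t z y a" using step by blast
      moreover from this have "\<sigma> z = t y z (t z y a)" using yz by (auto simp: flat_section_def)
      ultimately show "\<exists>\<sigma>. flat_section U \<sigma> \<and> \<sigma> z = a" using t_inverse yz a U(2) by (metis subsetD)
    qed
  qed (use v in auto)
  then show "\<exists>\<sigma>. flat_section U \<sigma> \<and> \<sigma> w = a" using a by blast
qed (use U in auto)

text \<open>Transport from the apex \<open>c\<close> is itself the section: every edge of
  \<open>U\<close> spans a simplex with \<open>c\<close>, and \<open>t_triangle\<close> on that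
  simplex is the flatness condition.\<close>

lemma good_cone:
  assumes U: "U \<subseteq> W" "c \<in> U" and sx: "\<And>u. u \<in> U \<Longrightarrow> sx {c, u}"
    "\<And>u v. u \<in> U \<Longrightarrow> v \<in> U \<Longrightarrow> sx {u, v} \<Longrightarrow> sx {c, u, v}"
  shows "good U"
proof (rule good_connI[of U c])
  show "conn sx U"
    by (rule connI_base[of _ c]) (use assms in \<open>auto simp: links_def insert_commute\<close>)
  fix a assume a: "a \<in> F c"
  have "flat_section U (\<lambda>u. t c u a)"
    unfolding flat_section_def using U sx a t_in t_triangle by (auto simp: subset_iff)
  then show "\<exists>\<sigma>. flat_section U \<sigma> \<and> \<sigma> c = a" using t_refl U a by blast
qed (use assms in auto)

text \<open>The value at one vertex of \<open>A\<close> extends over \<open>U\<close>, and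
  uniqueness over the connected set \<open>A\<close> forces agreement with the given section on all
  of \<open>A\<close>. This is the gluing step of \<open>good_tree\<close>.\<close>

lemma good_extend:
  assumes "good U" "conn sx A" "A \<subseteq> U" "flat_section A \<sigma>" "A \<noteq> {}"
  obtains \<tau> where "flat_section U \<tau>" "\<And>u. u \<in> A \<Longrightarrow> \<tau> u = \<sigma> u"
proof -
  obtain v where v: "v \<in> A" using assms by blast
  then obtain \<tau> where \<tau>: "flat_section U \<tau>" "\<tau> v = \<sigma> v"
    using assms unfolding good_def flat_section_def by blast
  then show ?thesis
    using that flat_section_unique[OF assms(2) flat_section_subset[OF \<tau>(1) assms(3)] assms(4) v]
      by blast
qed

text \<open>\<open>U\<close> is a tree of slabs, one over each edge, glued along connected fibres. A
  section is continued outwards from the root fibre one slab at a time; each slab is entered through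
  a single fibre, so no cycle of compatibilities arises.\<close>

lemma good_tree:
  fixes \<pi> :: "'v \<Rightarrow> 'l list"
  assumes U: "U \<subseteq> W" "U \<noteq> {}"
    and root: "\<And>u. u \<in> U \<Longrightarrow> \<exists>w. \<pi> u = r @ w"
    and adj: "\<And>u v. u \<in> U \<Longrightarrow> v \<in> U \<Longrightarrow> sx {u, v} \<Longrightarrow>
      tree_adjacent (\<pi> u) (\<pi> v)"
    and fibre: "\<And>w. conn sx {u \<in> U. \<pi> u = w}"
    and link: "\<And>u w l. u \<in> U \<Longrightarrow> \<pi> u = r @ w @ [l] \<Longrightarrow>
      \<exists>v\<in>U. \<exists>v'\<in>U. \<pi> v = r @ w \<and> \<pi> v' = \<pi> u \<and> sx {v, v'}"
    and base: "good {u \<in> U. \<pi> u = r}"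
    and slab: "\<And>u w l. u \<in> U \<Longrightarrow> \<pi> u = r @ w @ [l] \<Longrightarrow> good {u \<in> U. \<pi> u = r @ w \<or> \<pi> u = r @ w @ [l]}"
  shows "good U"
proof -
  define fib where "fib w = {u \<in> U. \<pi> u = r @ w}" for w
  have conn: "conn sx U" by (rule conn_tree[where \<pi> = \<pi> and r = r]) (use root fibre link in auto)
  have ne: "fib w \<noteq> {}" if "fib (w @ [l]) \<noteq> {}" for w l
    using link that unfolding fib_def by fast
  have nonempty: "u \<in> U \<Longrightarrow> \<pi> u = r @ w \<Longrightarrow> fib [] \<noteq> {}" for u w
  proof (induction w arbitrary: u rule: rev_induct)
    case (snoc l w)
    then show ?case using link[of u w l] by blast
  qed (auto simp: fib_def)
  obtain u w where "u \<in> U" "\<pi> u = r @ w" using U root by blast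
  from nonempty[OF this] obtain v where v: "v \<in> U" "\<pi> v = r" by (auto simp: fib_def)
  show ?thesis
  proof (rule good_connI[OF conn U(1) v(1)])
    fix a assume a: "a \<in> F v"
    have "good (fib [])" "v \<in> fib []" using base v by (auto simp: fib_def)
    then obtain \<sigma>0 where \<sigma>0: "flat_section (fib []) \<sigma>0" "\<sigma>0 v = a"
      using a unfolding good_def by blast
    have step: "\<exists>\<tau>. flat_section (fib (w @ [l]) \<union> fib w) \<tau> \<and> (\<forall>u\<in>fib w. \<tau> u = \<sigma> u)"
      if \<sigma>: "flat_section (fib w) \<sigma>" and n: "fib (w @ [l]) \<noteq> {}" for w l \<sigma>
    proof -
      have eq: "fib (w @ [l]) \<union> fib w = {u \<in> U. \<pi> u = r @ w \<or> \<pi> u = r @ w @ [l]}"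
        by (auto simp: fib_def)
      have "good (fib (w @ [l]) \<union> fib w)"
        unfolding eq using n slab by (auto simp: fib_def)
      moreover have "conn sx (fib w)" unfolding fib_def by (rule fibre)
      ultimately obtain \<tau> where "flat_section (fib (w @ [l]) \<union> fib w) \<tau>" "\<And>u. u \<in> fib w \<Longrightarrow> \<tau> u = \<sigma> u"
        using good_extend[of "fib (w @ [l]) \<union> fib w" "fib w" \<sigma>] \<sigma> ne[OF n] by auto
      then show ?thesis by blast
    qed
    \<comment> \<open>The choice at \<open>w\<close> is a section over the slab between
      \<open>w\<close> and its parent that continues the parent's choice. It consults
      \<open>f\<close> only at \<open>butlast w\<close>, so well-founded choice along the length
      applies; words with empty fibre are exempted because no slab is available there.\<close>
    define P where "P = (\<lambda>f w \<tau>. fib w \<noteq> {} \<longrightarrow> (if w = [] then \<tau> = \<sigma>0 else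
        flat_section (fib w \<union> fib (butlast w)) \<tau> \<and> (\<forall>u\<in>fib (butlast w). \<tau> u = f (butlast w) u)))"
    have "\<exists>f. \<forall>w. P f w (f w)"
    proof (rule dependent_wf_choice[of "Wellfounded.measure length"])
      fix f :: "'l list \<Rightarrow> 'v \<Rightarrow> 'h" and w
      assume IH: "\<And>y. (y, w) \<in> Wellfounded.measure length \<Longrightarrow> P f y (f y)"
      show "\<exists>\<tau>. P f w \<tau>"
      proof (cases w rule: rev_cases)
        case (snoc ys y)
        show ?thesis
        proof (cases "fib w = {}")
          case False
          then have "fib ys \<noteq> {}" using ne snoc by blast
          moreover have "P f ys (f ys)" using IH snoc by simp
          ultimately have "flat_section (fib ys) (f ys)"
            using \<sigma>0 by (auto simp: P_def split: if_splits intro: flat_section_subset)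
          from step[OF this, of y] show ?thesis using False snoc by (auto simp: P_def)
        qed (auto simp: P_def)
      qed (auto simp: P_def)
    qed (auto simp: P_def)
    then obtain f where f: "P f w (f w)" for w by blast
    have f_sec: "flat_section (fib w) (f w)" if "fib w \<noteq> {}" for w
      using f[of w] that \<sigma>0 by (auto simp: P_def split: if_splits intro: flat_section_subset)
    have f_step: "flat_section (fib (w @ [l]) \<union> fib w) (f (w @ [l]))"
      "\<forall>u\<in>fib w. f (w @ [l]) u = f w u" if "fib (w @ [l]) \<noteq> {}" for w l
      using f[of "w @ [l]"] that by (auto simp: P_def)
    \<comment> \<open>On the fibre of \<open>w\<close>, the choices at \<open>w\<close> and at the
      children of \<open>w\<close> coincide by \<open>f_step\<close>, so reading the value off at
      the word of \<open>u\<close> itself gives a function that is flat on every slab.\<close>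
    define \<sigma> where "\<sigma> u = f (drop (length r) (\<pi> u)) u" for u
    have \<sigma>_fib: "\<sigma> u = f w u" if "u \<in> fib w" for u w
      using that by (simp add: \<sigma>_def fib_def)
    have fibI: "\<exists>w. u \<in> fib w" if "u \<in> U" for u using that root by (auto simp: fib_def)
    have "flat_section U \<sigma>"
      unfolding flat_section_def
    proof (intro conjI ballI impI)
      fix u assume "u \<in> U"
      then obtain w where "u \<in> fib w" using fibI by blast
      then show "\<sigma> u \<in> F u" using \<sigma>_fib f_sec[of w] by (auto simp: flat_section_def)
    next
      fix u v assume uv: "u \<in> U" "v \<in> U" "sx {u, v}"
      obtain w where w: "u \<in> fib w" using fibI uv by blast
      obtain w' where w': "v \<in> fib w'" using fibI uv by blast
      from adj[OF uv] w w' consider "w' = w" | l where "w' = w @ [l]" | l where "w = w' @ [l]"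
        by (auto simp: fib_def)
      then show "t u v (\<sigma> u) = \<sigma> v"
      proof cases
        case 1
        then show ?thesis using f_sec[of w] w w' uv \<sigma>_fib[of _ w] by (auto simp: flat_section_def)
      next
        case 2
        then have n: "fib (w @ [l]) \<noteq> {}" using w w' by auto
        have "\<sigma> u = f (w @ [l]) u" "\<sigma> v = f (w @ [l]) v"
          using f_step(2)[OF n] \<sigma>_fib[OF w] \<sigma>_fib[OF w'] w w' 2 by auto
        then show ?thesis using f_step(1)[OF n] w w' uv unfolding flat_section_def 2 by auto
      next
        case 3
        then have n: "fib (w' @ [l]) \<noteq> {}" using w w' by auto
        have "\<sigma> u = f (w' @ [l]) u" "\<sigma> v = f (w' @ [l]) v"
          using f_step(2)[OF n] \<sigma>_fib[OF w] \<sigma>_fib[OF w'] w w' 3 by auto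
        then show ?thesis using f_step(1)[OF n] w w' uv unfolding flat_section_def 3 by auto
      qed
    qed
    moreover have "\<sigma> v = a"
    proof -
      have "v \<in> fib []" using v by (simp add: fib_def)
      then show ?thesis using \<sigma>_fib f[of "[]"] \<sigma>0 by (auto simp: P_def)
    qed
    ultimately show "\<exists>\<sigma>. flat_section U \<sigma> \<and> \<sigma> v = a" by blast
  qed
qed

end

text \<open>
  The sets \<open>A i p\<close> form a cover whose nerve is the join of three discrete sets, which is simply
  connected.
\<close>

lemma (in local_system) good_join:
  fixes A :: "'i \<Rightarrow> 'p \<Rightarrow> 'v set"
  assumes I: "I = {i1, i2, i3}" "i1 \<noteq> i2" "i1 \<noteq> i3" "i2 \<noteq> i3"
    and P: "P \<noteq> {}"
    and good: "\<And>i p. i \<in> I \<Longrightarrow> p \<in> P \<Longrightarrow> good (A i p)"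
    and disj: "\<And>i p q. i \<in> I \<Longrightarrow> p \<in> P \<Longrightarrow> q \<in> P \<Longrightarrow> p \<noteq> q \<Longrightarrow> A i p \<inter> A i q = {}"
    and conn: "\<And>i j p q. i \<in> I \<Longrightarrow> j \<in> I \<Longrightarrow> i \<noteq> j \<Longrightarrow> p \<in> P \<Longrightarrow> q \<in> P \<Longrightarrow> conn sx (A i p \<inter> A j q)"
    and triple: "\<And>p q r. p \<in> P \<Longrightarrow> q \<in> P \<Longrightarrow> r \<in> P \<Longrightarrow> A i1 p \<inter> A i2 q \<inter> A i3 r \<noteq> {}"
    and cover: "\<And>u. u \<in> U \<Longrightarrow> \<exists>i\<in>I. \<exists>p\<in>P. u \<in> A i p"
    and edges: "\<And>u v. u \<in> U \<Longrightarrow> v \<in> U \<Longrightarrow> sx {u, v} \<Longrightarrow> \<exists>i\<in>I. \<exists>p\<in>P. u \<in> A i p \<and> v \<in> A i p"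
  shows "good U"
  unfolding good_def
proof (intro conjI ballI subsetI)
  fix u assume "u \<in> U"
  then obtain i p where "i \<in> I" "p \<in> P" "u \<in> A i p" using cover by blast
  then show "u \<in> W" using good unfolding good_def by blast
next
  fix v a assume v: "v \<in> U" and a: "a \<in> F v"
  obtain i p where ip: "i \<in> I" "p \<in> P" "v \<in> A i p" using cover v by blast
  \<comment> \<open>The hypotheses are symmetric in the three indices, so the index of the set
    carrying the prescribed value can be put first.\<close>
  obtain j k where jk: "I = {i, j, k}" "i \<noteq> j" "i \<noteq> k" "j \<noteq> k"
  proof -
    consider "i = i1" | "i = i2" | "i = i3" using ip(1) I(1) by blast
    then show ?thesis
    proof cases
      case 1
      then show ?thesis using that[of i2 i3] I by simp
    next
      case 2
      have "I = {i2, i1, i3}" using I(1) by blast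
      then show ?thesis using that[of i1 i3] I 2 by simp
    next
      case 3
      have "I = {i3, i1, i2}" using I(1) by blast
      then show ?thesis using that[of i1 i2] I 3 by simp
    qed
  qed
  have I': "i \<in> I" "j \<in> I" "k \<in> I" using jk by auto
  have triple': "\<exists>u. u \<in> A i p \<and> u \<in> A j q \<and> u \<in> A k r" if "p \<in> P" "q \<in> P" "r \<in> P" for p q r
  proof -
    define f where "f x = (if x = i then p else if x = j then q else r)" for x
    have "f x \<in> P" for x using that by (auto simp: f_def)
    then obtain u where "u \<in> A i1 (f i1) \<inter> A i2 (f i2) \<inter> A i3 (f i3)" using triple by blast
    then have "\<forall>x\<in>I. u \<in> A x (f x)" using I by auto
    then show ?thesis using I' jk by (auto simp: f_def)
  qed
  define compat where "compat i p s j q s' \<longleftrightarrow> (\<forall>u\<in>A i p \<inter> A j q. s u = s' u)"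
    for i p j q and s s' :: "'v \<Rightarrow> 'h"
  have compat_sym: "compat i p s j q s' \<Longrightarrow> compat j q s' i p s" for i p s j q s'
    by (auto simp: compat_def)
  have compatI: "compat m p s n q s'"
    if "m \<in> I" "n \<in> I" "m \<noteq> n" "p \<in> P" "q \<in> P" "flat_section (A m p) s" "flat_section (A n q) s'"
      "u \<in> A m p" "u \<in> A n q" "s u = s' u" for m n p q s s' u
    unfolding compat_def
    using flat_section_unique[OF conn[OF that(1-5)] flat_section_subset[OF that(6)]
      flat_section_subset[OF that(7)]] that
    by blast
  have ex: "\<exists>s'. flat_section (A n q) s' \<and> compat m p s n q s'"
    if mn: "m \<in> I" "n \<in> I" "m \<noteq> n" "p \<in> P" "q \<in> P" "flat_section (A m p) s" "u \<in> A m p" "u \<in> A n q"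
      for m n p q s u
  proof -
    have "s u \<in> F u" using mn by (auto simp: flat_section_def)
    then obtain s' where "flat_section (A n q) s'" "s' u = s u"
      using good[OF mn(2,5)] mn(8) unfolding good_def by blast
    then show ?thesis using compatI[of m n p q s s' u] mn by auto
  qed
  obtain \<sigma> where \<sigma>: "flat_section (A i p) \<sigma>" "\<sigma> v = a" using good ip a unfolding good_def by blast
  \<comment> \<open>Every set of index \<open>j\<close> or \<open>k\<close> meets
    \<open>A i p\<close> and so receives a section from \<open>\<sigma>\<close>. A set of index
    \<open>j\<close> and one of index \<open>k\<close> share a vertex with \<open>A i p\<close>,
    where both sections equal \<open>\<sigma>\<close>; connectedness spreads the agreement over
    their intersection.\<close>
  have "\<exists>s. flat_section (A j q) s \<and> compat i p \<sigma> j q s" if "q \<in> P" for q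
    using ex[OF I'(1,2) jk(2) ip(2) that \<sigma>(1)] triple'[OF ip(2) that that] by blast
  then obtain sj where sj: "\<And>q. q \<in> P \<Longrightarrow> flat_section (A j q) (sj q)"
    "\<And>q. q \<in> P \<Longrightarrow> compat i p \<sigma> j q (sj q)" by metis
  have "\<exists>s. flat_section (A k q) s \<and> compat i p \<sigma> k q s" if "q \<in> P" for q
    using ex[OF I'(1,3) jk(3) ip(2) that \<sigma>(1)] triple'[OF ip(2) that that] by blast
  then obtain sk where sk: "\<And>q. q \<in> P \<Longrightarrow> flat_section (A k q) (sk q)"
    "\<And>q. q \<in> P \<Longrightarrow> compat i p \<sigma> k q (sk q)" by metis
  have jk_compat: "compat j q (sj q) k r (sk r)" if qr: "q \<in> P" "r \<in> P" for q r
  proof -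
    obtain u where u: "u \<in> A i p" "u \<in> A j q" "u \<in> A k r" using triple'[OF ip(2) qr] by blast
    then have "sj q u = sk r u" using sj(2) sk(2) qr unfolding compat_def by (metis IntI)
    then show ?thesis using compatI[OF I'(2,3) jk(4) qr sj(1) sk(1)] qr u by blast
  qed
  \<comment> \<open>The other sets of index \<open>i\<close> are disjoint from \<open>A i p\<close>,
    so their sections are imported through one fixed \<open>A j q0\<close>. Triple points in
    \<open>A j q0\<close> then give agreement with index \<open>k\<close>, and triple points in
    \<open>A k q0\<close> agreement with index \<open>j\<close>.\<close>
  obtain q0 where q0: "q0 \<in> P" using P by blast
  have "\<exists>s. flat_section (A i p') s \<and> compat j q0 (sj q0) i p' s \<and> (p' = p \<longrightarrow> s = \<sigma>)"
    if p': "p' \<in> P" for p'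
  proof (cases "p' = p")
    case True
    then show ?thesis using \<sigma> sj(2)[OF q0] compat_sym by blast
  next
    case False
    then show ?thesis using ex[OF I'(2,1) jk(2)[symmetric] q0 p' sj(1)[OF q0]] triple'[OF p' q0 q0]
      by blast
  qed
  then obtain si where si: "\<And>q. q \<in> P \<Longrightarrow> flat_section (A i q) (si q)"
    "\<And>q. q \<in> P \<Longrightarrow> compat j q0 (sj q0) i q (si q)"
    "si p = \<sigma>" using ip(2) by metis
  have ik_compat: "compat i p' (si p') k r (sk r)" if pr: "p' \<in> P" "r \<in> P" for p' r
  proof -
    obtain u where u: "u \<in> A i p'" "u \<in> A j q0" "u \<in> A k r"
      using triple'[OF pr(1) q0 pr(2)] by blast
    have "sj q0 u = si p' u" using si(2)[OF pr(1)] u unfolding compat_def by blast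
    moreover have "sj q0 u = sk r u" using jk_compat[OF q0 pr(2)] u unfolding compat_def by blast
    ultimately show ?thesis using compatI[OF I'(1,3) jk(3) pr si(1)[OF pr(1)] sk(1)[OF pr(2)]
      u(1,3)] by simp
  qed
  have ij_compat: "compat i p' (si p') j q (sj q)" if pq: "p' \<in> P" "q \<in> P" for p' q
  proof -
    obtain u where u: "u \<in> A i p'" "u \<in> A j q" "u \<in> A k q0" using triple'[OF pq q0] by blast
    have "si p' u = sk q0 u" using ik_compat[OF pq(1) q0] u unfolding compat_def by blast
    moreover have "sj q u = sk q0 u" using jk_compat[OF pq(2) q0] u unfolding compat_def by blast
    ultimately show ?thesis using compatI[OF I'(1,2) jk(2) pq si(1)[OF pq(1)] sj(1)[OF pq(2)]
      u(1,2)] by simp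
  qed
  define s where "s m = (if m = i then si else if m = j then sj else sk)" for m
  have s_flat: "flat_section (A m p) (s m p)" if "m \<in> I" "p \<in> P" for m p
    using that jk si(1) sj(1) sk(1) by (auto simp: s_def)
  have s_compat: "s m q u = s n r u"
    if mn: "m \<in> I" "n \<in> I" "q \<in> P" "r \<in> P" "u \<in> A m q" "u \<in> A n r" for m n q r u
  proof (cases "m = n")
    case True
    then have "q = r" using disj[OF mn(1,3,4)] mn(5,6) by blast
    then show ?thesis using True by simp
  next
    case False
    have "compat m q (s m q) n r (s n r)"
      using mn(1,2) False jk ij_compat[OF mn(3,4)] ik_compat[OF mn(3,4)] jk_compat[OF mn(3,4)]
        compat_sym[OF ij_compat[OF mn(4,3)]] compat_sym[OF ik_compat[OF mn(4,3)]]
        compat_sym[OF jk_compat[OF mn(4,3)]]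
      by (auto simp: s_def)
    then show ?thesis using mn(5,6) by (simp add: compat_def)
  qed
  define ix where "ix u = (SOME mp. fst mp \<in> I \<and> snd mp \<in> P \<and> u \<in> A (fst mp) (snd mp))" for u
  define \<tau> where "\<tau> u = s (fst (ix u)) (snd (ix u)) u" for u
  have \<tau>: "\<tau> u = s m q u" if "m \<in> I" "q \<in> P" "u \<in> A m q" for u m q
  proof -
    have "fst (m, q) \<in> I \<and> snd (m, q) \<in> P \<and> u \<in> A (fst (m, q)) (snd (m, q))" using that by simp
    then have "fst (ix u) \<in> I \<and> snd (ix u) \<in> P \<and> u \<in> A (fst (ix u)) (snd (ix u))"
      unfolding ix_def by (rule someI)
    then show ?thesis using s_compat that unfolding \<tau>_def by blast
  qed
  have "flat_section U \<tau>"
    unfolding flat_section_def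
  proof (intro conjI ballI impI)
    fix u assume "u \<in> U"
    then obtain m q where m: "m \<in> I" "q \<in> P" "u \<in> A m q" using cover by blast
    then show "\<tau> u \<in> F u" using \<tau>[OF m] s_flat[OF m(1,2)] unfolding flat_section_def by simp
  next
    fix u v assume uv: "u \<in> U" "v \<in> U" "sx {u, v}"
    then obtain m q where m: "m \<in> I" "q \<in> P" "u \<in> A m q" "v \<in> A m q" using edges by blast
    then show "t u v (\<tau> u) = \<tau> v"
      using \<tau>[OF m(1-3)] \<tau>[OF m(1,2,4)] s_flat[OF m(1,2)] uv unfolding flat_section_def by simp
  qed
  moreover have "\<tau> v = a" using \<tau>[OF ip] \<sigma>(2) si(3) by (simp add: s_def)
  ultimately show "\<exists>\<sigma>. flat_section U \<sigma> \<and> \<sigma> v = a" by blast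
qed

section \<open>The level complex in a product of three trees\<close>

definition words :: "nat letter list set" where "words = carrier F2"

abbreviation height :: "nat letter list \<Rightarrow> int" where "height \<equiv> exponent_sum"

abbreviation level_set :: "F2_cubed set" where "level_set \<equiv> carrier stallings_group"

definition tree_edge :: "nat letter list set \<Rightarrow> bool" where
  "tree_edge e \<longleftrightarrow> (\<exists>w l. w @ [l] \<in> words \<and> e = {w, w @ [l]})"

text \<open>
  The points of height \<open>0\<close> in the product of three trees meet every cube in a triangle, a vertex or
  the empty set.  The simplices are thus given by the vertices of height \<open>0\<close> in a single cube.
\<close>

definition is_simplex :: "F2_cubed set \<Rightarrow> bool" where
  "is_simplex s \<longleftrightarrow> s \<noteq> {} \<and> s \<subseteq> level_set \<and>
     (\<exists>a b c. tree_edge a \<and> tree_edge b \<and> tree_edge c \<and> s \<subseteq> a \<times> b \<times> c)"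

definition branch :: "nat letter list \<Rightarrow> nat letter list set" where
  "branch r = {w \<in> words. \<exists>u. w = r @ u}"

definition line :: "nat letter list \<Rightarrow> (int \<Rightarrow> nat letter list) \<Rightarrow> bool" where
  "line r \<alpha> \<longleftrightarrow> (\<forall>n. \<alpha> n \<in> branch r \<and> height (\<alpha> n) = n \<and> tree_edge {\<alpha> n, \<alpha> (n + 1)})"

definition level_region ::
  "nat letter list \<Rightarrow> nat letter list \<Rightarrow> nat letter list \<Rightarrow> F2_cubed set" where
  "level_region p q r = level_set \<inter> branch p \<times> branch q \<times> branch r"

section \<open>Reduced words, branches, tree edges and lines\<close>

lemma words_iff: "w \<in> words \<longleftrightarrow> reduced w \<and> fst ` set w \<subseteq> {0, 1}"
  by (simp add: words_def free_group_def)

lemma Nil_in_words: "[] \<in> words"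
  by (simp add: words_iff)

lemma reduced_snoc: "reduced (w @ [l]) \<longleftrightarrow> reduced w \<and> (w \<noteq> [] \<longrightarrow> l \<noteq> inv_letter (last w))"
  by (auto simp: reduced_def successively_append_iff)

lemma words_snoc: "w @ [l] \<in> words \<longleftrightarrow>
    w \<in> words \<and> fst l \<in> {0, 1} \<and> (w \<noteq> [] \<longrightarrow> l \<noteq> inv_letter (last w))"
  by (auto simp: words_iff reduced_snoc)

lemma words_appendD: "u @ v \<in> words \<Longrightarrow> u \<in> words"
  by (auto simp: words_iff reduced_def successively_append_iff)

lemma height_Nil [simp]: "height [] = 0"
  by (simp add: exponent_sum_def)

lemma height_append: "height (u @ v) = height u + height v"
  by (simp add: exponent_sum_def)

lemma height_snoc: "height (w @ [l]) = height w + (if snd l then 1 else - 1)"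
  by (simp add: height_append exponent_sum_Cons)

lemma level_set_iff: "(x, y, z) \<in> level_set \<longleftrightarrow>
    x \<in> words \<and> y \<in> words \<and> z \<in> words \<and> height x + height y + height z = 0"
  by (auto simp: words_def stallings_group_def kernel_def stallings_hom_def integer_group_def)

text \<open>Two letters have the sign \<open>b\<close>, and reducedness forbids at most one of them,
  the inverse of the last letter. This is where rank two enters: a nontrivial power of a single
  generator could be prolonged with one sign only.\<close>

lemma words_extend:
  assumes "w \<in> words" obtains l where "snd l = b" "w @ [l] \<in> words"
proof (cases "w \<noteq> [] \<and> (0, b) = inv_letter (last w)")
  case True
  then have "(1, b) \<noteq> inv_letter (last w)" by (metis Pair_inject zero_neq_one)
  then have "w @ [(1, b)] \<in> words" using assms by (simp add: words_snoc)
  then show ?thesis using that[of "(1, b)"] by simp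
next
  case False
  then have "w @ [(0, b)] \<in> words" using assms by (auto simp: words_snoc)
  then show ?thesis using that[of "(0, b)"] by simp
qed

lemma branch_words: "w \<in> branch r \<Longrightarrow> w \<in> words"
  by (simp add: branch_def)

lemma branch_Nil [simp]: "branch [] = words"
  by (auto simp: branch_def)

lemma branch_self: "r \<in> words \<Longrightarrow> r \<in> branch r"
  by (simp add: branch_def)

lemma branch_root: "w \<in> branch r \<Longrightarrow> r \<in> branch r"
  by (auto simp: branch_def intro: words_appendD)

lemma branch_snoc: "w \<in> branch r \<Longrightarrow> w @ [l] \<in> words \<Longrightarrow> w @ [l] \<in> branch r"
  by (auto simp: branch_def)

lemma branch_appendD: "r @ w @ [l] \<in> branch r \<Longrightarrow> r @ w \<in> branch r"
  unfolding branch_def using words_appendD[of "r @ w" "[l]"] by simp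

lemma branch_extend:
  assumes "w \<in> branch r" obtains l where "snd l = b" "w @ [l] \<in> branch r"
  using words_extend[OF branch_words[OF assms], of b] branch_snoc[OF assms] by blast

lemma tree_edge_snoc: "w @ [l] \<in> words \<Longrightarrow> tree_edge {w, w @ [l]}"
  unfolding tree_edge_def by blast

lemma tree_edge_ex: "w \<in> words \<Longrightarrow> \<exists>e. tree_edge e \<and> w \<in> e"
  by (meson words_extend[of w True] tree_edge_snoc insertI1)

lemma tree_edge_cases:
  assumes "tree_edge e" "x \<in> e" "y \<in> e"
  shows "tree_adjacent x y"
  using assms by (auto simp: tree_edge_def)

lemma tree_edge_height:
  assumes "tree_edge e" "x \<in> e" "y \<in> e"
  shows "\<bar>height x - height y\<bar> \<le> 1" "height x = height y \<Longrightarrow> x = y"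
  using assms by (auto simp: tree_edge_def height_snoc split: if_splits)

lemma tree_edge_words: "tree_edge e \<Longrightarrow> x \<in> e \<Longrightarrow> x \<in> words"
  using words_appendD by (auto simp: tree_edge_def)

lemma simplexI:
  "\<lbrakk>tree_edge a; tree_edge b; tree_edge c; s \<subseteq> a \<times> b \<times> c; s \<subseteq> level_set; s \<noteq> {}\<rbrakk> \<Longrightarrow> is_simplex s"
  unfolding is_simplex_def by blast

lemma simplexE:
  assumes "is_simplex s"
  obtains a b c where "tree_edge a" "tree_edge b" "tree_edge c" "s \<subseteq> a \<times> b \<times> c" "s \<subseteq> level_set"
    "s \<noteq> {}"
  using assms unfolding is_simplex_def by (elim conjE exE)

lemma simplex_subset:
  assumes "is_simplex s" "s' \<subseteq> s" "s' \<noteq> {}" shows "is_simplex s'"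
proof -
  obtain a b c where "tree_edge a" "tree_edge b" "tree_edge c" "s \<subseteq> a \<times> b \<times> c" "s \<subseteq> level_set"
    using assms(1) by (rule simplexE)
  then show ?thesis using assms by (intro simplexI[of a b c]) auto
qed

lemma simplex_pairD:
  assumes "is_simplex {(x, y, z), (x', y', z')}"
  obtains a b c where "tree_edge a" "{x, x'} \<subseteq> a" "tree_edge b" "{y, y'} \<subseteq> b" "tree_edge c"
    "{z, z'} \<subseteq> c"
  using assms by (rule simplexE) (use that in auto)

lemma simplex_singleton:
  assumes "v \<in> level_set" shows "is_simplex {v}"
proof -
  obtain x y z where v: "v = (x, y, z)" by (metis prod_cases3)
  then have "x \<in> words" "y \<in> words" "z \<in> words" using assms by (auto simp: level_set_iff)
  then obtain a b c where "tree_edge a \<and> x \<in> a" "tree_edge b \<and> y \<in> b" "tree_edge c \<and> z \<in> c"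
    using tree_edge_ex[of x] tree_edge_ex[of y] tree_edge_ex[of z] by auto
  then show ?thesis using assms v by (intro simplexI[of a b c]) auto
qed

lemma replicate_words: "w @ [l] \<in> words \<Longrightarrow> w @ replicate n l \<in> words"
proof (induction n)
  case (Suc n)
  show ?case
  proof (cases n)
    case (Suc m)
    then have "w @ replicate n l \<noteq> []" "last (w @ replicate n l) = l"
      by (auto simp: replicate_append_same[symmetric] simp del: replicate_append_same)
    moreover have "w @ replicate n l \<in> words" "fst l \<in> {0, 1}"
      using Suc.IH Suc.prems by (auto simp: words_snoc)
    ultimately have "(w @ replicate n l) @ [l] \<in> words" by (simp only: words_snoc) simp
    then show ?thesis by (simp add: replicate_append_same)
  qed (use Suc in simp)
qed (auto simp: words_snoc)

lemma height_replicate: "height (replicate n l) = (if snd l then int n else - int n)"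
  by (induction n) (auto simp: exponent_sum_Cons)

text \<open>The edge gives one direction of the line, and \<open>words_extend\<close> a letter of
  the opposite sign for the other. Each of the two letters is repeated forever, which never cancels;
  all points prolong \<open>z\<close>, so the line stays in the branch.\<close>

lemma line_exists:
  assumes z: "z \<in> branch r" "z @ [l] \<in> words"
  obtains \<alpha> where "line r \<alpha>" "\<alpha> (height z) = z" "\<alpha> (height (z @ [l])) = z @ [l]"
proof -
  obtain m where m: "snd m = (\<not> snd l)" "z @ [m] \<in> words"
    using words_extend branch_words z by metis
  define up where "up = (if snd l then l else m)"
  define dn where "dn = (if snd l then m else l)"
  have ud: "snd up" "\<not> snd dn" "z @ [up] \<in> words" "z @ [dn] \<in> words"
    using m z by (auto simp: up_def dn_def)
  define \<alpha> where "\<alpha> n = (if n \<ge> height z then z @ replicate (nat (n - height z)) up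
     else z @ replicate (nat (height z - n)) dn)" for n
  have step: "tree_edge {z @ replicate n k, z @ replicate (Suc n) k}" if "z @ [k] \<in> words" for n k
    using tree_edge_snoc[of "z @ replicate n k" k] replicate_words[OF that, of "Suc n"]
    by (simp add: replicate_append_same)
  have edge: "tree_edge {\<alpha> n, \<alpha> (n + 1)}" for n
  proof (cases "n \<ge> height z")
    case True
    then have "nat (n + 1 - height z) = Suc (nat (n - height z))" by simp
    then show ?thesis using True step[OF ud(3), of "nat (n - height z)"] by (simp add: \<alpha>_def)
  next
    case False
    then have "nat (height z - n) = Suc (nat (height z - (n + 1)))" by simp
    then show ?thesis using False step[OF ud(4), of "nat (height z - (n + 1))"]
      by (auto simp: \<alpha>_def insert_commute)
  qed
  have "\<alpha> n \<in> words" for n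
    using replicate_words ud unfolding \<alpha>_def by presburger
  then have "\<alpha> n \<in> branch r" for n
    using z(1) unfolding branch_def \<alpha>_def by (auto split: if_splits)
  then have "line r \<alpha>"
    unfolding line_def using edge ud by (auto simp: \<alpha>_def height_append height_replicate)
  moreover have "\<alpha> (height z) = z" "\<alpha> (height (z @ [l])) = z @ [l]"
    by (auto simp: \<alpha>_def height_snoc up_def dn_def)
  ultimately show ?thesis using that by blast
qed

lemma line_through:
  assumes "z \<in> branch r" obtains \<alpha> where "line r \<alpha>" "\<alpha> (height z) = z"
  using words_extend[OF branch_words[OF assms]] line_exists[OF assms] by metis

lemma line_edge:
  assumes "line r \<alpha>" "\<bar>n - m\<bar> \<le> 1"
  obtains e where "tree_edge e" "\<alpha> n \<in> e" "\<alpha> m \<in> e"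
proof -
  define k where "k = min n m"
  have "tree_edge {\<alpha> k, \<alpha> (k + 1)}" using assms by (simp add: line_def)
  moreover have "n = k \<or> n = k + 1" "m = k \<or> m = k + 1" using assms(2) by (auto simp: k_def)
  ultimately show ?thesis using that[of "{\<alpha> k, \<alpha> (k + 1)}"] by auto
qed

lemma lineD: "line r \<alpha> \<Longrightarrow> \<alpha> n \<in> words" "line r \<alpha> \<Longrightarrow> \<alpha> n \<in> branch r" "line r \<alpha> \<Longrightarrow> height (\<alpha> n) = n"
  by (auto simp: line_def branch_def)

section \<open>Connectivity of the level set in a product of branches\<close>

lemma conn_branch_image:
  assumes step: "\<And>y l. y \<in> branch q \<Longrightarrow> y @ [l] \<in> branch q \<Longrightarrow> is_simplex {f y, f (y @ [l])}"
  shows "conn is_simplex (f ` branch q)"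
proof (rule connI_base)
  fix u assume "u \<in> f ` branch q"
  then obtain w where u: "u = f (q @ w)" "q @ w \<in> branch q" by (auto simp: branch_def)
  have "q @ w \<in> branch q \<Longrightarrow> (f (q @ w), f q) \<in> (links is_simplex (f ` branch q))\<^sup>*"
  proof (induction w rule: rev_induct)
    case (snoc l w)
    have q: "q @ w \<in> branch q" using branch_appendD snoc.prems by blast
    have "is_simplex {f (q @ w), f (q @ w @ [l])}" using step[OF q, of l] snoc.prems by simp
    then have "(f (q @ w @ [l]), f (q @ w)) \<in> links is_simplex (f ` branch q)"
      using q snoc.prems by (simp add: links_def insert_commute)
    then show ?case using snoc.IH[OF q] by (rule converse_rtrancl_into_rtrancl)
  qed simp
  then show "(u, f q) \<in> (links is_simplex (f ` branch q))\<^sup>*" using u by simp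
qed

text \<open>Letters are traded between the first two coordinates: the last letter of the first one
  is deleted and a letter of the same sign is appended to the second, until the first coordinate is
  the root \<open>p\<close>. The points reached in this way lie on a connected copy of the tree
  \<open>branch q\<close>.\<close>

lemma conn_level_fibre: "conn is_simplex {u \<in> level_region p q r. snd (snd u) = w}"
proof (cases "p \<in> branch p \<and> w \<in> branch r")
  case True
  let ?U = "{u \<in> level_region p q r. snd (snd u) = w}"
  obtain \<alpha> where \<alpha>: "line p \<alpha>" "\<alpha> (height p) = p" using True line_through by metis
  \<comment> \<open>The height condition selects the point of the line in the first coordinate.
    Since the line passes through \<open>p\<close>, every point of the fibre with first coordinate
    \<open>p\<close> is some \<open>f y\<close>.\<close>
  define f where "f y = (\<alpha> (- height w - height y), y, w)" for y
  obtain ew where ew: "tree_edge ew" "w \<in> ew" using tree_edge_ex branch_words True by blast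
  have f_in: "f y \<in> ?U" if "y \<in> branch q" for y
    using that True \<alpha> by (auto simp: f_def level_region_def level_set_iff lineD branch_words)
  have edge: "is_simplex {f y, f (y @ [l])}" if y: "y \<in> branch q" "y @ [l] \<in> branch q" for y l
  proof -
    obtain e where "tree_edge e" "\<alpha> (- height w - height y) \<in> e"
      "\<alpha> (- height w - height (y @ [l])) \<in> e"
      by (rule line_edge[OF \<alpha>(1), of "- height w - height y" "- height w - height (y @ [l])"])
        (auto simp: height_snoc)
    then show ?thesis
      using y f_in ew tree_edge_snoc[OF branch_words[OF y(2)]]
      by (intro simplexI[of e "{y, y @ [l]}" ew]) (auto simp: f_def level_region_def)
  qed
  have conn_f: "conn is_simplex (f ` branch q)" by (rule conn_branch_image) (rule edge)
  have main: "(p @ x, y, w) \<in> ?U \<Longrightarrow> ((p @ x, y, w), f q) \<in> (links is_simplex ?U)\<^sup>*" for x y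
  proof (induction x arbitrary: y rule: rev_induct)
    case Nil
    then have y: "y \<in> branch q" and p: "height p = - height w - height y"
      by (auto simp: level_region_def level_set_iff)
    have "f y = (p, y, w)" using \<alpha>(2) unfolding f_def p[symmetric] by simp
    moreover have "(f y, f q) \<in> (links is_simplex (f ` branch q))\<^sup>*"
      using conn_f y branch_root[OF y] unfolding conn_def by blast
    moreover have "f ` branch q \<subseteq> ?U" using f_in by blast
    ultimately show ?case using links_rtrancl_mono[of "f y" "f q"] by simp
  next
    case (snoc l x)
    then have x: "p @ x @ [l] \<in> branch p" and y: "y \<in> branch q" by (auto simp: level_region_def)
    obtain m where m: "snd m = snd l" "y @ [m] \<in> branch q" using branch_extend[OF y] by blast
    have x': "p @ x \<in> branch p" using branch_appendD x by blast
    have u': "(p @ x, y @ [m], w) \<in> ?U"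
      using snoc.prems m x' branch_words[OF m(2)] branch_words[OF x']
      by (auto simp: level_region_def level_set_iff height_append exponent_sum_Cons)
    have "tree_edge {p @ x, p @ x @ [l]}" "tree_edge {y, y @ [m]}"
      using tree_edge_snoc[of "p @ x" l] branch_words[OF x] tree_edge_snoc branch_words[OF m(2)]
        by auto
    then have "is_simplex {(p @ x @ [l], y, w), (p @ x, y @ [m], w)}"
      using ew u' snoc.prems by (intro simplexI[of "{p @ x, p @ x @ [l]}"
        "{y, y @ [m]}" ew]) (auto simp: level_region_def)
    then have "((p @ x @ [l], y, w), (p @ x, y @ [m], w)) \<in> links is_simplex ?U"
      using u' snoc.prems by (simp add: links_def)
    then show ?case using snoc.IH[OF u'] by (rule converse_rtrancl_into_rtrancl)
  qed
  show ?thesis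
  proof (rule connI_base)
    fix u assume u: "u \<in> ?U"
    then obtain x y where "u = (p @ x, y, w)" by (auto simp: level_region_def branch_def)
    then show "(u, f q) \<in> (links is_simplex ?U)\<^sup>*" using main u by simp
  qed
next
  case False
  then have empty: "{u \<in> level_region p q r. snd (snd u) = w} = {}"
    by (auto simp: level_region_def intro: branch_root)
  show ?thesis unfolding empty conn_def by simp
qed

text \<open>The third coordinate loses its last letter and the first gains one of the same sign, so
  the height is unchanged; both points lie in one cube.\<close>

lemma level_region_link:
  assumes u: "u \<in> level_region p q r" "snd (snd u) = r @ w @ [l]"
  shows "\<exists>v\<in>level_region p q r. \<exists>v'\<in>level_region p q r.
     snd (snd v) = r @ w \<and> snd (snd v') = snd (snd u) \<and> is_simplex {v, v'}"
proof -
  obtain x y where xy: "u = (x, y, r @ w @ [l])" using u by (metis prod.collapse)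
  then have x: "x \<in> branch p" and y: "y \<in> branch q" and z: "r @ w @ [l] \<in> branch r"
    using u by (auto simp: level_region_def)
  obtain m where m: "snd m = snd l" "x @ [m] \<in> branch p" using branch_extend[OF x] by blast
  have z': "r @ w \<in> branch r" using branch_appendD z by blast
  obtain ey where ey: "tree_edge ey" "y \<in> ey" using tree_edge_ex branch_words y by blast
  have v: "(x @ [m], y, r @ w) \<in> level_region p q r"
    using u m y z' xy branch_words[OF m(2)] branch_words[OF z']
    by (auto simp: level_region_def level_set_iff height_append exponent_sum_Cons)
  have "tree_edge {r @ w, r @ w @ [l]}" "tree_edge {x, x @ [m]}"
    using tree_edge_snoc[of "r @ w" l] branch_words[OF z] tree_edge_snoc branch_words[OF m(2)]
      by auto
  then have "is_simplex {(x @ [m], y, r @ w), u}"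
    using ey v u xy by (intro simplexI[of "{x, x @ [m]}" ey "{r @ w, r @ w @ [l]}"]) (auto simp:
      level_region_def)
  then show ?thesis using v u by (intro bexI[OF _ v] bexI[OF _ u(1)]) auto
qed

lemma level_region_root: "u \<in> level_region p q r \<Longrightarrow> \<exists>w. snd (snd u) = r @ w"
  by (auto simp: level_region_def branch_def)

lemma conn_level_region: "conn is_simplex (level_region p q r)"
proof (rule conn_tree[where \<pi> = "\<lambda>u. snd (snd u)" and r = r])
  show "conn is_simplex {u \<in> level_region p q r. snd (snd u) = w}" for w
    by (rule conn_level_fibre)
qed (erule level_region_root, erule (1) level_region_link)

text \<open>
  The part of the level complex over a line in the third tree is the graph of a function on the
  product of the other two trees, hence contractible.
\<close>

definition sheet :: "(int \<Rightarrow> nat letter list) \<Rightarrow> nat letter list \<Rightarrow> nat letter list \<Rightarrow> F2_cubed" where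
  "sheet \<alpha> x y = (x, y, \<alpha> (- height x - height y))"

lemma sheet_in: "\<lbrakk>line r \<alpha>; x \<in> words; y \<in> words\<rbrakk> \<Longrightarrow> sheet \<alpha> x y \<in> level_set"
  by (auto simp: sheet_def level_set_iff lineD)

text \<open>In a sheet the third coordinate is determined by its height, so two consecutive heights
  confine it to one edge of the line, which completes the edges \<open>a\<close> and
  \<open>b\<close> to a cube.\<close>

lemma sheet_simplex:
  assumes \<alpha>: "line r \<alpha>" and e: "tree_edge a" "tree_edge b"
    and s: "s \<noteq> {}" "s \<subseteq> (\<lambda>(x, y). sheet \<alpha> x y) ` (a \<times> b)"
    and h: "\<And>x y z. (x, y, z) \<in> s \<Longrightarrow> height z = k \<or> height z = k + 1"
  shows "is_simplex s"
proof (rule simplexI[OF e, of "{\<alpha> k, \<alpha> (k + 1)}"])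
  show "tree_edge {\<alpha> k, \<alpha> (k + 1)}" using \<alpha> by (simp add: line_def)
  show "s \<subseteq> level_set" using s(2) sheet_in[OF \<alpha>] tree_edge_words e by fastforce
  show "s \<subseteq> a \<times> b \<times> {\<alpha> k, \<alpha> (k + 1)}"
  proof
    fix u assume u: "u \<in> s"
    then obtain x y where xy: "u = sheet \<alpha> x y" "x \<in> a" "y \<in> b" using s(2) by auto
    then have "height (\<alpha> (- height x - height y)) = k \<or> height (\<alpha> (- height x - height y)) = k + 1"
      using h u by (simp add: sheet_def)
    then show "u \<in> a \<times> b \<times> {\<alpha> k, \<alpha> (k + 1)}" using xy lineD(3)[OF \<alpha>] by (auto simp: sheet_def)
  qed
qed (use s in auto)

lemma sheet_pair:
  assumes \<alpha>: "line r \<alpha>" and e: "tree_edge a" "x \<in> a" "x' \<in> a" "tree_edge b" "y \<in> b" "y' \<in> b"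
    and h: "\<bar>height x + height y - height x' - height y'\<bar> \<le> 1"
  shows "is_simplex {sheet \<alpha> x y, sheet \<alpha> x' y'}"
proof (rule sheet_simplex[OF \<alpha> e(1,4), where k = "min (- height x - height y) (- height x' - height
  y')"])
  show "\<And>u v w. (u, v, w) \<in> {sheet \<alpha> x y, sheet \<alpha> x' y'} \<Longrightarrow>
    height w = min (- height x - height y) (- height x' - height y') \<or>
    height w = min (- height x - height y) (- height x' - height y') + 1"
    using h lineD(3)[OF \<alpha>] by (auto simp: sheet_def)
qed (use e in auto)

lemma sheet_snoc1:
  assumes "line r \<alpha>" "x @ [l] \<in> words" "y \<in> words"
  shows "is_simplex {sheet \<alpha> x y, sheet \<alpha> (x @ [l]) y}"
proof -
  obtain b where "tree_edge b" "y \<in> b" using tree_edge_ex assms by blast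
  then show ?thesis using tree_edge_snoc[OF assms(2)]
    by (intro sheet_pair[OF assms(1), where a = "{x, x @ [l]}" and b = b]) (auto simp: height_snoc)
qed

lemma sheet_snoc2:
  assumes "line r \<alpha>" "x \<in> words" "y @ [l] \<in> words"
  shows "is_simplex {sheet \<alpha> x y, sheet \<alpha> x (y @ [l])}"
proof -
  obtain a where "tree_edge a" "x \<in> a" using tree_edge_ex assms by blast
  then show ?thesis using tree_edge_snoc[OF assms(3)]
    by (intro sheet_pair[OF assms(1), where b = "{y, y @ [l]}" and a = a]) (auto simp: height_snoc)
qed

lemma coordinates_adjacent:
  assumes "is_simplex {u, v}"
  shows "tree_adjacent (fst u) (fst v)"
    and "tree_adjacent (fst (snd u)) (fst (snd v))"
    and "tree_adjacent (snd (snd u)) (snd (snd v))"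
    and "\<bar>height (snd (snd u)) - height (snd (snd v))\<bar> \<le> 1"
proof -
  obtain x y z x' y' z' where uv: "u = (x, y, z)" "v = (x', y', z')" by (metis prod_cases3)
  obtain a b c where "tree_edge a" "x \<in> a" "x' \<in> a" "tree_edge b" "y \<in> b" "y' \<in> b" "tree_edge c"
    "z \<in> c" "z' \<in> c"
    using assms unfolding uv by (rule simplex_pairD) auto
  note * = tree_edge_cases[OF this(1-3)] tree_edge_cases[OF this(4-6)] tree_edge_cases[OF this(7-9)]
    tree_edge_height(1)[OF this(7-9)]
  show "tree_adjacent (fst u) (fst v)"
    "tree_adjacent (fst (snd u)) (fst (snd v))"
    "tree_adjacent (snd (snd u)) (snd (snd v))"
    "\<bar>height (snd (snd u)) - height (snd (snd v))\<bar> \<le> 1"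
    using * unfolding uv fst_conv snd_conv by this+
qed

section \<open>Flat sections over sheets and level regions\<close>

locale level_local_system = local_system is_simplex W F t
  for W :: "F2_cubed set" and F :: "F2_cubed \<Rightarrow> 'h set" and t
begin

text \<open>The sheet over a square consists of two triangles with a common diagonal, and is a cone
  from either end of that diagonal.\<close>

lemma good_square:
  assumes \<alpha>: "line r \<alpha>" and x: "x @ [l] \<in> words" and y: "y @ [m] \<in> words"
    and W: "(\<lambda>(x, y). sheet \<alpha> x y) ` ({x, x @ [l]} \<times> {y, y @ [m]}) \<subseteq> W"
  shows "good ((\<lambda>(x, y). sheet \<alpha> x y) ` ({x, x @ [l]} \<times> {y, y @ [m]}))" (is "good ?U")
proof (rule good_cone[OF W])
  \<comment> \<open>The diagonal joins the two corners of equal height: these are the mixed corners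
    when both letters have the same sign, and the corners over \<open>(x, y)\<close> and
    \<open>(x @ [l], y @ [m])\<close> otherwise. The third coordinates of all four corners then have
    height within \<open>1\<close> of that at \<open>c\<close>.\<close>
  define c where "c = (if snd l = snd m then sheet \<alpha> (x @ [l]) y else sheet \<alpha> x y)"
  define n where "n = height (snd (snd c))"
  show c: "c \<in> ?U" by (auto simp: c_def)
  have hU: "\<bar>height (snd (snd u)) - n\<bar> \<le> 1" if "u \<in> ?U" for u
    using that lineD(3)[OF \<alpha>] by (auto simp: n_def c_def sheet_def height_snoc)
  have edges: "tree_edge {x, x @ [l]}" "tree_edge {y, y @ [m]}" using x y tree_edge_snoc by auto
  show triple: "is_simplex {c, u, v}" if uv: "u \<in> ?U" "v \<in> ?U" "is_simplex {u, v}" for u v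
  proof -
    \<comment> \<open>The heights \<open>n - 1\<close> and \<open>n + 1\<close> do not occur
      together at the adjacent vertices \<open>u\<close> and \<open>v\<close>, so one of the two
      edges of the line at height \<open>n\<close> carries the third coordinates of
      \<open>c\<close>, \<open>u\<close> and \<open>v\<close>.\<close>
    define k where "k = (if height (snd (snd u)) < n \<or> height (snd (snd v)) < n then n - 1 else n)"
    show ?thesis
    proof (rule sheet_simplex[OF \<alpha> edges, of _ k])
      fix a b z assume "(a, b, z) \<in> {c, u, v}"
      then have "height z \<in> {n, height (snd (snd u)), height (snd (snd v))}" by (auto simp: n_def)
      then show "height z = k \<or> height z = k + 1"
        using hU[OF uv(1)] hU[OF uv(2)] coordinates_adjacent(4)[OF uv(3)] by (auto simp: k_def)
    qed (use c uv in auto)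
  qed
  show "is_simplex {c, u}" if u: "u \<in> ?U" for u
  proof -
    have "x \<in> words" "y \<in> words" using x y words_appendD by blast+
    then have "u \<in> level_set" using u x y sheet_in[OF \<alpha>] by auto
    then show ?thesis using triple[OF u u] simplex_singleton by simp
  qed
qed

text \<open>A product of two trees is treated as a tree of strips, each strip being an edge of the
  first tree times the second tree; a strip is in turn a tree of squares.\<close>

lemma good_sheet:
  assumes \<alpha>: "line r \<alpha>" and p: "p \<in> words" and q: "q \<in> words"
    and W: "(\<lambda>(x, y). sheet \<alpha> x y) ` (branch p \<times> branch q) \<subseteq> W"
  shows "good ((\<lambda>(x, y). sheet \<alpha> x y) ` (branch p \<times> branch q))" (is "good ?U")
proof -
  have in_U [simp]: "sheet \<alpha> x y \<in> ?U \<longleftrightarrow> x \<in> branch p \<and> y \<in> branch q" for x y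
    by (auto simp: sheet_def)
  have U_cases: "\<exists>x y. u = sheet \<alpha> x y \<and> x \<in> branch p \<and> y \<in> branch q" if "u \<in> ?U" for u
    using that by auto
  have fst_sheet [simp]: "fst (sheet \<alpha> x y) = x" "fst (snd (sheet \<alpha> x y)) = y" for x y
    by (auto simp: sheet_def)
  have slab: "good {u \<in> ?U. fst u = x \<or> fst u = x @ [l]}" (is "good ?S")
    if x: "x \<in> branch p" "x @ [l] \<in> branch p" for x l
  proof (rule good_tree[where \<pi> = "\<lambda>u. fst (snd u)" and r = q])
    have in_S: "sheet \<alpha> x y \<in> ?S" "sheet \<alpha> (x @ [l]) y \<in> ?S" if "y \<in> branch q" for y
      using that x by auto
    have xw: "x @ [l] \<in> words" using x branch_words by blast
    have square: "good {u \<in> ?S. fst (snd u) = y \<or> fst (snd u) = y @ [m]}"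
      if "y \<in> branch q" "y @ [m] \<in> branch q" for y m
    proof (rule good_subset[OF good_square[OF \<alpha> xw branch_words[OF that(2)]]])
      have "(\<lambda>(x, y). sheet \<alpha> x y) ` ({x, x @ [l]} \<times> {y, y @ [m]}) \<subseteq> ?U" using x that by auto
      then show "(\<lambda>(x, y). sheet \<alpha> x y) ` ({x, x @ [l]} \<times> {y, y @ [m]}) \<subseteq> W" using W by blast
      show "{u \<in> ?S. fst (snd u) = y \<or> fst (snd u)
        = y @ [m]} \<subseteq> (\<lambda>(x, y). sheet \<alpha> x y) ` ({x, x @ [l]} \<times> {y, y @ [m]})"
        by (auto simp: image_iff)
    qed
    show "?S \<subseteq> W" using W by blast
    show "?S \<noteq> {}" using in_S branch_self q by blast
    show "\<exists>w. fst (snd u) = q @ w" if "u \<in> ?S" for u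
      using that by (auto simp: branch_def)
    show "tree_adjacent (fst (snd u)) (fst (snd v))"
      if "is_simplex {u, v}" for u v using coordinates_adjacent(2)[OF that] .
    show "conn is_simplex {u \<in> ?S. fst (snd u) = w}" for w
    proof (rule connI_base)
      fix u assume u: "u \<in> {u \<in> ?S. fst (snd u) = w}"
      then have w: "w \<in> branch q" and cases: "u = sheet \<alpha> x w \<or> u = sheet \<alpha> (x @ [l]) w" by auto
      have "is_simplex {u, sheet \<alpha> x w}"
        using cases
      proof
        assume "u = sheet \<alpha> x w"
        then show ?thesis using simplex_singleton sheet_in[OF \<alpha>] branch_words x w by simp
      next
        assume "u = sheet \<alpha> (x @ [l]) w"
        then show ?thesis using sheet_snoc1[OF \<alpha> xw branch_words[OF w]]
          by (simp add: insert_commute)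
      qed
      then show "(u, sheet \<alpha> x w) \<in> (links is_simplex {u \<in> ?S. fst (snd u) = w})\<^sup>*"
        using u in_S[OF w] by (intro r_into_rtrancl) (simp add: links_def)
    qed
    show "\<exists>v\<in>?S. \<exists>v'\<in>?S. fst (snd v) = q @ w \<and> fst (snd v') = fst (snd u) \<and> is_simplex {v, v'}"
      if u: "u \<in> ?S" "fst (snd u) = q @ w @ [k]" for u w k
    proof -
      have y: "q @ w @ [k] \<in> branch q" using u by auto
      then have y': "q @ w \<in> branch q" by (rule branch_appendD)
      have "is_simplex {sheet \<alpha> x (q @ w), sheet \<alpha> x (q @ w @ [k])}"
        using sheet_snoc2[OF \<alpha> branch_words[OF x(1)], of "q @ w" k] branch_words[OF y] by simp
      then show ?thesis using in_S(1)[OF y] in_S(1)[OF y'] u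
        by (intro bexI[of _ "sheet \<alpha> x (q @ w)"] bexI[of _ "sheet \<alpha> x (q @ w @ [k])"]) auto
    qed
    \<comment> \<open>Goodness passes to subsets, so the fibre over the root inherits it from the
      square over any edge that leaves the root.\<close>
    obtain m where "q @ [m] \<in> branch q" using branch_extend branch_self[OF q] by metis
    then show "good {u \<in> ?S. fst (snd u) = q}"
      by (rule good_subset[OF square[OF branch_self[OF q]]]) auto
    show "good {u \<in> ?S. fst (snd u) = q @ w \<or> fst (snd u) = q @ w @ [k]}"
      if u: "u \<in> ?S" "fst (snd u) = q @ w @ [k]" for u w k
    proof -
      have y: "q @ w @ [k] \<in> branch q" using u by auto
      then have y': "q @ w \<in> branch q" by (rule branch_appendD)
      show ?thesis using square[OF y', of k] y by simp
    qed
  qed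
  show ?thesis
  proof (rule good_tree[where \<pi> = fst and r = p])
    show "?U \<subseteq> W" by (rule W)
    show "?U \<noteq> {}" using p q branch_self by blast
    show "\<exists>w. fst u = p @ w" if "u \<in> ?U" for u using that by (auto simp: branch_def)
    show "tree_adjacent (fst u) (fst v)"
      if "is_simplex {u, v}" for u v using coordinates_adjacent(1)[OF that] .
    show "conn is_simplex {u \<in> ?U. fst u = w}" for w
    proof (cases "w \<in> branch p")
      case True
      have eq: "{u \<in> ?U. fst u = w} = sheet \<alpha> w ` branch q" using True by auto
      show ?thesis unfolding eq
        by (intro conn_branch_image sheet_snoc2[OF \<alpha>]) (use True branch_words in auto)
    next
      case False
      then have eq: "{u \<in> ?U. fst u = w} = {}" by (auto simp: sheet_def)
      show ?thesis unfolding eq conn_def by simp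
    qed
    show "\<exists>v\<in>?U. \<exists>v'\<in>?U. fst v = p @ w \<and> fst v' = fst u \<and> is_simplex {v, v'}"
      if u: "u \<in> ?U" "fst u = p @ w @ [k]" for u w k
    proof -
      have x: "p @ w @ [k] \<in> branch p" using u by auto
      then have x': "p @ w \<in> branch p" by (rule branch_appendD)
      have "is_simplex {sheet \<alpha> (p @ w) q, sheet \<alpha> (p @ w @ [k]) q}"
        using sheet_snoc1[OF \<alpha>, of "p @ w" k q] branch_words[OF x] q by simp
      then show ?thesis using x x' u branch_self[OF q]
        by (intro bexI[of _ "sheet \<alpha> (p @ w) q"] bexI[of _ "sheet \<alpha> (p @ w @ [k]) q"]) auto
    qed
    obtain m where "p @ [m] \<in> branch p" using branch_extend branch_self[OF p] by metis
    then show "good {u \<in> ?U. fst u = p}"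
      by (rule good_subset[OF slab[OF branch_self[OF p]]]) auto
    show "good {u \<in> ?U. fst u = p @ w \<or> fst u = p @ w @ [k]}"
      if u: "u \<in> ?U" "fst u = p @ w @ [k]" for u w k
    proof -
      have x: "p @ w @ [k] \<in> branch p" using u by auto
      then have x': "p @ w \<in> branch p" by (rule branch_appendD)
      show ?thesis using slab[OF x', of k] x by simp
    qed
  qed
qed

text \<open>The slab over an edge of the third tree lies in the sheet over a line through that edge.
  On its own a slab need not be simply connected, but its loops contract in the sheet, which is
  contained in \<open>W\<close>; the relative notion \<open>good\<close> records exactly this, and
  \<open>good_tree\<close> assembles the slabs.\<close>

lemma good_level_region:
  assumes p: "p \<in> words" and q: "q \<in> words" and r: "r \<in> words" and W: "level_region p q r \<subseteq> W"
  shows "good (level_region p q r)"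
proof -
  have slab: "good {u \<in> level_region p q r. snd (snd u) = z \<or> snd (snd u) = z @ [l]}"
    if z: "z \<in> branch r" "z @ [l] \<in> branch r" for z l
  proof -
    obtain \<alpha> where \<alpha>: "line r \<alpha>" "\<alpha> (height z) = z" "\<alpha> (height (z @ [l])) = z @ [l]"
      using line_exists[OF z(1) branch_words[OF z(2)]] by blast
    have "(\<lambda>(x, y). sheet \<alpha> x y) ` (branch p \<times> branch q) \<subseteq> level_region p q r"
      using sheet_in[OF \<alpha>(1)] lineD[OF \<alpha>(1)] branch_words by (auto simp: level_region_def sheet_def)
    then have "good ((\<lambda>(x, y). sheet \<alpha> x y) ` (branch p \<times> branch q))"
      using good_sheet[OF \<alpha>(1) p q] W by blast
    then show ?thesis
    proof (rule good_subset, intro subsetI)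
      fix u assume u: "u \<in> {u \<in> level_region p q r. snd (snd u) = z \<or> snd (snd u) = z @ [l]}"
      obtain x y w where xyw: "u = (x, y, w)" by (metis prod_cases3)
      then have "height w = - height x - height y" "x \<in> branch p" "y \<in> branch q"
        "w = z \<or> w = z @ [l]"
        using u by (auto simp: level_region_def level_set_iff)
      then have "u = sheet \<alpha> x y" using \<alpha> xyw unfolding sheet_def by (metis)
      then show "u \<in> (\<lambda>(x, y). sheet \<alpha> x y) ` (branch p \<times> branch q)"
        using \<open>x \<in> branch p\<close> \<open>y \<in> branch q\<close> by auto
    qed
  qed
  show ?thesis
  proof (rule good_tree[where \<pi> = "\<lambda>u. snd (snd u)" and r = r])
    obtain \<alpha> where \<alpha>: "line r \<alpha>" using line_through branch_self r by metis
    then have "sheet \<alpha> p q \<in> level_region p q r"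
      using sheet_in[OF \<alpha>] p q branch_self lineD[OF \<alpha>] by (auto simp: level_region_def sheet_def)
    then show "level_region p q r \<noteq> {}" by blast
    show "tree_adjacent (snd (snd u)) (snd (snd v))"
      if "is_simplex {u, v}" for u v using coordinates_adjacent(3)[OF that] .
    show "conn is_simplex {u \<in> level_region p q r. snd (snd u) = w}" for w
      by (rule conn_level_fibre)
    obtain m where "r @ [m] \<in> branch r" using branch_extend branch_self[OF r] by metis
    then show "good {u \<in> level_region p q r. snd (snd u) = r}"
      by (rule good_subset[OF slab[OF branch_self[OF r]]]) auto
    show "good {u \<in> level_region p q r. snd (snd u) = r @ w \<or> snd (snd u) = r @ w @ [k]}"
      if u: "u \<in> level_region p q r" "snd (snd u) = r @ w @ [k]" for u w k
    proof -
      have x: "r @ w @ [k] \<in> branch r" using u by (auto simp: level_region_def)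
      then have x': "r @ w \<in> branch r" by (rule branch_appendD)
      show ?thesis using slab[OF x', of k] x by simp
    qed
  qed (rule W, erule level_region_root, erule (1) level_region_link)
qed

end

section \<open>The complement of a product of balls\<close>

definition far :: "nat \<Rightarrow> F2_cubed set" where
  "far n = {u \<in> level_set. n < length (fst u) \<or> n < length (fst (snd u)) \<or> n < length (snd (snd
    u))}"

definition piece :: "nat \<Rightarrow> nat letter list \<Rightarrow> F2_cubed set" where
  "piece i p = level_region (if i = 0 then p else []) (if i = 1 then p else []) (if i
    = 2 then p else [])"

lemma level_region_Nil: "level_region [] [] [] = level_set"
proof -
  have "level_set \<subseteq> words \<times> words \<times> words" by (auto simp: level_set_iff)
  then show ?thesis by (auto simp: level_region_def)
qed

lemma level_region_ne:
  assumes "p \<in> words" "q \<in> words" "r \<in> words" shows "level_region p q r \<noteq> {}"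
proof -
  obtain \<alpha> where \<alpha>: "line r \<alpha>" using line_through branch_self assms by metis
  then have "sheet \<alpha> p q \<in> level_region p q r"
    using sheet_in[OF \<alpha>] assms branch_self lineD[OF \<alpha>] by (auto simp: level_region_def sheet_def)
  then show ?thesis by blast
qed

lemma words_take: "w \<in> words \<Longrightarrow> take n w \<in> words"
  using words_appendD[of "take n w" "drop n w"] by simp

lemma branch_iff: "w \<in> branch p \<longleftrightarrow> w \<in> words \<and> take (length p) w = p"
  unfolding branch_def by (auto simp: append_eq_conv_conj) (metis append_take_drop_id)

lemma words_extend_length: "\<exists>p\<in>words. length p = n"
proof (induction n)
  case (Suc n)
  then obtain p where p: "p \<in> words" "length p = n" by blast
  obtain l where "p @ [l] \<in> words" using words_extend p by metis
  then show ?case using p by (intro bexI[of _ "p @ [l]"]) auto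
qed (use Nil_in_words in auto)

lemma piece_Int:
  assumes "i \<in> {0, 1, 2}" "j \<in> {0, 1, 2}" "i \<noteq> j"
  shows "piece i p \<inter> piece j q = level_region
     (if i = 0 then p else if j = 0 then q else []) (if i = 1 then p else if j = 1 then q else [])
     (if i = 2 then p else if j = 2 then q else [])"
  using assms branch_words by (auto simp: piece_def level_region_def)

lemma piece_Int3: "piece 0 p \<inter> piece 1 q \<inter> piece 2 r = level_region p q r"
  using branch_words by (auto simp: piece_def level_region_def)

lemma mem_piece: "u \<in> piece i p \<longleftrightarrow> u \<in> level_set \<and> (i = 0 \<longrightarrow> fst u \<in> branch p) \<and>
    (i = 1 \<longrightarrow> fst (snd u) \<in> branch p) \<and> (i = 2 \<longrightarrow> snd (snd u) \<in> branch p)"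
  by (cases u) (auto simp: piece_def level_region_def level_set_iff)

lemma far_piece:
  assumes "u \<in> far n" obtains i p where "i \<in> {0, 1, 2}" "p \<in> words" "length p = Suc n"
    "u \<in> piece i p"
proof -
  obtain x y z where u: "u = (x, y, z)" by (metis prod_cases3)
  have w: "x \<in> words" "y \<in> words" "z \<in> words" "u \<in> level_set"
    using assms by (auto simp: far_def u level_set_iff)
  consider "n < length x" | "n < length y" | "n < length z" using assms by (auto simp: far_def u)
  then show ?thesis
  proof cases
    case 1
    then show ?thesis using w that[of 0 "take (Suc n) x"]
      by (auto simp: mem_piece u branch_iff words_take)
  next
    case 2
    then show ?thesis using w that[of 1 "take (Suc n) y"]
      by (auto simp: mem_piece u branch_iff words_take)
  next
    case 3
    then show ?thesis using w that[of 2 "take (Suc n) z"]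
      by (auto simp: mem_piece u branch_iff words_take)
  qed
qed

lemma piece_far: "i \<in> {0, 1, 2} \<Longrightarrow> length p = Suc n \<Longrightarrow> piece i p \<subseteq> far n"
  by (auto simp: mem_piece far_def branch_def)

text \<open>Pieces with different indices always meet, since they constrain different coordinates.
  For two given pieces, a piece whose index differs from both therefore connects them.\<close>

lemma conn_far: "conn is_simplex (far n)"
proof -
  have piece: "(u, v) \<in> (links is_simplex (far n))\<^sup>*"
    if "i \<in> {0, 1, 2}" "length p = Suc n" "u \<in> piece i p" "v \<in> piece i p" for i p u v
  proof (rule links_rtrancl_mono)
    show "(u, v) \<in> (links is_simplex (piece i p))\<^sup>*"
      using that conn_level_region unfolding conn_def piece_def by blast
  qed (use piece_far that in auto)
  show ?thesis
    unfolding conn_def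
  proof (intro ballI)
    fix u v assume u: "u \<in> far n" and v: "v \<in> far n"
    obtain i p where ip: "i \<in> {0, 1, 2}" "p \<in> words" "length p = Suc n" "u \<in> piece i p"
      using far_piece[OF u] .
    obtain j q where jq: "j \<in> {0, 1, 2}" "q \<in> words" "length q = Suc n" "v \<in> piece j q"
      using far_piece[OF v] .
    define k :: nat where "k = (if i \<noteq> 0 \<and> j \<noteq> 0 then 0 else if i \<noteq> 1 \<and> j \<noteq> 1 then 1 else 2)"
    have k: "k \<in> {0, 1, 2}" "k \<noteq> i" "k \<noteq> j" by (auto simp: k_def)
    have "piece i p \<inter> piece k p \<noteq> {}" "piece j q \<inter> piece k p \<noteq> {}"
      using k ip jq by (simp_all add: piece_Int level_region_ne Nil_in_words)
    then obtain a b where a: "a \<in> piece i p" "a \<in> piece k p" and b: "b \<in> piece j q" "b \<in> piece k p"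
      by blast
    show "(u, v) \<in> (links is_simplex (far n))\<^sup>*"
      using piece[OF ip(1,3,4) a(1)] piece[OF k(1) ip(3) a(2) b(2)] piece[OF jq(1,3) b(1) jq(4)]
        by simp
  qed
qed

lemma take_adjacent:
  "tree_adjacent u v \<Longrightarrow> n < length u \<Longrightarrow> take n v = take n u"
  by auto

lemma (in level_local_system) good_far:
  assumes "far n \<subseteq> W" shows "good (far (Suc n))"
proof (rule good_join[where I = "{0, 1, 2 :: nat}" and P = "{p \<in> words. length p = Suc n}"
  and A = piece])
  let ?P = "{p \<in> words. length p = Suc n}"
  show "?P \<noteq> {}" using words_extend_length by auto
  show "good (piece i p)" if "i \<in> {0, 1, 2}" "p \<in> ?P" for i p
  proof -
    have "piece i p \<subseteq> W" using piece_far[of i p n] that assms by auto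
    then show ?thesis using that unfolding piece_def
      by (intro good_level_region) (auto simp: Nil_in_words)
  qed
  show "piece i p \<inter> piece i q = {}"
    if "i \<in> {0, 1, 2}" "p \<in> ?P" "q \<in> ?P" "p \<noteq> q" for i p q
    using that by (auto simp: mem_piece branch_iff)
  show "conn is_simplex (piece i p \<inter> piece j q)"
    if "i \<in> {0, 1, 2}" "j \<in> {0, 1, 2}" "i \<noteq> j" for i j p q
    unfolding piece_Int[OF that] by (rule conn_level_region)
  show "piece 0 p \<inter> piece 1 q \<inter> piece 2 r \<noteq> {}"
    if "p \<in> ?P" "q \<in> ?P" "r \<in> ?P" for p q r
    unfolding piece_Int3 using that level_region_ne by simp
  have sub: "far (Suc n) \<subseteq> far n" by (auto simp: far_def)
  show "\<exists>i\<in>{0, 1, 2}. \<exists>p\<in>?P. u \<in> piece i p" if "u \<in> far (Suc n)" for u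
  proof -
    have "u \<in> far n" using that sub by blast
    then show ?thesis by (rule far_piece) blast
  qed
  show "\<exists>i\<in>{0, 1, 2}. \<exists>p\<in>?P. u \<in> piece i p \<and> v \<in> piece i p"
    if uv: "u \<in> far (Suc n)" "v \<in> far (Suc n)" "is_simplex {u, v}" for u v
  proof -
    obtain i p where ip: "i \<in> {0, 1, 2}" "p \<in> words" "length p = Suc (Suc n)" "u \<in> piece i p"
      using far_piece[OF uv(1)] .
    have v: "fst v \<in> words" "fst (snd v) \<in> words" "snd (snd v) \<in> words" "v \<in> level_set"
      using uv(2) by (cases v; simp add: far_def level_set_iff)+
    \<comment> \<open>The relevant coordinate of \<open>u\<close> has at least \<open>n + 2\<close>
      letters. A neighbour differs from it by at most one final letter, so both share the first
      \<open>n + 1\<close> letters.\<close>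
    have "u \<in> piece i (take (Suc n) p) \<and> v \<in> piece i (take (Suc n) p)"
    proof -
      have len: "Suc n < length w \<and> take (Suc n) w = take (Suc n) p" if "w \<in> branch p" for w
      proof -
        have p: "take (length p) w = p" using that by (simp add: branch_iff)
        then have "length w \<ge> length p" by (metis length_take min.cobounded1)
        moreover have "take (Suc n) (take (length p) w) = take (Suc n) p" using p by (rule arg_cong)
        ultimately show ?thesis using ip(3) by (simp add: min_def)
      qed
      note adj = coordinates_adjacent[OF uv(3)]
      have b: "w \<in> branch (take (Suc n) p) \<and> w' \<in> branch (take (Suc n) p)"
        if "w \<in> branch p" "w' \<in> words" "tree_adjacent w w'" for w w'
        using len[OF that(1)] take_adjacent[OF that(3), of "Suc n"] that ip(3) branch_words
          by (auto simp: branch_iff)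
      show ?thesis using ip(1,4) v b[OF _ _ adj(1)] b[OF _ _ adj(2)] b[OF _ _ adj(3)]
        by (auto simp: mem_piece)
    qed
    then show ?thesis using ip words_take[OF ip(2), of "Suc n"]
      by (intro bexI[OF _ ip(1)] bexI[of _ "take (Suc n) p"]) auto
  qed
qed auto

section \<open>The action of Stallings' group\<close>

abbreviation act :: "F2_cubed \<Rightarrow> F2_cubed \<Rightarrow> F2_cubed" where
  "act \<equiv> monoid.mult stallings_group"

abbreviation act_inv :: "F2_cubed \<Rightarrow> F2_cubed" where
  "act_inv \<equiv> m_inv stallings_group"

abbreviation origin :: F2_cubed where
  "origin \<equiv> \<one>\<^bsub>stallings_group\<^esub>"

lemma group_stallings: "group stallings_group"
proof -
  interpret group_hom F2_cubed integer_group stallings_hom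
    by (intro group_hom.intro group_F2_cubed group_integer_group group_hom_axioms.intro
      stallings_hom_hom)
  show ?thesis unfolding stallings_group_def
    by (rule subgroup.subgroup_is_group[OF subgroup_kernel group_F2_cubed])
qed

interpretation stallings: group stallings_group by (rule group_stallings)

lemma one_stallings: "origin = ([], [], [])"
  by (simp add: stallings_group_def free_group_def)

lemma act_eq: "act (x, y, z) (x', y', z') =
    (foldr cancel_cons x x', foldr cancel_cons y y', foldr cancel_cons z z')"
  by (simp add: stallings_group_def free_group_def DirProd_def)

lemma words_mult: "g \<in> words \<Longrightarrow> w \<in> words \<Longrightarrow> foldr cancel_cons g w \<in> words"
  using group.is_monoid[OF group_free_group, THEN monoid.m_closed, of g "{0, 1}" w]
  by (simp add: words_def free_group_def)

lemma foldr_snoc: "w @ [l] \<in> words \<Longrightarrow> foldr cancel_cons w [l] = w @ [l]"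
  using foldr_Nil_right[of "w @ [l]"] by (simp add: words_iff cancel_cons_def)

text \<open>Right multiplication by a letter is a step in the Cayley tree, either away from the root
  or back towards it.\<close>

lemma foldr_cancel:
  assumes "w \<in> words" "fst l \<in> {0, 1}"
  obtains "w @ [l] \<in> words" "foldr cancel_cons w [l] = w @ [l]"
  | v where "w = v @ [inv_letter l]" "foldr cancel_cons w [l] = v"
proof (cases "w @ [l] \<in> words")
  case True
  then show ?thesis using that(1) foldr_snoc by blast
next
  case False
  then have w: "w \<noteq> []" "l = inv_letter (last w)" using assms by (auto simp: words_snoc)
  then obtain v where v: "w = v @ [inv_letter l]"
    by (metis append_butlast_last_id inv_letter_inv_letter)
  have "v \<in> words" using v assms words_appendD by blast
  then have "foldr cancel_cons w [l] = v"
    using v foldr_Nil_right[of v] by (simp add: words_iff cancel_cons_def)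
  then show ?thesis using that(2) v by blast
qed

text \<open>By associativity the edge from \<open>w\<close> to its product with \<open>l\<close>
  goes to the edge from the translate of \<open>w\<close> to its product with \<open>l\<close>.
  Which end is the longer word may change when the letter cancels.\<close>

lemma tree_edge_translate:
  assumes "tree_edge e" "g \<in> words" shows "tree_edge (foldr cancel_cons g ` e)"
proof -
  obtain w l where e: "e = {w, w @ [l]}" and wl: "w @ [l] \<in> words"
    using assms by (auto simp: tree_edge_def)
  have w: "w \<in> words" "fst l \<in> {0, 1}" using wl by (auto simp: words_snoc)
  define u where "u = foldr cancel_cons g w"
  have u: "u \<in> words" unfolding u_def by (rule words_mult) (use assms w in auto)
  have "foldr cancel_cons g (w @ [l]) = foldr cancel_cons g (foldr cancel_cons w [l])"
    using foldr_snoc[OF wl] by simp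
  also have "\<dots> = foldr cancel_cons u [l]"
    unfolding u_def by (rule foldr_assoc[symmetric]) (simp add: reduced_Cons)
  finally have ul: "foldr cancel_cons g (w @ [l]) = foldr cancel_cons u [l]" .
  from u w(2) show ?thesis
  proof (cases rule: foldr_cancel)
    case 1
    then have "foldr cancel_cons g ` e = {u, u @ [l]}" unfolding e using ul by (simp add: u_def)
    then show ?thesis using tree_edge_snoc[OF 1(1)] by simp
  next
    case (2 v)
    then have "foldr cancel_cons g ` e = {v, v @ [inv_letter l]}"
      unfolding e using ul by (simp add: u_def[symmetric] insert_commute)
    then show ?thesis using tree_edge_snoc[of v "inv_letter l"] u 2(1) by simp
  qed
qed

lemma simplex_act:
  assumes "is_simplex s" "g \<in> level_set" shows "is_simplex (act g ` s)"
proof -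
  obtain a b c where s: "tree_edge a" "tree_edge b" "tree_edge c" "s \<subseteq> a \<times> b \<times> c" "s \<subseteq> level_set"
    "s \<noteq> {}"
    using assms(1) by (rule simplexE)
  obtain x y z where g: "g = (x, y, z)" by (metis prod_cases3)
  have w: "x \<in> words" "y \<in> words" "z \<in> words" using assms(2) by (auto simp: g level_set_iff)
  have "act g ` s \<subseteq> level_set" using s(5) assms(2) by (auto intro: stallings.m_closed)
  moreover have "act g ` s \<subseteq> (foldr cancel_cons x ` a) \<times> (foldr cancel_cons y ` b) \<times> (foldr
    cancel_cons z ` c)"
    using s(4) by (auto simp: g act_eq)
  ultimately show ?thesis
    using simplexI[OF tree_edge_translate[OF s(1) w(1)] tree_edge_translate[OF s(2) w(2)]
        tree_edge_translate[OF s(3) w(3)]] s(6) by simp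
qed

text \<open>The three points have heights in arithmetic progression with difference
  \<open>height g\<close>. Heights within an edge differ by at most \<open>1\<close>, so this
  difference is \<open>0\<close>; an edge has only one point of each height, hence \<open>g\<close>
  fixes \<open>x\<close> and is trivial.\<close>

lemma tree_free:
  assumes e: "tree_edge e" "x \<in> e" "foldr cancel_cons g x \<in> e"
    "foldr cancel_cons g (foldr cancel_cons g x) \<in> e"
    and g: "g \<in> words"
  shows "g = []"
proof -
  have "height g = 0"
    using tree_edge_height(1)[OF e(1,2,3)] tree_edge_height(1)[OF e(1,2,4)]
      by (simp add: exponent_sum_foldr)
  then have "foldr cancel_cons g x = foldr cancel_cons [] x"
    using tree_edge_height(2)[OF e(1,3,2)] by (simp add: exponent_sum_foldr)
  then show ?thesis
    using group.right_cancel[OF group_free_group, of x "{0, 1}" g "[]"] g tree_edge_words[OF e(1,2)]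
      Nil_in_words
    by (simp add: words_def free_group_def)
qed

text \<open>
  Two steps are needed: \<open>v\<close> and \<open>act g v\<close> alone may well be the ends of an edge.
\<close>

lemma act_free:
  assumes s: "is_simplex s" "v \<in> s" "act g v \<in> s" "act g (act g v) \<in> s" and g: "g \<in> level_set"
  shows "g = origin"
proof -
  obtain a b c where abc: "tree_edge a" "tree_edge b" "tree_edge c" "s \<subseteq> a \<times> b \<times> c"
    using s(1) by (rule simplexE)
  obtain x y z x' y' z' where gv: "g = (x, y, z)" "v = (x', y', z')" by (metis prod_cases3)
  have w: "x \<in> words" "y \<in> words" "z \<in> words" using g by (auto simp: gv level_set_iff)
  have in_abc: "v \<in> a \<times> b \<times> c" "act g v \<in> a \<times> b \<times> c" "act g (act g v) \<in> a \<times> b \<times> c"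
    using s abc(4) by blast+
  have "x = []" "y = []" "z = []"
    using in_abc tree_free[OF abc(1), of x' x] tree_free[OF abc(2), of y' y] tree_free[OF abc(3), of
      z' z] w
    by (simp_all add: gv act_eq)
  then show ?thesis by (simp add: gv one_stallings)
qed

lemma simplex_stabilizer:
  assumes "is_simplex s" "act g ` s = s" "g \<in> level_set" shows "g = origin"
proof -
  obtain v where v: "v \<in> s" using assms(1) unfolding is_simplex_def by blast
  then have "act g v \<in> s" using assms(2) by blast
  moreover from this have "act g (act g v) \<in> s" using assms(2) by blast
  ultimately show ?thesis using act_free assms v by blast
qed

lemma tree_edge_oriented:
  assumes "tree_edge e" obtains x x' where "e = {x, x'}" "height x' = height x + 1"
proof -
  obtain w l where e: "e = {w, w @ [l]}" using assms by (auto simp: tree_edge_def)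
  show ?thesis
  proof (cases "snd l")
    case True
    then show ?thesis using that[of w "w @ [l]"] e by (simp add: height_snoc)
  next
    case False
    then show ?thesis using that[of "w @ [l]" w] e by (simp add: height_snoc insert_commute)
  qed
qed

text \<open>The level set meets a cube in one layer of corners at fixed distance above the lowest
  corner. The four layers have 1, 3, 3 and 1 corners; \<open>n\<close> below is the height of the
  lowest one.\<close>

lemma card_simplex:
  assumes "is_simplex s" shows "finite s" "card s \<in> {1, 2, 3}"
proof -
  obtain a b c where s: "tree_edge a" "tree_edge b" "tree_edge c" "s \<subseteq> a \<times> b \<times> c" "s \<subseteq> level_set"
    "s \<noteq> {}"
    using assms by (rule simplexE)
  obtain x x' where a: "a = {x, x'}" "height x' = height x + 1" using tree_edge_oriented[OF s(1)] .
  obtain y y' where b: "b = {y, y'}" "height y' = height y + 1" using tree_edge_oriented[OF s(2)] .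
  obtain z z' where c: "c = {z, z'}" "height z' = height z + 1" using tree_edge_oriented[OF s(3)] .
  show fin: "finite s" by (rule finite_subset[OF s(4)]) (simp add: a b c)
  consider "s \<subseteq> {(x, y, z)}" | "s \<subseteq> {(x', y, z), (x, y', z), (x, y, z')}"
    | "s \<subseteq> {(x, y', z'), (x', y, z'), (x', y', z)}" | "s \<subseteq> {(x', y', z')}"
  proof -
    define n where "n = height x + height y + height z"
    have mem: "i \<in> {x, x'} \<and> j \<in> {y, y'} \<and> k \<in> {z, z'} \<and> height i + height j + height k = 0"
      if "(i, j, k) \<in> s" for i j k
      using that s(4,5) a(1) b(1) c(1) level_set_iff by blast
    have subset: "s \<subseteq> A"
      if "\<And>i j k. i \<in> {x, x'} \<Longrightarrow> j \<in> {y, y'} \<Longrightarrow> k \<in> {z, z'} \<Longrightarrow> height i + height j + height k = 0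
        \<Longrightarrow> (i, j, k) \<in> A" for A
      using that mem by (auto simp: subset_iff)
    obtain i j k where "(i, j, k) \<in> s" using s(6) by auto
    from mem[OF this] consider "n = 0" | "n = -1" | "n = -2" | "n = -3"
      using a(2) b(2) c(2) by (auto simp: n_def)
    then show ?thesis
    proof cases
      case 1
      show ?thesis by (rule that(1), rule subset) (use a(2) b(2) c(2) 1 in \<open>auto simp: n_def\<close>)
    next
      case 2
      show ?thesis by (rule that(2), rule subset) (use a(2) b(2) c(2) 2 in \<open>auto simp: n_def\<close>)
    next
      case 3
      show ?thesis by (rule that(3), rule subset) (use a(2) b(2) c(2) 3 in \<open>auto simp: n_def\<close>)
    next
      case 4
      show ?thesis by (rule that(4), rule subset) (use a(2) b(2) c(2) 4 in \<open>auto simp: n_def\<close>)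
    qed
  qed
  then have "\<exists>u v w. s \<subseteq> {u, v, w}" by cases blast+
  then obtain u v w where "s \<subseteq> {u, v, w}" by blast
  then have "card s \<le> card {u, v, w}" by (intro card_mono) auto
  also have "\<dots> \<le> 3" by (simp add: card_insert_if)
  finally have "card s \<le> 3" .
  moreover have "card s \<noteq> 0" using fin s(6) by simp
  ultimately show "card s \<in> {1, 2, 3}" by auto
qed

section \<open>Local finiteness and the single end\<close>

lemma finite_star: "finite {v. is_simplex {u, v}}"
proof -
  define N where "N w = insert w (insert (butlast w) ((\<lambda>l. w @ [l]) ` ({0, 1} \<times> UNIV)))"
    for w :: "nat letter list"
  have fin: "finite (N w)" for w by (simp add: N_def)
  have N: "w' \<in> N w" if "w' \<in> words" "tree_adjacent w w'" for w w'
    using that by (auto simp: N_def words_snoc)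
  have "{v. is_simplex {u, v}} \<subseteq> N (fst u) \<times> N (fst (snd u)) \<times> N (snd (snd u))"
  proof
    fix v assume "v \<in> {v. is_simplex {u, v}}"
    then have uv: "is_simplex {u, v}" by simp
    then have "v \<in> level_set" unfolding is_simplex_def by blast
    then have "fst v \<in> words" "fst (snd v) \<in> words" "snd (snd v) \<in> words"
      by (cases v; simp add: level_set_iff)+
    then show "v \<in> N (fst u) \<times> N (fst (snd u)) \<times> N (snd (snd u))"
      using N coordinates_adjacent[OF uv] by (simp add: mem_Times_iff)
  qed
  then show ?thesis by (rule finite_subset) (use fin in blast)
qed

lemma finite_simplices_at: "finite {s. is_simplex s \<and> u \<in> s}"
proof (rule finite_subset)
  show "{s. is_simplex s \<and> u \<in> s} \<subseteq> Pow {v. is_simplex {u, v}}"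
  proof (intro subsetI PowI)
    fix s v assume "s \<in> {s. is_simplex s \<and> u \<in> s}" "v \<in> s"
    then show "v \<in> {v. is_simplex {u, v}}" using simplex_subset[of s "{u, v}"] by simp
  qed
qed (simp add: finite_star)

lemma finite_near: "finite (level_set - far n)"
proof (rule finite_subset)
  have *: "finite {w \<in> words. length w \<le> n}"
    by (rule finite_subset[OF _ finite_lists_length_le[of "{0, 1} \<times> UNIV" n]]) (auto simp:
      words_iff)
  show "level_set - far n \<subseteq> {w \<in> words. length w \<le> n} \<times> {w \<in> words. length w \<le> n} \<times> {w \<in> words.
    length w \<le> n}"
    by (auto simp: far_def level_set_iff)
  show "finite ({w \<in> words. length w \<le> n} \<times> {w \<in> words. length w \<le> n} \<times> {w \<in> words. length w \<le> n})"
    using * by blast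
qed

lemma finite_imp_near:
  assumes "finite K" shows "\<exists>n. K \<inter> far n = {}"
proof -
  define L where "L u = length (fst u) + length (fst (snd u)) + length (snd (snd u))"
    for u :: F2_cubed
  obtain n where "\<forall>u\<in>K. L u \<le> n"
    using finite_imageI[OF assms, of L] by (meson finite_nat_set_iff_bounded_le imageI)
  then have "K \<inter> far n = {}" by (auto simp: far_def L_def)
  then show ?thesis by blast
qed

lemma infinite_far: "infinite (far n)"
proof
  assume "finite (far n)"
  then have "finite (far n \<union> (level_set - far n))" using finite_near by blast
  then have "finite level_set" by (rule rev_finite_subset) blast
  then obtain m where m: "level_set \<inter> far m = {}" using finite_imp_near by blast
  obtain p where p: "p \<in> words" "length p = Suc m" using words_extend_length by blast
  have "piece 0 p \<noteq> {}" unfolding piece_def using p by (simp add: level_region_ne Nil_in_words)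
  then show False using m piece_far[of 0 p m] p by (auto simp: far_def)
qed

lemma simplex_quotient:
  assumes "is_simplex {u, v}"
  shows "u \<in> level_set" "v \<in> level_set" "is_simplex {origin, act (act_inv u) v}"
    "v = act u (act (act_inv u) v)"
proof -
  show u: "u \<in> level_set" "v \<in> level_set" using assms unfolding is_simplex_def by auto
  show "is_simplex {origin, act (act_inv u) v}"
    using simplex_act[OF assms, of "act_inv u"] u by simp
  show "v = act u (act (act_inv u) v)"
    using u by (simp add: stallings.m_assoc[symmetric])
qed

text \<open>Left translation identifies the edges of the level complex with steps by neighbours of
  \<open>origin\<close>. Connectedness of the level set then says that these neighbours generate;
  \<open>far n\<close> is connected with finite complement, so after removing \<open>K\<close> every
  infinite component must meet it, and only one can.\<close>

lemma one_ended_stallings: "one_ended stallings_group"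
  unfolding one_ended_def
proof (intro exI conjI allI impI)
  let ?S = "{v. is_simplex {origin, v}}"
  show "finite ?S" by (rule finite_star)
  show S: "?S \<subseteq> level_set" unfolding is_simplex_def by auto
  show "generate stallings_group ?S = level_set"
  proof
    show "generate stallings_group ?S \<subseteq> level_set" using stallings.generate_incl S .
    show "level_set \<subseteq> generate stallings_group ?S"
    proof
      fix v assume v: "v \<in> level_set"
      have "(origin, v) \<in> (links is_simplex level_set)\<^sup>*"
        using conn_level_region[of "[]" "[]" "[]"] v unfolding level_region_Nil conn_def by blast
      then show "v \<in> generate stallings_group ?S"
      proof (induction rule: rtrancl_induct)
        case (step u w)
        then have uw: "is_simplex {u, w}" by (simp add: links_def)
        have "act (act_inv u) w \<in> generate stallings_group ?S"
          using simplex_quotient(3)[OF uw] by (intro generate.incl) simp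
        then have "act u (act (act_inv u) w) \<in> generate stallings_group ?S"
          by (rule generate.eng[OF step.IH])
        then show ?case using simplex_quotient(4)[OF uw] by simp
      qed (rule generate.one)
    qed
  qed
  fix K assume K: "finite K \<and> K \<subseteq> level_set"
  define V where "V = level_set - K"
  define R where "R = {(x, y). x \<in> V \<and> y \<in> V \<and> (\<exists>s\<in>?S. y = act x s \<or> x = act y s)}"
  have comp: "cayley_components stallings_group ?S K = (\<lambda>x. R\<^sup>* `` {x}) ` V"
    by (simp add: cayley_components_def V_def R_def)
  obtain n where n: "K \<inter> far n = {}" using finite_imp_near K by blast
  have far_V: "far n \<subseteq> V" using n by (auto simp: V_def far_def)
  have "links is_simplex (far n) \<subseteq> R"
  proof
    fix p assume "p \<in> links is_simplex (far n)"
    then obtain u v where uv: "p = (u, v)" "u \<in> far n" "v \<in> far n" "is_simplex {u, v}"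
      by (auto simp: links_def)
    then show "p \<in> R" using far_V simplex_quotient(3,4)[OF uv(4)] unfolding R_def by blast
  qed
  then have far_R: "(u, v) \<in> R\<^sup>*" if "u \<in> far n" "v \<in> far n" for u v
    using conn_far[of n] that rtrancl_mono unfolding conn_def by blast
  have "sym R" by (auto simp: sym_def R_def)
  then have sym: "sym (R\<^sup>*)" by (rule sym_rtrancl)
  obtain u0 where u0: "u0 \<in> far n" using infinite_far by (metis finite.emptyI ex_in_conv)
  have V_R: "y \<in> V" if "(x, y) \<in> R\<^sup>*" "x \<in> V" for x y
    using that by (induction rule: rtrancl_induct) (auto simp: R_def)
  show "\<exists>!C. C \<in> cayley_components stallings_group ?S K \<and> infinite C"
  proof (rule ex1I[of _ "R\<^sup>* `` {u0}"])
    have "far n \<subseteq> R\<^sup>* `` {u0}" using far_R u0 by blast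
    then show "R\<^sup>* `` {u0} \<in> cayley_components stallings_group ?S K \<and> infinite (R\<^sup>* `` {u0})"
      unfolding comp using u0 far_V infinite_far infinite_super by blast
    fix C assume C: "C \<in> cayley_components stallings_group ?S K \<and> infinite C"
    then obtain x where x: "x \<in> V" "C = R\<^sup>* `` {x}" unfolding comp by blast
    have "\<not> C \<subseteq> level_set - far n" using C finite_near finite_subset by blast
    then obtain y where y: "(x, y) \<in> R\<^sup>*" "y \<in> far n" using x V_R V_def by blast
    then have xu: "(x, u0) \<in> R\<^sup>*" using far_R[OF y(2) u0] by simp
    then have "(u0, x) \<in> R\<^sup>*" using sym by (auto dest: symD)
    then show "C = R\<^sup>* `` {u0}" using xu x(2) by (auto intro: rtrancl_trans)
  qed
qed

section \<open>Geometric realization\<close>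

text \<open>Vertices are numbered by countability and realized as unit vectors of
  \<open>linfty\<close>; for points of a simplex these entries are the barycentric coordinates, and
  distance is their largest difference.\<close>

definition coord :: "linfty \<Rightarrow> 'v::countable \<Rightarrow> real" where
  "coord f v = apply_bcontfun f (to_nat v)"

definition vert :: "'v::countable \<Rightarrow> linfty" where
  "vert v = Bcontfun (\<lambda>n. if n = to_nat v then 1 else 0)"

definition simplex_hull :: "'v::countable set \<Rightarrow> linfty set" where
  "simplex_hull s = convex hull (vert ` s)"

definition support :: "linfty \<Rightarrow> 'v::countable set" where
  "support f = {v. coord f v \<noteq> 0}"

lemma apply_Bcontfun_nat:
  fixes g :: "nat \<Rightarrow> real"
  assumes "bounded (range g)" shows "apply_bcontfun (Bcontfun g) = g"
  using assms by (intro Bcontfun_inverse) (simp add: bcontfun_def)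

lemma apply_vert: "apply_bcontfun (vert v) n = (if n = to_nat v then 1 else 0)"
proof -
  have "bounded (range (\<lambda>n. if n = to_nat v then 1 else 0 :: real))"
    by (rule boundedI[of _ 1]) auto
  then show ?thesis unfolding vert_def by (simp add: apply_Bcontfun_nat)
qed

lemma coord_vert: "coord (vert v) w = (if v = w then 1 else 0)"
  by (auto simp: coord_def apply_vert)

lemma inj_vert: "inj (vert :: 'v::countable \<Rightarrow> linfty)"
  by (rule injI) (metis coord_vert zero_neq_one)

lemma coord_linear: "coord (a *\<^sub>R f + b *\<^sub>R g) v = a * coord f v + b * coord g v"
  by (simp add: coord_def)

lemma apply_sum: "finite s \<Longrightarrow> apply_bcontfun (\<Sum>v\<in>s. F v) n = (\<Sum>v\<in>s. apply_bcontfun (F v) n)"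
  by (induction s rule: finite_induct) auto

lemma coord_point: "finite s \<Longrightarrow> coord (\<Sum>v\<in>s. c v *\<^sub>R vert v) w = (if w \<in> s then c w else 0)"
  by (simp add: coord_def apply_sum apply_vert if_distrib[of "(*) _"] sum.delta cong: if_cong)

lemma abs_coord_diff: "\<bar>coord f v - coord g v\<bar> \<le> dist f g"
  using dist_bounded[of f "to_nat v" g] by (simp add: coord_def dist_real_def)

lemma continuous_on_coord: "continuous_on A (\<lambda>f. coord f v)"
  unfolding continuous_on_iff using abs_coord_diff by (metis dist_real_def order_le_less_trans)

lemma open_coord_pos: "open {f. 0 < coord f v}"
  by (intro open_Collect_less continuous_on_coord continuous_on_const)

lemma simplex_hullE:
  assumes "f \<in> simplex_hull s" "finite s"
  obtains c where "\<And>v. v \<in> s \<Longrightarrow> 0 \<le> c v" "sum c s = 1" "f = (\<Sum>v\<in>s. c v *\<^sub>R vert v)"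
proof -
  obtain u where u: "\<forall>x\<in>vert ` s. 0 \<le> u x" "sum u (vert ` s) = 1" "(\<Sum>x\<in>vert ` s. u x *\<^sub>R x) = f"
    using assms by (auto simp: simplex_hull_def convex_hull_finite)
  have inj: "inj_on vert s" using inj_vert inj_on_subset by blast
  show ?thesis
    by (rule that[of "u \<circ> vert"]) (use u in \<open>auto simp: sum.reindex[OF inj]\<close>)
qed

lemma simplex_hullI:
  assumes "finite s" "\<And>v. v \<in> s \<Longrightarrow> 0 \<le> c v" "sum c s = 1"
  shows "(\<Sum>v\<in>s. c v *\<^sub>R vert v) \<in> simplex_hull s"
  unfolding simplex_hull_def
  using assms by (intro convex_sum) (auto intro: hull_inc)

lemma convex_simplex_hull: "convex (simplex_hull s)"
  by (simp add: simplex_hull_def)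

lemma simplex_hull_mono: "s \<subseteq> s' \<Longrightarrow> simplex_hull s \<subseteq> simplex_hull s'"
  unfolding simplex_hull_def by (intro hull_mono image_mono)

lemma vert_in_hull: "v \<in> s \<Longrightarrow> vert v \<in> simplex_hull s"
  unfolding simplex_hull_def by (intro hull_inc imageI)

lemma simplex_hull_coord:
  fixes s :: "'v::countable set"
  assumes "f \<in> simplex_hull s" "finite s"
  shows "f = (\<Sum>v\<in>s. coord f v *\<^sub>R vert v)" "0 \<le> coord f (v::'v)" "(\<Sum>v\<in>s. coord f v) = 1"
    "support f \<subseteq> s"
proof -
  obtain c where c: "\<And>v. v \<in> s \<Longrightarrow> 0 \<le> c v" "sum c s = 1" "f = (\<Sum>v\<in>s. c v *\<^sub>R vert v)"
    using simplex_hullE[OF assms] by metis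
  have co: "coord f w = (if w \<in> s then c w else 0)" for w
    unfolding c(3) by (rule coord_point[OF assms(2)])
  show "f = (\<Sum>v\<in>s. coord f v *\<^sub>R vert v)" by (subst c(3)) (intro sum.cong, auto simp: co)
  show "0 \<le> coord f v" "(\<Sum>v\<in>s. coord f v) = 1" "support f \<subseteq> s"
    using c(1,2) by (auto simp: co support_def split: if_splits)
qed

lemma simplex_hull_support:
  fixes s :: "'v::countable set"
  assumes f: "f \<in> simplex_hull s" "finite s"
  shows "f \<in> simplex_hull (support f :: 'v set)" "support f \<noteq> ({} :: 'v set)"
proof -
  note co = simplex_hull_coord[OF f]
  have fin: "finite (support f :: 'v set)" using co(4) f(2) finite_subset by blast
  have sum: "(\<Sum>v\<in>support f. coord f (v::'v)) = 1"
    unfolding co(3)[symmetric]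
      by (rule sum.mono_neutral_left[OF f(2) co(4)]) (auto simp: support_def)
  have "(\<Sum>v\<in>s. coord f v *\<^sub>R vert v) = (\<Sum>v\<in>support f. coord f (v::'v) *\<^sub>R vert v)"
    by (rule sum.mono_neutral_right[OF f(2) co(4)]) (auto simp: support_def)
  then have "f = (\<Sum>v\<in>support f. coord f (v::'v) *\<^sub>R vert v)"
    by (rule trans[OF co(1)])
  moreover have "(\<Sum>v\<in>support f. coord f (v::'v) *\<^sub>R vert v) \<in> simplex_hull (support f :: 'v set)"
    by (rule simplex_hullI) (use fin co(2) sum in auto)
  ultimately show "f \<in> simplex_hull (support f :: 'v set)"
    by (rule ssubst[where P = "\<lambda>x. x \<in> simplex_hull (support f :: 'v set)"])
  show "support f \<noteq> ({} :: 'v set)" using sum by auto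
qed

text \<open>\<open>coord\<close> only sees the entries whose index is the number of a vertex. On
  hulls nothing is lost, because a point is the combination of unit vectors with its coordinates as
  coefficients.\<close>

lemma simplex_hull_ext:
  fixes s s' :: "'v::countable set"
  assumes "f \<in> simplex_hull s" "finite s" "g \<in> simplex_hull s'" "finite s'"
    and "\<And>v::'v. coord f v = coord g v"
  shows "f = g"
proof -
  have supp: "support f = (support g :: 'v set)" using assms(5) by (simp add: support_def)
  have f: "f \<in> simplex_hull (support g :: 'v set)" and g: "g \<in> simplex_hull (support g :: 'v set)"
    using simplex_hull_support(1)[OF assms(1,2)] simplex_hull_support(1)[OF assms(3,4)] supp by auto
  have fin: "finite (support g :: 'v set)"
    using simplex_hull_coord(4)[OF assms(3,4)] assms(4) finite_subset by blast
  have "f = (\<Sum>v\<in>support g. coord g (v::'v) *\<^sub>R vert v)"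
    using simplex_hull_coord(1)[OF f fin] unfolding assms(5) .
  then show ?thesis using simplex_hull_coord(1)[OF g fin] by (rule trans[OF _ sym])
qed

locale simplicial_complex =
  fixes sx :: "'v::countable set \<Rightarrow> bool"
  assumes sx_finite: "sx s \<Longrightarrow> finite s"
    and sx_subset: "sx s \<Longrightarrow> s' \<subseteq> s \<Longrightarrow> s' \<noteq> {} \<Longrightarrow> sx s'"
begin

text \<open>The realization of the full subcomplex spanned by \<open>U\<close>.\<close>

definition body :: "'v set \<Rightarrow> linfty set" where
  "body U = (\<Union>s\<in>{s. sx s \<and> s \<subseteq> U}. simplex_hull s)"

lemma body_support:
  assumes "f \<in> body U" shows "sx (support f)" "support f \<subseteq> U"
    "f \<in> simplex_hull (support f :: 'v set)"
    "finite (support f :: 'v set)" "support f \<noteq> ({} :: 'v set)" "0 \<le> coord f (v::'v)"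
proof -
  obtain s where s: "sx s" "s \<subseteq> U" "f \<in> simplex_hull s" using assms by (auto simp: body_def)
  note fin = sx_finite[OF s(1)]
  show "f \<in> simplex_hull (support f :: 'v set)" "support f \<noteq> ({} :: 'v set)"
    using simplex_hull_support[OF s(3) fin] by auto
  show "support f \<subseteq> U" "0 \<le> coord f v" "finite (support f :: 'v set)"
    using simplex_hull_coord[OF s(3) fin] s fin by (auto intro: finite_subset)
  show "sx (support f)"
    by (rule sx_subset[OF s(1) simplex_hull_coord(4)[OF s(3) fin] simplex_hull_support(2)[OF s(3)
      fin]])
qed

lemma bodyI: "sx s \<Longrightarrow> s \<subseteq> U \<Longrightarrow> f \<in> simplex_hull s \<Longrightarrow> f \<in> body U"
  by (auto simp: body_def)

lemma body_mono: "U \<subseteq> U' \<Longrightarrow> body U \<subseteq> body U'"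
  by (auto simp: body_def)

lemma body_subsetI: "f \<in> body U \<Longrightarrow> support f \<subseteq> U' \<Longrightarrow> f \<in> body U'"
  using body_support(1,3) bodyI by blast

lemma support_pos: "f \<in> body U \<Longrightarrow> (v::'v) \<in> support f \<longleftrightarrow> 0 < coord f v"
  using body_support(6)[of f U v] by (auto simp: support_def)

lemma hull_body: "sx s \<Longrightarrow> s \<subseteq> U \<Longrightarrow> simplex_hull s \<subseteq> body U"
  by (auto simp: body_def)

lemma linepath_hull: "a \<in> simplex_hull s \<Longrightarrow> b \<in> simplex_hull s
  \<Longrightarrow> path_image (linepath a b) \<subseteq> simplex_hull s"
  by (simp add: closed_segment_subset convex_simplex_hull)

lemma linepath_body:
  "sx s \<Longrightarrow> s \<subseteq> U \<Longrightarrow> a \<in> simplex_hull s \<Longrightarrow> b \<in> simplex_hull s \<Longrightarrow> path_image (linepath a b) \<subseteq> body U"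
  using linepath_hull hull_body by blast

lemma vert_body: "sx s \<Longrightarrow> v \<in> s \<Longrightarrow> s \<subseteq> U \<Longrightarrow> vert v \<in> body U"
  using vert_in_hull hull_body by blast

lemma hull_homotopic:
  assumes "sx s" "s \<subseteq> U" "path p" "path q" "path_image p \<subseteq> simplex_hull s"
    "path_image q \<subseteq> simplex_hull s"
    "pathstart p = pathstart q" "pathfinish p = pathfinish q"
  shows "homotopic_paths (body U) p q"
proof (rule homotopic_paths_subset)
  show "homotopic_paths (simplex_hull s) p q"
    using convex_imp_simply_connected[OF convex_simplex_hull[of s]] assms
    unfolding simply_connected_eq_homotopic_paths by simp
qed (use assms hull_body in blast)

lemma triangle_homotopic:
  assumes "sx s" "s \<subseteq> U" "a \<in> simplex_hull s" "b \<in> simplex_hull s" "c \<in> simplex_hull s"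
  shows "homotopic_paths (body U) (linepath a b +++ linepath b c) (linepath a c)"
  using assms by (intro hull_homotopic[of s]) (auto simp: path_image_join linepath_hull[unfolded
    path_image_linepath])

lemma path_connected_body:
  assumes "conn sx U" shows "path_connected (body U)"
proof -
  have to_vert: "path_component (body U) f (vert v)"
    if f: "f \<in> body U" and v: "v \<in> support f" for f and v :: 'v
    unfolding path_component_def
    using linepath_body[OF body_support(1,2)[OF f] body_support(3)[OF f] vert_in_hull[OF v]]
    by (intro exI[of _ "linepath f (vert v)"]) auto
  have step: "path_component (body U) (vert u) (vert v)" if "sx {u, v}" "u \<in> U" "v \<in> U" for u v
    unfolding path_component_def
    using linepath_body[OF that(1) _ vert_in_hull[of u] vert_in_hull[of v], of U] that
    by (intro exI[of _ "linepath (vert u) (vert v)"]) auto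
  have chain: "path_component (body U) (vert u) (vert v)"
    if "(u, v) \<in> (links sx U)\<^sup>*" "vert u \<in> body U" for u v
    using that
  proof (induction rule: rtrancl_induct)
    case (step w v)
    then show ?case using \<open>\<And>v u. \<lbrakk>sx {u, v}; u \<in> U; v \<in> U\<rbrakk>
      \<Longrightarrow> path_component (body U) (vert u) (vert v)\<close>
      by (auto simp: links_def intro: path_component_trans)
  qed (simp add: path_component_refl)
  show ?thesis
    unfolding path_connected_component
  proof (intro ballI)
    fix f g assume f: "f \<in> body U" and g: "g \<in> body U"
    obtain u v :: 'v where uv: "u \<in> support f" "v \<in> support g"
      using body_support(5)[OF f] body_support(5)[OF g] by blast
    then have "(u, v) \<in> (links sx U)\<^sup>*"
      using assms body_support(2)[OF f] body_support(2)[OF g] unfolding conn_def by blast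
    moreover have "vert u \<in> body U" using vert_body body_support(1,2)[OF f] uv by blast
    ultimately show "path_component (body U) f g"
      using to_vert[OF f uv(1)] to_vert[OF g uv(2)] chain
      by (meson path_component_sym path_component_trans)
  qed
qed

end

section \<open>Homotopy classes of paths as a local system\<close>

lemma homotopic_paths_cancel:
  assumes "homotopic_paths X (p +++ q) p" "path p" "path q" "path_image p \<subseteq> X" "path_image q \<subseteq> X"
    "pathfinish p = pathstart q"
  shows "homotopic_paths X q (linepath (pathstart q) (pathstart q))"
proof -
  have "homotopic_paths X q (linepath (pathstart q) (pathstart q) +++ q)"
    using assms by (intro homotopic_paths_sym[OF homotopic_paths_lid])
  also have "homotopic_paths X \<dots> ((reversepath p +++ p) +++ q)"
    using assms homotopic_paths_linv[of p X]
    by (intro homotopic_paths_join homotopic_paths_sym[OF homotopic_paths_linv[of p X, unfolded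
      assms(6)]]) auto
  also have "homotopic_paths X \<dots> (reversepath p +++ (p +++ q))"
    using assms by (intro homotopic_paths_sym[OF homotopic_paths_assoc]) auto
  also have "homotopic_paths X \<dots> (reversepath p +++ p)"
    using assms by (intro homotopic_paths_join) auto
  also have "homotopic_paths X \<dots> (linepath (pathstart q) (pathstart q))"
    using homotopic_paths_linv[of p X] assms by simp
  finally show ?thesis .
qed

lemma homotopy_class_eq:
  assumes "homotopic_paths X p q" shows "homotopy_class X p = homotopy_class X q"
proof -
  have "homotopic_paths X p r \<longleftrightarrow> homotopic_paths X q r" for r
    using homotopic_paths_trans[OF assms, of r] homotopic_paths_trans[OF homotopic_paths_sym[OF
      assms], of r] by blast
  then show ?thesis unfolding homotopy_class_def by (intro Collect_cong)
qed

lemma homotopy_class_eqD: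
  assumes "homotopy_class X p = homotopy_class X q" "path q" "path_image q \<subseteq> X"
  shows "homotopic_paths X p q"
proof -
  have "q \<in> homotopy_class X q" using assms by (simp add: homotopy_class_def)
  then show ?thesis using assms(1) by (auto simp: homotopy_class_def)
qed

context simplicial_complex
begin

definition paths_to :: "'v set \<Rightarrow> linfty \<Rightarrow> 'v \<Rightarrow> (real \<Rightarrow> linfty) set" where
  "paths_to U a v = {q. path q \<and> path_image q \<subseteq> body U \<and> pathstart q = a \<and> pathfinish q = vert v}"

definition path_classes :: "'v set \<Rightarrow> linfty \<Rightarrow> 'v \<Rightarrow> (real \<Rightarrow> linfty) set set" where
  "path_classes U a v = homotopy_class (body U) ` paths_to U a v"

text \<open>A homotopy class is literally a set of paths, so a representative has to be picked by
  \<open>SOME\<close>; \<open>transport_class\<close> shows that the result does not depend on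
  it.\<close>

definition transport :: "'v set \<Rightarrow> 'v \<Rightarrow> 'v \<Rightarrow> (real \<Rightarrow> linfty) set \<Rightarrow> (real \<Rightarrow> linfty) set" where
  "transport U u v P = homotopy_class (body U) ((SOME q. q \<in> P) +++ linepath (vert u) (vert v))"

lemma class_representative:
  assumes "q \<in> paths_to U a v"
  shows "homotopic_paths (body U) q (SOME p. p \<in> homotopy_class (body U) q)"
proof -
  have "q \<in> homotopy_class (body U) q" using assms by (simp add: homotopy_class_def paths_to_def)
  then have "(SOME p. p \<in> homotopy_class (body U) q) \<in> homotopy_class (body U) q"
    unfolding some_in_eq by blast
  then show ?thesis by (simp add: homotopy_class_def)
qed

lemma edge_path:
  assumes "sx {u, v}" "u \<in> U" "v \<in> U"
  shows "path_image (linepath (vert u) (vert v)) \<subseteq> body U"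
  using linepath_body[OF assms(1), of U "vert u" "vert v"] assms by (auto intro: vert_in_hull)

lemma transport_class:
  assumes q: "q \<in> paths_to U a u" and uv: "sx {u, v}" "u \<in> U" "v \<in> U"
  shows "transport U u v (homotopy_class (body U) q)
    = homotopy_class (body U) (q +++ linepath (vert u) (vert v))"
    "q +++ linepath (vert u) (vert v) \<in> paths_to U a v"
proof -
  show "q +++ linepath (vert u) (vert v) \<in> paths_to U a v"
    using q edge_path[OF uv] by (auto simp: paths_to_def path_image_join)
  have "homotopic_paths (body U) (q +++ linepath (vert u) (vert v))
      ((SOME p. p \<in> homotopy_class (body U) q) +++ linepath (vert u) (vert v))"
    using q edge_path[OF uv] by (intro homotopic_paths_join class_representative[OF q]) (auto simp:
      paths_to_def)
  then show "transport U u v (homotopy_class (body U) q)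
    = homotopy_class (body U) (q +++ linepath (vert u) (vert v))"
    unfolding transport_def by (rule homotopy_class_eq[symmetric])
qed

text \<open>The triangle law holds because two sides of a simplex are homotopic to the third inside
  its convex hull.\<close>

lemma local_system_paths: "local_system sx U (path_classes U a) (transport U)"
proof
  fix u v P assume uv: "u \<in> U" "v \<in> U" "sx {u, v}" and "P \<in> path_classes U a u"
  then obtain q where q: "q \<in> paths_to U a u" "P = homotopy_class (body U) q"
    by (auto simp: path_classes_def)
  show "transport U u v P \<in> path_classes U a v"
    unfolding q(2) path_classes_def using transport_class[OF q(1) uv(3,1,2)] by simp
next
  fix u v w P assume uvw: "u \<in> U" "v \<in> U" "w \<in> U" "sx {u, v, w}" and "P \<in> path_classes U a u"
  then obtain q where q: "q \<in> paths_to U a u" "P = homotopy_class (body U) q"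
    by (auto simp: path_classes_def)
  have sub: "sx {u, v}" "sx {v, w}" "sx {u, w}" using sx_subset[OF uvw(4)] by auto
  let ?uv = "linepath (vert u) (vert v) :: real \<Rightarrow> linfty"
    and ?vw = "linepath (vert v) (vert w) :: real \<Rightarrow> linfty"
  have "transport U v w (transport U u v P) = homotopy_class (body U) ((q +++ ?uv) +++ ?vw)"
    unfolding q(2) transport_class(1)[OF q(1) sub(1) uvw(1,2)]
    by (rule transport_class(1)[OF transport_class(2)[OF q(1) sub(1) uvw(1,2)] sub(2) uvw(2,3)])
  also have "\<dots> = homotopy_class (body U) (q +++ (?uv +++ ?vw))"
    using q(1) edge_path[OF sub(1) uvw(1,2)] edge_path[OF sub(2) uvw(2,3)]
    by (intro homotopy_class_eq homotopic_paths_sym[OF homotopic_paths_assoc]) (auto simp: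
      paths_to_def)
  also have "\<dots> = homotopy_class (body U) (q +++ linepath (vert u) (vert w))"
    using q(1) uvw
    by (intro homotopy_class_eq homotopic_paths_join triangle_homotopic[OF uvw(4)]) (auto simp:
      paths_to_def intro: vert_in_hull)
  also have "\<dots> = transport U u w P"
    unfolding q(2) by (rule transport_class(1)[OF q(1) sub(3) uvw(1,3), symmetric])
  finally show "transport U v w (transport U u v P) = transport U u w P" .
next
  fix u P assume u: "u \<in> U" and "P \<in> path_classes U a u"
  then obtain q where q: "q \<in> paths_to U a u" "P = homotopy_class (body U) q"
    by (auto simp: path_classes_def)
  have "vert u \<in> body U" using q(1) pathfinish_in_path_image[of q] by (auto simp: paths_to_def)
  then have "homotopic_paths (body U) (SOME p. p \<in> P) ((SOME p. p \<in> P) +++ linepath (vert u) (vert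
    u))"
    unfolding q(2) using class_representative[OF q(1)] q(1)
      homotopic_paths_imp_path[OF class_representative[OF q(1)]] homotopic_paths_imp_subset[OF
        class_representative[OF q(1)]]
      homotopic_paths_imp_pathfinish[OF class_representative[OF q(1)]]
    by (intro homotopic_paths_sym[OF homotopic_paths_rid']) (auto simp: paths_to_def)
  then have "homotopic_paths (body U) q ((SOME p. p \<in> P) +++ linepath (vert u) (vert u))"
    using class_representative[OF q(1)] unfolding q(2) by (rule homotopic_paths_trans[rotated])
  then show "transport U u u P = P"
    unfolding transport_def q(2) by (rule homotopy_class_eq[symmetric, unfolded q(2)])
qed

text \<open>The points with positive coordinate at \<open>v\<close> form the open star of
  \<open>v\<close>, which is starlike about \<open>vert v\<close> and hence simply
  connected.\<close>

lemma star_homotopic: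
  fixes v :: 'v
  assumes v: "sx {v}" "v \<in> U" and p: "path p" "path_image p \<subseteq> body U \<inter> {f. 0 < coord f v}"
  shows "homotopic_paths (body U) (linepath (vert v) (pathstart p) +++ p) (linepath (vert v)
    (pathfinish p))"
proof -
  let ?S = "body U \<inter> {f. 0 < coord f v}"
  have vS: "vert v \<in> ?S" using vert_body[OF v(1), of v U] v(2) by (simp add: coord_vert)
  have seg: "closed_segment (vert v) f \<subseteq> ?S" if f: "f \<in> ?S" for f
  proof
    have fU: "f \<in> body U" and supp: "v \<in> support f" using f by (auto simp: support_def)
    fix g assume g: "g \<in> closed_segment (vert v) f"
    then obtain t where t: "g = (1 - t) *\<^sub>R vert v + t *\<^sub>R f" "0 \<le> t" "t \<le> 1"
      by (auto simp: closed_segment_def)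
    have "coord g v = (1 - t) * 1 + t * coord f v" unfolding t(1) coord_linear
      by (simp add: coord_vert)
    also have "\<dots> > 0" using t f by (cases "t = 1") (auto intro: add_pos_nonneg)
    finally have "0 < coord g v" .
    moreover have "g \<in> body U"
      using linepath_body[OF body_support(1)[OF fU] body_support(2)[OF fU] vert_in_hull[OF supp]
        body_support(3)[OF fU]] g
      by auto
    ultimately show "g \<in> ?S" by simp
  qed
  have "starlike ?S" unfolding starlike_def using vS seg by blast
  then have sc: "simply_connected ?S" by (rule starlike_imp_simply_connected)
  have ends: "pathstart p \<in> ?S" "pathfinish p \<in> ?S"
    using p(2) pathstart_in_path_image pathfinish_in_path_image by blast+
  have "homotopic_paths ?S (linepath (vert v) (pathstart p) +++ p) (linepath (vert v) (pathfinish
    p))"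
    using sc p seg[OF ends(1)] seg[OF ends(2)] unfolding simply_connected_eq_homotopic_paths
    by (auto simp: path_image_join)
  then show ?thesis by (rule homotopic_paths_subset) blast
qed

text \<open>The open stars of the vertices cover the image of the path, and a Lebesgue number of
  this cover together with uniform continuity gives the subdivision.\<close>

lemma star_subdivision:
  assumes p: "path p" "path_image p \<subseteq> body U"
  obtains n where "0 < n" "\<And>k. k < n \<Longrightarrow> \<exists>v::'v. \<forall>t\<in>{real k / real n .. real (Suc k) / real n}. 0 <
    coord (p t) v"
proof -
  have cont: "continuous_on {0..1} p" using p by (simp add: path_def)
  have "path_image p \<subseteq> \<Union> (range (\<lambda>v::'v. {f. 0 < coord f v}))"
  proof
    fix f assume "f \<in> path_image p"
    then have f: "f \<in> body U" using p by blast
    then obtain v :: 'v where "v \<in> support f" using body_support(5) by blast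
    then show "f \<in> \<Union> (range (\<lambda>v::'v. {f. 0 < coord f v}))" using support_pos[OF f] by blast
  qed
  then obtain \<delta> where \<delta>: "0 < \<delta>" "\<And>T. T \<subseteq> path_image p \<Longrightarrow> diameter T < \<delta>
    \<Longrightarrow> \<exists>B\<in>range (\<lambda>v::'v. {f. 0 < coord f v}). T \<subseteq> B"
    using Lebesgue_number_lemma[OF compact_path_image[OF p(1)], of "range (\<lambda>v::'v. {f. 0 < coord f
      v})"] open_coord_pos
    by blast
  have "uniformly_continuous_on {0..1} p" using cont compact_uniformly_continuous by blast
  then obtain \<epsilon> where \<epsilon>: "0 < \<epsilon>" "\<And>s t. s \<in> {0..1} \<Longrightarrow> t \<in> {0..1} \<Longrightarrow> dist s t < \<epsilon>
    \<Longrightarrow> dist (p s) (p t) < \<delta> / 2"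
    unfolding uniformly_continuous_on_def using \<delta>(1) by (metis half_gt_zero dist_commute)
  obtain n :: nat where n: "0 < n" "1 / real n < \<epsilon>"
    using reals_Archimedean[OF \<epsilon>(1)] by (metis inverse_eq_divide zero_less_Suc)
  show ?thesis
  proof (rule that[OF n(1)])
    fix k assume k: "k < n"
    let ?I = "{real k / real n .. real (Suc k) / real n}"
    have I: "?I \<subseteq> {0..1}" using k n(1) by (auto simp: divide_simps)
    have "dist s t < \<epsilon>" if "s \<in> ?I" "t \<in> ?I" for s t
    proof -
      have "real (Suc k) / real n - real k / real n = 1 / real n" by (simp add: add_divide_distrib)
      then show ?thesis using that n(2) by (auto simp: dist_real_def)
    qed
    then have "dist (p s) (p t) \<le> \<delta> / 2" if "s \<in> ?I" "t \<in> ?I" for s t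
      using \<epsilon>(2) that I by (meson less_imp_le subsetD)
    then have "diameter (p ` ?I) \<le> \<delta> / 2"
      by (intro diameter_le) (use \<delta>(1) in \<open>auto simp: dist_norm\<close>)
    then have "diameter (p ` ?I) < \<delta>" using \<delta>(1) by simp
    moreover have "p ` ?I \<subseteq> path_image p" unfolding path_image_def by (rule image_mono[OF I])
    ultimately obtain v :: 'v where "p ` ?I \<subseteq> {f. 0 < coord f v}" using \<delta>(2) by blast
    then show "\<exists>v::'v. \<forall>t\<in>?I. 0 < coord (p t) v" by blast
  qed
qed

text \<open>A flat section of path classes selects a path \<open>s v\<close> from
  \<open>vert v0\<close> to every vertex \<open>v\<close> of \<open>U'\<close>, compatibly with
  edges. Prolonged by segments, it gives a path \<open>E\<close> to every point of
  \<open>body U'\<close>, and following \<open>p\<close> changes \<open>E\<close> only as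
  prescribed. Since \<open>p\<close> closes up, the initial path followed by \<open>p\<close> is
  homotopic to the initial path, and \<open>p\<close> cancels.\<close>

theorem body_loop_nullhomotopic:
  fixes U U' :: "'v set"
  assumes UU': "U' \<subseteq> U"
    and good: "\<And>(F :: 'v \<Rightarrow> (real \<Rightarrow> linfty) set set) t. local_system sx U F t
      \<Longrightarrow> local_system.good sx U F t U'"
    and p: "path p" "path_image p \<subseteq> body U'" "pathfinish p = pathstart p"
  shows "homotopic_paths (body U) p (linepath (pathstart p) (pathstart p))"
proof -
  let ?X = "body U"
  have start: "pathstart p \<in> body U'" using p(2) pathstart_in_path_image by blast
  obtain v0 :: 'v where v0: "v0 \<in> support (pathstart p)" using body_support(5)[OF start] by blast
  then have v0': "v0 \<in> U'" "v0 \<in> U" "sx {v0}"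
    using body_support(1,2)[OF start] UU' sx_subset by blast+
  have "vert v0 \<in> ?X" using vert_body v0' by blast
  then have c: "linepath (vert v0) (vert v0) \<in> paths_to U (vert v0) v0" by (simp add: paths_to_def)
  interpret L: local_system sx U "path_classes U (vert v0)" "transport U"
    by (rule local_system_paths)
  \<comment> \<open>The constant path merely provides some value at \<open>v0\<close> to extend. The
    value of the section at \<open>v0\<close> is not recorded, and \<open>s v0\<close> is only known
    to be some loop.\<close>
  obtain \<sigma> where \<sigma>: "L.flat_section U' \<sigma>"
    using good[OF local_system_paths, of "vert v0"] v0'(1) c unfolding L.good_def path_classes_def
      by blast
  have "\<exists>q. q \<in> paths_to U (vert v0) v \<and> \<sigma> v = homotopy_class ?X q" if "v \<in> U'" for v
    using \<sigma> that unfolding L.flat_section_def path_classes_def by blast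
  then obtain s where s: "\<And>v. v \<in> U' \<Longrightarrow> s v \<in> paths_to U (vert v0) v"
    "\<And>v. v \<in> U' \<Longrightarrow> \<sigma> v = homotopy_class ?X (s v)" by metis
  have s_edge: "homotopic_paths ?X (s u +++ linepath (vert u) (vert v)) (s v)"
    if uv: "u \<in> U'" "v \<in> U'" "sx {u, v}" for u v
  proof (rule homotopy_class_eqD)
    have "transport U u v (\<sigma> u) = \<sigma> v" using \<sigma> uv unfolding L.flat_section_def by blast
    then show "homotopy_class ?X (s u +++ linepath (vert u) (vert v)) = homotopy_class ?X (s v)"
      using transport_class(1)[OF s(1)[OF uv(1)] uv(3)] s(2) uv UU' by auto
  qed (use s(1)[OF uv(2)] in \<open>auto simp: paths_to_def\<close>)
  define E where "E v f = s v +++ linepath (vert v) f" for v f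
  have seg: "path_image (linepath (vert v) f) \<subseteq> ?X"
    if f: "f \<in> body U'" and v: "v \<in> support f" for f and v :: 'v
  proof (rule linepath_body[OF body_support(1)[OF f] _ vert_in_hull[OF v] body_support(3)[OF f]])
    show "support f \<subseteq> U" using body_support(2)[OF f] UU' by blast
  qed
  have E_path: "path (E v f)" "path_image (E v f) \<subseteq> ?X" "pathstart (E v f) = vert v0"
    "pathfinish (E v f) = f"
    if f: "f \<in> body U'" and v: "v \<in> support f" for f v
  proof -
    have "v \<in> U'" using body_support(2)[OF f] v by blast
    note sv = s(1)[OF this, unfolded paths_to_def, simplified]
    show "path_image (E v f) \<subseteq> ?X"
      unfolding E_def by (rule subset_path_image_join) (use sv seg[OF f v] in auto)
    show "path (E v f)" "pathstart (E v f) = vert v0" "pathfinish (E v f) = f"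
      unfolding E_def using sv by simp_all
  qed
  \<comment> \<open>Both vertices belong to the simplex carrying \<open>f\<close>, so the detour
    along their edge closes a triangle in the hull of that simplex.\<close>
  have E_indep: "homotopic_paths ?X (E u f) (E v f)"
    if f: "f \<in> body U'" and uv: "u \<in> support f" "v \<in> support f" for u v f
  proof -
    have u: "u \<in> U'" "v \<in> U'" "sx {u, v}"
      using body_support(2)[OF f] uv sx_subset[OF body_support(1)[OF f], of "{u, v}"] by auto
    note su = s(1)[OF u(1), unfolded paths_to_def, simplified]
      and sv = s(1)[OF u(2), unfolded paths_to_def, simplified]
    have uv_seg: "path_image (linepath (vert u) (vert v)) \<subseteq> ?X"
      using edge_path[OF u(3)] u UU' by blast
    have "homotopic_paths ?X (E v f) ((s u +++ linepath (vert u) (vert v)) +++ linepath (vert v) f)"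
      unfolding E_def using s_edge[OF u] sv seg[OF f uv(2)]
      by (intro homotopic_paths_join) (auto intro: homotopic_paths_sym)
    also have "homotopic_paths ?X \<dots> (s u +++ (linepath (vert u) (vert v) +++ linepath (vert v) f))"
      using su uv_seg seg[OF f uv(2)] by (intro homotopic_paths_sym[OF homotopic_paths_assoc]) auto
    also have "homotopic_paths ?X \<dots> (E u f)"
      unfolding E_def using su body_support[OF f] uv UU'
      by (intro homotopic_paths_join triangle_homotopic[of "support f"]) (auto intro: vert_in_hull)
    finally show ?thesis by (rule homotopic_paths_sym)
  qed
  let ?E0 = "E v0 (pathstart p)"
  note E0 = E_path[OF start v0]
  obtain n where n: "0 < n" "\<And>k. k < n \<Longrightarrow> \<exists>v::'v. \<forall>t\<in>{real k / real n .. real (Suc k) / real n}. 0 <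
    coord (p t) v"
    using star_subdivision[OF p(1,2)] by blast
  have pt: "p t \<in> body U'" if "t \<in> {0..1}" for t using p(2) that by (auto simp: path_image_def)
  have pX: "path_image p \<subseteq> ?X" using p(2) body_mono[OF UU'] by blast
  have sub: "path (subpath a b p)" "path_image (subpath a b p) \<subseteq> body U'"
    "path_image (subpath a b p) \<subseteq> ?X"
    if "a \<in> {0..1}" "b \<in> {0..1}" for a b
    using path_subpath[OF p(1) that] path_image_subpath_subset[OF that, of p] p(2) pX by auto
  \<comment> \<open>The claim is made for all vertices in the support of the current point, so that
    each step can continue with a vertex whose open star contains the next arc of
    \<open>p\<close>.\<close>
  have main: "k \<le> n \<Longrightarrow> \<forall>v\<in>support (p (real k / real n)).
      homotopic_paths ?X (?E0 +++ subpath 0 (real k / real n) p) (E v (p (real k / real n)))" for k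
  proof (induction k)
    case 0
    show ?case
    proof
      fix v :: 'v assume v: "v \<in> support (p (real 0 / real n))"
      have "homotopic_paths ?X (?E0 +++ linepath (pathstart p) (pathstart p)) ?E0"
        using homotopic_paths_rid[OF E0(1,2)] E0(4) by simp
      moreover have "subpath 0 0 p = linepath (pathstart p) (pathstart p)"
        by (simp add: subpath_refl pathstart_def)
      moreover have "homotopic_paths ?X ?E0 (E v (pathstart p))"
        using E_indep[OF start v0] v by (simp add: pathstart_def)
      ultimately show "homotopic_paths ?X (?E0 +++ subpath 0 (real 0 / real n) p) (E v (p (real 0 /
        real n)))"
        by (simp add: pathstart_def) (rule homotopic_paths_trans)
    qed
  next
    case (Suc k)
    define a b where "a = real k / real n" and "b = real (Suc k) / real n"
    have ab: "a \<in> {0..1}" "b \<in> {0..1}" "a \<le> b"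
      using Suc.prems n(1) by (auto simp: a_def b_def divide_simps)
    have "k < n" using Suc.prems by simp
    from n(2)[OF this] obtain v :: 'v where v: "\<And>t. t \<in> {a..b} \<Longrightarrow> 0 < coord (p t) v"
      unfolding a_def b_def by blast
    have va: "v \<in> support (p a)" "v \<in> support (p b)"
      using v[of a] v[of b] ab(3) by (auto simp: support_def)
    have vU: "v \<in> U'" "v \<in> U" "sx {v}"
      using body_support(2)[OF pt[OF ab(1)]] va(1) UU' sx_subset[OF body_support(1)[OF pt[OF
        ab(1)]], of "{v}"] by auto
    note sv = s(1)[OF vU(1), unfolded paths_to_def, simplified]
    have "path_image (subpath a b p) = p ` {a..b}" using ab(3) by (simp add: path_image_subpath)
    then have img: "path_image (subpath a b p) \<subseteq> ?X \<inter> {f. 0 < coord f v}"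
      using v sub(3)[OF ab(1,2)] by auto
    have zero: "(0::real) \<in> {0..1}" and p0: "pathstart p = p 0" by (auto simp: pathstart_def)
    have "homotopic_paths ?X (?E0 +++ subpath 0 b p) (?E0 +++ (subpath 0 a p +++ subpath a b p))"
      using E0 homotopic_join_subpaths[OF p(1) pX zero ab(1,2)]
      by (intro homotopic_paths_join) (auto intro: homotopic_paths_sym simp: p0)
    also have "homotopic_paths ?X \<dots> ((?E0 +++ subpath 0 a p) +++ subpath a b p)"
      using E0 sub[OF zero ab(1)] sub[OF ab(1,2)] by (intro homotopic_paths_assoc) (auto simp: p0)
    also have "homotopic_paths ?X \<dots> (E v (p a) +++ subpath a b p)"
      using Suc.IH Suc.prems va(1) sub[OF ab(1,2)] E0
        by (intro homotopic_paths_join) (auto simp: a_def)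
    also have "homotopic_paths ?X \<dots> (s v +++ (linepath (vert v) (p a) +++ subpath a b p))"
      unfolding E_def using sv seg[OF pt[OF ab(1)] va(1)] sub[OF ab(1,2)]
      by (intro homotopic_paths_sym[OF homotopic_paths_assoc]) auto
    also have "homotopic_paths ?X \<dots> (E v (p b))"
      unfolding E_def using sv star_homotopic[OF vU(3,2) sub(1)[OF ab(1,2)] img]
      by (intro homotopic_paths_join) auto
    finally have *: "homotopic_paths ?X (?E0 +++ subpath 0 b p) (E v (p b))" .
    show ?case
      using homotopic_paths_trans[OF * E_indep[OF pt[OF ab(2)] va(2)]] unfolding b_def by blast
  qed
  have "homotopic_paths ?X (?E0 +++ p) (E v0 (p 1))"
    using main[of n] n(1) v0 p(3) by (simp add: pathstart_def pathfinish_def)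
  then have "homotopic_paths ?X (?E0 +++ p) ?E0"
    using p(3) by (simp add: pathstart_def pathfinish_def)
  then show ?thesis using homotopic_paths_cancel E0 p(1) pX by blast
qed

end

section \<open>Quotients by isometric actions\<close>

text \<open>The constant \<open>\<delta>\<close> is a uniform form of free and properly
  discontinuous action; it yields evenly covered balls of one fixed radius.\<close>

locale isometric_action =
  fixes G :: "('g, 'm) monoid_scheme" (structure) and Y :: "'a::metric_space set"
    and \<alpha> :: "'g \<Rightarrow> 'a \<Rightarrow> 'a" and \<delta> :: real
  assumes group: "group G"
    and closed: "\<lbrakk>g \<in> carrier G; y \<in> Y\<rbrakk> \<Longrightarrow> \<alpha> g y \<in> Y"
    and one: "y \<in> Y \<Longrightarrow> \<alpha> \<one> y = y"
    and mult: "\<lbrakk>g \<in> carrier G; h \<in> carrier G; y \<in> Y\<rbrakk> \<Longrightarrow> \<alpha> (g \<otimes> h) y = \<alpha> g (\<alpha> h y)"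
    and isometry: "\<lbrakk>g \<in> carrier G; y \<in> Y; z \<in> Y\<rbrakk> \<Longrightarrow> dist (\<alpha> g y) (\<alpha> g z) = dist y z"
    and \<delta>_pos: "0 < \<delta>"
    and separated: "\<lbrakk>g \<in> carrier G; g \<noteq> \<one>; y \<in> Y\<rbrakk> \<Longrightarrow> \<delta> \<le> dist (\<alpha> g y) y"
begin

interpretation group G by (rule group)

lemma inverse_action: "\<lbrakk>g \<in> carrier G; y \<in> Y\<rbrakk> \<Longrightarrow> \<alpha> g (\<alpha> (inv g) y) = y"
  "\<lbrakk>g \<in> carrier G; y \<in> Y\<rbrakk> \<Longrightarrow> \<alpha> (inv g) (\<alpha> g y) = y"
  using mult[of g "inv g" y] mult[of "inv g" g y] one by auto

lemma separated2:
  assumes g: "g \<in> carrier G" "h \<in> carrier G" "y \<in> Y" "g \<noteq> h"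
  shows "\<delta> \<le> dist (\<alpha> g y) (\<alpha> h y)"
proof -
  have "inv h \<otimes> g \<noteq> \<one>" using g inv_equality by (metis inv_closed inv_inv)
  then have "\<delta> \<le> dist (\<alpha> (inv h \<otimes> g) y) y" using separated g by simp
  also have "\<dots> = dist (\<alpha> h (\<alpha> (inv h) (\<alpha> g y))) (\<alpha> h y)" using isometry g closed mult by simp
  also have "\<dots> = dist (\<alpha> g y) (\<alpha> h y)" using inverse_action(1) g closed by simp
  finally show ?thesis .
qed

definition orbit :: "'a \<Rightarrow> 'a set" where
  "orbit y = (\<lambda>g. \<alpha> g y) ` carrier G"

lemma orbit_ne: "orbit y \<noteq> {}"
  by (auto simp: orbit_def)

lemma infdist_orbit: "g \<in> carrier G \<Longrightarrow> infdist x (orbit z) \<le> dist x (\<alpha> g z)"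
  by (rule infdist_le) (auto simp: orbit_def)

lemma infdist_orbit_less:
  assumes "infdist x (orbit z) < e" shows "\<exists>g\<in>carrier G. dist x (\<alpha> g z) < e"
proof (rule ccontr)
  assume "\<not> ?thesis"
  then have "e \<le> infdist x (orbit z)"
    unfolding infdist_notempty[OF orbit_ne]
      by (intro cINF_greatest[OF orbit_ne]) (auto simp: orbit_def not_less)
  then show False using assms by simp
qed

lemma infdist_orbit_act:
  assumes g: "g \<in> carrier G" and yz: "y \<in> Y" "z \<in> Y"
  shows "infdist (\<alpha> g y) (orbit z) \<le> infdist y (orbit z)"
proof (rule field_le_epsilon)
  fix e :: real assume "0 < e"
  then obtain h where h: "h \<in> carrier G" "dist y (\<alpha> h z) < infdist y (orbit z) + e"
    using infdist_orbit_less[of y z "infdist y (orbit z) + e"] by auto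
  have "infdist (\<alpha> g y) (orbit z) \<le> dist (\<alpha> g y) (\<alpha> (g \<otimes> h) z)" using infdist_orbit g h by blast
  also have "\<dots> = dist y (\<alpha> h z)" using mult g h yz closed isometry by simp
  finally show "infdist (\<alpha> g y) (orbit z) \<le> infdist y (orbit z) + e" using h by simp
qed

text \<open>The point \<open>x\<close> is unrestricted because it will be a member of the dense
  sequence, which may leave \<open>Y\<close>.\<close>

lemma infdist_orbit_triangle:
  assumes yz: "y \<in> Y" "z \<in> Y"
  shows "infdist x (orbit z) \<le> infdist x (orbit y) + infdist y (orbit z)"
proof (rule field_le_epsilon)
  fix e :: real assume "0 < e"
  then obtain h where h: "h \<in> carrier G" "dist x (\<alpha> h y) < infdist x (orbit y) + e"
    using infdist_orbit_less[of x y "infdist x (orbit y) + e"] by auto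
  have "infdist x (orbit z) \<le> infdist (\<alpha> h y) (orbit z) + dist x (\<alpha> h y)" by (rule infdist_triangle)
  then show "infdist x (orbit z) \<le> infdist x (orbit y) + infdist y (orbit z) + e"
    using h infdist_orbit_act[OF h(1) yz] by simp
qed

lemma infdist_orbit_commute:
  assumes yz: "y \<in> Y" "z \<in> Y" shows "infdist y (orbit z) \<le> infdist z (orbit y)"
proof (rule field_le_epsilon)
  fix e :: real assume "0 < e"
  then obtain h where h: "h \<in> carrier G" "dist z (\<alpha> h y) < infdist z (orbit y) + e"
    using infdist_orbit_less[of z y "infdist z (orbit y) + e"] by auto
  have "infdist y (orbit z) \<le> dist y (\<alpha> (inv h) z)" using infdist_orbit h by simp
  also have "\<dots> = dist (\<alpha> h y) (\<alpha> h (\<alpha> (inv h) z))" using isometry h closed yz by simp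
  also have "\<dots> = dist z (\<alpha> h y)" using inverse_action h yz by (simp add: dist_commute)
  finally show "infdist y (orbit z) \<le> infdist z (orbit y) + e" using h by simp
qed

text \<open>
  The Kuratowski embedding of the orbit space, a point being sent to the distances of its orbit
  to the points of a dense sequence \<open>d\<close>.
\<close>

definition orbit_map :: "(nat \<Rightarrow> 'a) \<Rightarrow> 'a \<Rightarrow> linfty" where
  "orbit_map d y = Bcontfun (\<lambda>n. min 1 (infdist (d n) (orbit y)))"

lemma apply_orbit_map: "apply_bcontfun (orbit_map d y) n = min 1 (infdist (d n) (orbit y))"
proof -
  have "(\<lambda>n. min 1 (infdist (d n) (orbit y))) \<in> bcontfun"
    by (rule bcontfun_normI[of _ 1]) (auto simp: infdist_nonneg)
  then show ?thesis by (simp add: orbit_map_def Bcontfun_inverse)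
qed

text \<open>The triangle inequality bounds the difference of every entry, and an entry for a point
  \<open>d n\<close> close to \<open>y\<close> comes arbitrarily near the bound. Cutting off at
  \<open>1\<close> keeps the sequences bounded and leaves short distances intact.\<close>

lemma dist_orbit_map:
  assumes yz: "y \<in> Y" "z \<in> Y" and dense: "\<And>e. 0 < e \<Longrightarrow> \<exists>n. dist (d n) y < e"
  shows "dist (orbit_map d y) (orbit_map d z) = min 1 (infdist y (orbit z))"
proof (rule antisym)
  show "dist (orbit_map d y) (orbit_map d z) \<le> min 1 (infdist y (orbit z))"
  proof (rule dist_bound)
    fix n
    show "dist (apply_bcontfun (orbit_map d y) n) (apply_bcontfun (orbit_map d z) n) \<le> min 1
      (infdist y (orbit z))"
      using infdist_orbit_triangle[OF yz, of "d n"] infdist_orbit_triangle[OF yz(2,1), of "d n"]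
        infdist_orbit_commute[OF yz] infdist_orbit_commute[OF yz(2,1)]
        infdist_nonneg[of "d n" "orbit y"] infdist_nonneg[of "d n" "orbit z"]
      by (simp add: apply_orbit_map dist_real_def min_def abs_if)
  qed
  show "min 1 (infdist y (orbit z)) \<le> dist (orbit_map d y) (orbit_map d z)"
  proof (rule field_le_epsilon)
    fix e :: real assume e: "0 < e"
    \<comment> \<open>Here \<open>a\<close> and \<open>b\<close> will be the distances of
      \<open>d n\<close> from the orbits of \<open>y\<close> and \<open>z\<close>, \<open>c\<close>
      that of \<open>y\<close> from the orbit of \<open>z\<close>, and \<open>t\<close> the error of
      approximating \<open>y\<close> by \<open>d n\<close>.\<close>
    have aux: "a \<le> t \<Longrightarrow> c \<le> b + t \<Longrightarrow> t < e / 2 \<Longrightarrow> 0 \<le> t \<Longrightarrow> min 1 c \<le> \<bar>min 1 a - min 1 b\<bar> + e"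
      for a b c t :: real
      by (auto simp: min_def abs_if)
    from e obtain n where n: "dist (d n) y < e / 2" using dense[of "e / 2"] by auto
    have "infdist (d n) (orbit y) \<le> dist (d n) y" using infdist_orbit[of \<one> "d n" y] one yz by simp
    moreover have "infdist y (orbit z) \<le> infdist (d n) (orbit z) + dist y (d n)"
      by (rule infdist_triangle)
    ultimately have "min 1 (infdist y (orbit z)) \<le> dist (apply_bcontfun (orbit_map d y) n)
      (apply_bcontfun (orbit_map d z) n) + e"
      using aux[of "infdist (d n) (orbit y)" "dist (d n) y" "infdist y (orbit z)"
        "infdist (d n) (orbit z)"] n
      unfolding apply_orbit_map dist_real_def by (simp add: dist_commute)
    also have "\<dots> \<le> dist (orbit_map d y) (orbit_map d z) + e" using dist_bounded by simp
    finally show "min 1 (infdist y (orbit z)) \<le> dist (orbit_map d y) (orbit_map d z) + e" .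
  qed
qed

context
  fixes d :: "nat \<Rightarrow> 'a"
  assumes dense: "\<And>y e. y \<in> Y \<Longrightarrow> 0 < e \<Longrightarrow> \<exists>n. dist (d n) y < e"
begin

lemma orbit_map_le: "\<lbrakk>y \<in> Y; z \<in> Y; g \<in> carrier G\<rbrakk>
  \<Longrightarrow> dist (orbit_map d y) (orbit_map d z) \<le> dist y (\<alpha> g z)"
  using dist_orbit_map[of y z d] dense infdist_orbit[of g y z] by simp

lemma orbit_map_less:
  assumes "y \<in> Y" "z \<in> Y" "dist (orbit_map d y) (orbit_map d z) < e" "e \<le> 1"
  shows "\<exists>g\<in>carrier G. dist y (\<alpha> g z) < e"
proof (rule infdist_orbit_less)
  show "infdist y (orbit z) < e"
    using dist_orbit_map[of y z d] dense assms by (simp add: min_def split: if_splits)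
qed

lemma orbit_map_act: "\<lbrakk>y \<in> Y; g \<in> carrier G\<rbrakk> \<Longrightarrow> orbit_map d (\<alpha> g y) = orbit_map d y"
  using orbit_map_le[of "\<alpha> g y" y g] closed by simp

text \<open>A strictly smaller image distance would mean that some \<open>g\<close> other than the
  identity brings \<open>z\<close> closer to \<open>y\<close> than it was; then \<open>z\<close> and
  its translate are less than \<open>\<delta>\<close> apart, against
  \<open>separated\<close>.\<close>

lemma orbit_map_local_isometry:
  assumes yz: "y \<in> Y" "z \<in> Y" "dist y z < min \<delta> 1 / 2"
  shows "dist (orbit_map d y) (orbit_map d z) = dist y z"
proof (rule ccontr)
  assume "dist (orbit_map d y) (orbit_map d z) \<noteq> dist y z"
  moreover have "dist (orbit_map d y) (orbit_map d z) \<le> dist y z"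
    using orbit_map_le[OF yz(1,2) one_closed] one yz by simp
  ultimately have "dist (orbit_map d y) (orbit_map d z) < dist y z" by simp
  moreover have "dist y z \<le> 1" using yz(3) by linarith
  ultimately obtain g where g: "g \<in> carrier G" "dist y (\<alpha> g z) < dist y z"
    using orbit_map_less[of y z "dist y z"] yz by auto
  then have "g \<noteq> \<one>" using one yz by auto
  then have "\<delta> \<le> dist (\<alpha> g z) z" using separated g(1) yz(2) by blast
  also have "\<dots> \<le> dist y (\<alpha> g z) + dist y z" by (metis dist_commute dist_triangle)
  finally show False using g yz(3) by (auto simp: min_def split: if_splits)
qed

text \<open>Equal images only say that the infimum of distances to the orbit is zero. Once a
  translate of \<open>z\<close> is within the range of the local isometry, its distance from
  \<open>y\<close> equals that of the images, so it is zero.\<close>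

lemma orbit_map_eqD:
  assumes yz: "y \<in> Y" "z \<in> Y" "orbit_map d y = orbit_map d z"
  shows "\<exists>g\<in>carrier G. y = \<alpha> g z"
proof -
  define e where "e = min \<delta> 1 / 2"
  have "0 < e" "e \<le> 1" using \<delta>_pos by (auto simp: e_def)
  then obtain g where g: "g \<in> carrier G" "dist y (\<alpha> g z) < e"
    using orbit_map_less[of y z e] yz by auto
  then have "dist y (\<alpha> g z) = dist (orbit_map d y) (orbit_map d (\<alpha> g z))"
    using orbit_map_local_isometry[OF yz(1) closed[OF g(1) yz(2)]] g(2) unfolding e_def by simp
  then have "y = \<alpha> g z" using orbit_map_act yz g by simp
  then show ?thesis using g by blast
qed

lemma continuous_orbit_map: "continuous_on Y (orbit_map d)"
  unfolding continuous_on_iff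
proof (intro ballI allI impI)
  fix y e assume y: "y \<in> Y" and e: "(0::real) < e"
  have "dist (orbit_map d z) (orbit_map d y) \<le> dist z y" if "z \<in> Y" for z
    using orbit_map_le[OF that y one_closed] one y by simp
  then show "\<exists>r>0. \<forall>z\<in>Y. dist z y < r \<longrightarrow> dist (orbit_map d z) (orbit_map d y) < e"
    using e by (intro exI[of _ e]) (auto intro: le_less_trans)
qed

theorem covering_orbit_map: "covering_space Y (orbit_map d) (orbit_map d ` Y)"
proof
  let ?p = "orbit_map d"
  show "continuous_on Y ?p" by (rule continuous_orbit_map)
  fix x assume "x \<in> ?p ` Y"
  then obtain y where y: "y \<in> Y" "x = ?p y" by blast
  \<comment> \<open>With this radius the centres of two balls are at least \<open>4 * r\<close>
    apart, so the balls are disjoint, and two points of one ball are less than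
    \<open>2 * r = min \<delta> 1 / 2\<close> apart, where the map is isometric.\<close>
  define r where "r = min \<delta> 1 / 4"
  have r: "0 < r" "4 * r \<le> \<delta>" "r \<le> 1" "4 * r \<le> 1" using \<delta>_pos by (auto simp: r_def)
  let ?T = "?p ` Y \<inter> ball x r"
  let ?v = "(\<lambda>g. Y \<inter> ball (\<alpha> g y) r) ` carrier G"
  have T: "x \<in> ?T" using y r by simp
  have "\<Union>?v = Y \<inter> ?p -` ?T"
  proof (intro equalityI subsetI)
    fix z assume "z \<in> \<Union>?v"
    then obtain g where g: "g \<in> carrier G" "z \<in> Y" "dist (\<alpha> g y) z < r" by auto
    then have "dist (?p z) (?p y) < r" using orbit_map_le[of z y g] y by (simp add: dist_commute)
    then show "z \<in> Y \<inter> ?p -` ?T" using g y by (simp add: dist_commute)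
  next
    fix z assume z: "z \<in> Y \<inter> ?p -` ?T"
    then have "dist (?p z) (?p y) < r" using y by (simp add: dist_commute)
    then obtain g where "g \<in> carrier G" "dist z (\<alpha> g y) < r" using orbit_map_less z y r by blast
    then show "z \<in> \<Union>?v" using z by (auto simp: dist_commute)
  qed
  moreover have "openin (top_of_set Y) u" if "u \<in> ?v" for u
    using that by (auto intro: openin_open_Int)
  moreover have "pairwise disjnt ?v"
  proof (rule pairwiseI)
    fix u u' assume u: "u \<in> ?v" "u' \<in> ?v" "u \<noteq> u'"
    then obtain g h where gh: "g \<in> carrier G" "h \<in> carrier G" "u = Y \<inter> ball (\<alpha> g y) r"
      "u' = Y \<inter> ball (\<alpha> h y) r" by auto
    then have sep: "\<delta> \<le> dist (\<alpha> g y) (\<alpha> h y)" using u separated2 y by metis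
    show "disjnt u u'"
    proof (rule ccontr)
      assume "\<not> disjnt u u'"
      then obtain z where "dist (\<alpha> g y) z < r" "dist (\<alpha> h y) z < r" unfolding gh disjnt_def by auto
      then have "dist (\<alpha> g y) (\<alpha> h y) < 2 * r" by (metis dist_triangle_less_add mult_2 dist_commute)
      then show False using sep r by simp
    qed
  qed
  moreover have "\<exists>q. homeomorphism u ?T ?p q" if u: "u \<in> ?v" for u
  proof -
    obtain g where g: "g \<in> carrier G" "u = Y \<inter> ball (\<alpha> g y) r" using u by auto
    have iso: "dist (?p z) (?p w) = dist z w" if zw: "z \<in> u" "w \<in> u" for z w
    proof (rule orbit_map_local_isometry)
      have "dist (\<alpha> g y) z < r" "dist (\<alpha> g y) w < r" using zw g by auto
      then have "dist z w < 2 * r" by (metis dist_triangle_less_add mult_2 dist_commute)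
      then show "dist z w < min \<delta> 1 / 2" by (simp add: r_def)
    qed (use zw g in auto)
    have inj: "inj_on ?p u" by (rule inj_onI) (metis iso dist_eq_0_iff)
    have img: "?p ` u = ?T"
    proof (intro equalityI subsetI)
      fix t assume "t \<in> ?p ` u"
      then obtain z where z: "z \<in> Y" "dist (\<alpha> g y) z < r" "t = ?p z" using g by auto
      then have "dist (?p z) (?p y) < r"
        using orbit_map_le[of z y g] y g by (simp add: dist_commute)
      then show "t \<in> ?T" using z y by (simp add: dist_commute)
    next
      fix t assume t: "t \<in> ?T"
      then obtain z where z: "z \<in> Y" "t = ?p z" by blast
      then have "dist (?p y) (?p z) < r" using t y by simp
      then obtain h where h: "h \<in> carrier G" "dist y (\<alpha> h z) < r"
        using orbit_map_less z y r by blast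
      then have "dist (\<alpha> g y) (\<alpha> g (\<alpha> h z)) < r" using isometry g y closed z by simp
      then have "\<alpha> g (\<alpha> h z) \<in> u" using g h z closed by simp
      moreover have "?p (\<alpha> g (\<alpha> h z)) = t" using orbit_map_act closed g h z by simp
      ultimately show "t \<in> ?p ` u" by blast
    qed
    have "homeomorphism u (?p ` u) ?p (inv_into u ?p)"
    proof
      show "continuous_on u ?p" using continuous_orbit_map g continuous_on_subset by blast
      show "continuous_on (?p ` u) (inv_into u ?p)"
        unfolding continuous_on_iff
      proof (intro ballI allI impI)
        fix t e assume t: "t \<in> ?p ` u" and e: "(0::real) < e"
        have "dist (inv_into u ?p s) (inv_into u ?p t) = dist s t" if "s \<in> ?p ` u" for s
          using iso[of "inv_into u ?p s" "inv_into u ?p t"] that t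
            by (simp add: inv_into_into f_inv_into_f)
        then show "\<exists>a>0. \<forall>s\<in>?p ` u. dist s t < a \<longrightarrow> dist (inv_into u ?p s) (inv_into u ?p t) < e"
          using e by (intro exI[of _ e]) simp
      qed
    qed (use inj in auto)
    then show ?thesis unfolding img by blast
  qed
  moreover have "openin (top_of_set (?p ` Y)) ?T" by (intro openin_open_Int open_ball)
  ultimately show "\<exists>T. x \<in> T \<and> openin (top_of_set (?p ` Y)) T \<and>
      (\<exists>v. \<Union>v = Y \<inter> ?p -` T \<and> (\<forall>u\<in>v. openin (top_of_set Y) u) \<and> pairwise disjnt v
        \<and> (\<forall>u\<in>v. \<exists>q. homeomorphism u T ?p q))"
    using T by (intro exI[of _ ?T] conjI exI[of _ ?v]) blast+
qed simp

end

end

section \<open>The universal covering\<close>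

lemma norm_point_le:
  fixes s :: "'v::countable set"
  assumes "finite s" "\<And>v. v \<in> s \<Longrightarrow> \<bar>c v\<bar> \<le> b" "0 \<le> b"
  shows "norm (\<Sum>v\<in>s. c v *\<^sub>R vert v) \<le> b"
proof (rule norm_bound)
  fix n
  have "apply_bcontfun (\<Sum>v\<in>s. c v *\<^sub>R vert v) n = (\<Sum>v\<in>s. if n = to_nat v then c v else 0)"
    using assms(1) by (simp add: apply_sum apply_vert if_distrib cong: if_cong)
  also have "\<bar>\<dots>\<bar> \<le> b"
  proof (cases "\<exists>v\<in>s. n = to_nat v")
    case True
    then obtain v where v: "v \<in> s" "n = to_nat v" by blast
    then have "(\<Sum>w\<in>s. if n = to_nat w then c w else 0) = (\<Sum>w\<in>s. if w = v then c w else 0)"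
      by (intro sum.cong) auto
    then show ?thesis using assms v by (simp add: sum.delta')
  next
    case False
    then have "(\<Sum>w\<in>s. if n = to_nat w then c w else 0) = 0" by (intro sum.neutral) auto
    then show ?thesis using assms(3) by simp
  qed
  finally show "norm (apply_bcontfun (\<Sum>v\<in>s. c v *\<^sub>R vert v) n) \<le> b" by simp
qed

lemma simplex_hull_expand:
  fixes s S :: "'v::countable set"
  assumes "f \<in> simplex_hull s" "s \<subseteq> S" "finite S"
  shows "f = (\<Sum>v\<in>S. coord f v *\<^sub>R vert v)"
proof -
  have fin: "finite s" using assms finite_subset by blast
  have "(\<Sum>v\<in>s. coord f v *\<^sub>R vert v) = (\<Sum>v\<in>S. coord f v *\<^sub>R vert v)"
    by (rule sum.mono_neutral_left[OF assms(3,2)])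
      (use simplex_hull_coord(4)[OF assms(1) fin] in \<open>auto simp: support_def\<close>)
  then show ?thesis by (rule trans[OF simplex_hull_coord(1)[OF assms(1) fin]])
qed

lemma dist_hull_le:
  fixes s s' :: "'v::countable set"
  assumes f: "f \<in> simplex_hull s" "g \<in> simplex_hull s'" and fin: "finite s" "finite s'"
    and b: "\<And>v::'v. \<bar>coord f v - coord g v\<bar> \<le> b"
  shows "dist f g \<le> b"
proof -
  have "0 \<le> b" using order_trans[OF abs_ge_zero b] .
  have "f - g = (\<Sum>v\<in>s \<union> s'. coord f v *\<^sub>R vert v) - (\<Sum>v\<in>s \<union> s'. coord g v *\<^sub>R vert v)"
    using simplex_hull_expand[OF f(1), of "s \<union> s'"] simplex_hull_expand[OF f(2), of "s \<union> s'"] fin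
      by simp
  also have "\<dots> = (\<Sum>v\<in>s \<union> s'. (coord f v - coord g v) *\<^sub>R vert v)"
    by (simp add: sum_subtractf scaleR_diff_left)
  finally show ?thesis
    unfolding dist_norm using norm_point_le[of "s \<union> s'" "\<lambda>v. coord f v - coord g v" b] fin b \<open>0 \<le> b\<close>
      by simp
qed

text \<open>All finite rational combinations of vertices, enumerated through the countability of
  lists. They serve as the dense sequence of the embedding, although many of them lie outside the
  complex.\<close>

definition rational_point :: "nat \<Rightarrow> linfty" where
  "rational_point n = (\<Sum>(q, v)\<leftarrow>(from_nat n :: (rat \<times> F2_cubed) list). of_rat q *\<^sub>R vert v)"

lemma rational_point_dense:
  fixes s :: "F2_cubed set"
  assumes f: "f \<in> simplex_hull s" "finite s" and e: "0 < e"
  shows "\<exists>n. dist (rational_point n) f < e"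
proof -
  have "\<exists>q. \<bar>of_rat q - coord f v\<bar> < e / 2" for v :: F2_cubed
  proof -
    obtain r where r: "r \<in> \<rat>" "coord f v - e / 2 < r" "r < coord f v + e / 2"
      using Rats_dense_in_real[of "coord f v - e / 2" "coord f v + e / 2"] e by auto
    obtain q where "r = of_rat q" using r(1) by (rule Rats_cases)
    then show ?thesis using r by (intro exI[of _ q]) linarith
  qed
  then obtain q where q: "\<And>v::F2_cubed. \<bar>of_rat (q v) - coord f v\<bar> < e / 2" by metis
  obtain vs where vs: "distinct vs" "set vs = s" using finite_distinct_list f(2) by metis
  define n where "n = to_nat (map (\<lambda>v. (q v, v)) vs)"
  have "rational_point n = (\<Sum>v\<in>s. of_rat (q v) *\<^sub>R vert v)"
    unfolding rational_point_def n_def using vs by (simp add: o_def sum_list_distinct_conv_sum_set)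
  then have "rational_point n - f = (\<Sum>v\<in>s. of_rat (q v) *\<^sub>R vert v) - (\<Sum>v\<in>s. coord f v *\<^sub>R vert v)"
    using simplex_hull_coord(1)[OF f] by simp
  also have "\<dots> = (\<Sum>v\<in>s. (of_rat (q v) - coord f v) *\<^sub>R vert v)"
    by (simp add: sum_subtractf scaleR_diff_left)
  also have "norm \<dots> \<le> e / 2"
    using e q by (intro norm_point_le f(2)) (auto intro: less_imp_le)
  finally have "dist (rational_point n) f \<le> e / 2" by (simp add: dist_norm)
  then show ?thesis using e by (intro exI[of _ n]) simp
qed

section \<open>The level complex and the translations acting on it\<close>

interpretation level: simplicial_complex is_simplex
  by unfold_locales (auto intro: card_simplex simplex_subset)

definition level_complex :: "linfty set" where
  "level_complex = level.body level_set"

text \<open>The affine extension of the action on vertices, written as a sum over the support, which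
  is finite for points of the complex.\<close>

definition translate :: "F2_cubed \<Rightarrow> linfty \<Rightarrow> linfty" where
  "translate g f = (\<Sum>v\<in>support f. coord f v *\<^sub>R vert (act g v))"

lemma support_level:
  assumes "f \<in> level_complex"
  shows "is_simplex (support f)" "support f \<subseteq> level_set" "finite (support f :: F2_cubed set)"
    "f \<in> simplex_hull (support f :: F2_cubed set)" "0 \<le> coord f (v :: F2_cubed)"
  using level.body_support[of f level_set] assms by (auto simp: level_complex_def)

lemma level_complex_ext:
  assumes "f \<in> level_complex" "f' \<in> level_complex" "\<And>v::F2_cubed. coord f v = coord f' v"
  shows "f = f'"
  by (rule simplex_hull_ext[OF support_level(4,3)[OF assms(1)] support_level(4,3)[OF assms(2)]
    assms(3)])

lemma act_inj: "g \<in> level_set \<Longrightarrow> inj_on (act g) level_set"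
  by (rule inj_onI) simp

lemma act_inverse:
  "g \<in> level_set \<Longrightarrow> v \<in> level_set \<Longrightarrow> act g (act (act_inv g) v) = v"
  "g \<in> level_set \<Longrightarrow> v \<in> level_set \<Longrightarrow> act (act_inv g) (act g v) = v"
  by (simp_all add: stallings.m_assoc[symmetric])

lemma translate_eq:
  assumes f: "f \<in> level_complex" and g: "g \<in> level_set"
  shows "translate g f = (\<Sum>w\<in>act g ` support f. coord f (act (act_inv g) w) *\<^sub>R vert w)"
proof -
  have "inj_on (act g) (support f)"
    using act_inj[OF g] support_level(2)[OF f] inj_on_subset by blast
  moreover have "act (act_inv g) (act g v) = v" if "v \<in> support f" for v
    using act_inverse(2)[OF g, of v] support_level(2)[OF f] that by blast
  ultimately show ?thesis
    unfolding translate_def by (simp add: sum.reindex)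
qed

lemma coord_translate:
  assumes f: "f \<in> level_complex" and g: "g \<in> level_set"
  shows "coord (translate g f) w = (if w \<in> level_set then coord f (act (act_inv g) w) else 0)"
proof -
  have "coord (translate g f) w = (if w \<in> act g ` support f then coord f (act (act_inv g) w) else
    0)"
    unfolding translate_eq[OF assms] by (rule coord_point) (simp add: support_level(3)[OF f])
  moreover have "w \<in> level_set" if "w \<in> act g ` support f"
    using that support_level(2)[OF f] g by auto
  moreover have "coord f (act (act_inv g) w) = 0" if w: "w \<in> level_set" "w \<notin> act g ` support f"
  proof -
    have "act (act_inv g) w \<notin> support f" using w act_inverse(1)[OF g w(1)] by (metis imageI)
    then show ?thesis by (simp add: support_def)
  qed
  ultimately show ?thesis by auto
qed

lemma translate_hull:
  assumes f: "f \<in> level_complex" and g: "g \<in> level_set"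
  shows "translate g f \<in> simplex_hull (act g ` support f)"
  unfolding translate_eq[OF assms]
proof (rule simplex_hullI)
  have inj: "inj_on (act g) (support f)"
    using act_inj[OF g] support_level(2)[OF f] inj_on_subset by blast
  show "finite (act g ` support f)" using support_level(3)[OF f] by simp
  have "(\<Sum>w\<in>act g ` support f. coord f (act (act_inv g) w))
    = (\<Sum>v\<in>support f. coord f (v :: F2_cubed))"
  proof -
    have "act (act_inv g) (act g v) = v" if "v \<in> support f" for v
      using act_inverse(2)[OF g, of v] support_level(2)[OF f] that by blast
    then show ?thesis by (simp add: sum.reindex[OF inj])
  qed
  then show "(\<Sum>w\<in>act g ` support f. coord f (act (act_inv g) w)) = 1"
    using simplex_hull_coord(3)[OF support_level(4,3)[OF f]] by simp
qed (use support_level(5)[OF f] in auto)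

lemma translate_in:
  assumes f: "f \<in> level_complex" and g: "g \<in> level_set" shows "translate g f \<in> level_complex"
proof -
  have s: "is_simplex (act g ` support f)" by (rule simplex_act[OF support_level(1)[OF f] g])
  then have "act g ` support f \<subseteq> level_set" by (auto elim: simplexE)
  then show ?thesis
    unfolding level_complex_def using level.bodyI[OF s] translate_hull[OF f g] by blast
qed

lemma support_translate:
  assumes f: "f \<in> level_complex" and g: "g \<in> level_set" shows "support (translate g f)
    = act g ` support f"
proof -
  have "w \<in> act g ` support f" if w: "w \<in> level_set" "act (act_inv g) w \<in> support f" for w
    using act_inverse(1)[OF g w(1)] w(2) by (metis imageI)
  moreover have "act g v \<in> level_set" "act (act_inv g) (act g v) = v" if "v \<in> support f" for v
    using act_inverse(2)[OF g, of v] support_level(2)[OF f] that stallings.m_closed[OF g] by blast+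
  ultimately show ?thesis
    by (auto simp: support_def coord_translate[OF f g] split: if_splits)
qed

lemma coord_outside: "f \<in> level_complex \<Longrightarrow> v \<notin> level_set \<Longrightarrow> coord f v = 0"
  using support_level(2) by (auto simp: support_def)

lemma translate_one: "f \<in> level_complex \<Longrightarrow> translate origin f = f"
  by (rule level_complex_ext) (auto simp: translate_in coord_translate coord_outside)

lemma translate_mult:
  assumes "g \<in> level_set" "h \<in> level_set" and f: "f \<in> level_complex"
  shows "translate (act g h) f = translate g (translate h f)"
  by (rule level_complex_ext)
    (use assms in \<open>auto simp: translate_in coord_translate stallings.inv_mult_group
      stallings.m_assoc\<close>)

lemma dist_translate_le:
  assumes "g \<in> level_set" "f \<in> level_complex" "f' \<in> level_complex"
  shows "dist (translate g f) (translate g f') \<le> dist f f'"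
proof (rule dist_hull_le[OF translate_hull[OF assms(2,1)] translate_hull[OF assms(3,1)]])
  show "\<bar>coord (translate g f) v - coord (translate g f') v\<bar> \<le> dist f f'" for v :: F2_cubed
    using assms abs_coord_diff[of f "act (act_inv g) v" f'] by (simp add: coord_translate)
qed (use assms support_level(3) in auto)

text \<open>
  Some barycentric coordinate of \<open>f\<close> is at least \<open>1/3\<close>.  If \<open>g\<close> moved \<open>f\<close> by less than \<open>1/6\<close>, then
  the vertices \<open>v\<close>, \<open>g\<^sup>-\<^sup>1v\<close> and \<open>g\<^sup>-\<^sup>1g\<^sup>-\<^sup>1v\<close> would all carry \<open>f\<close>, against \<open>act_free\<close>.
\<close>

lemma translate_separated:
  assumes g: "g \<in> level_set" "g \<noteq> origin" and f: "f \<in> level_complex"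
  shows "1 / 6 \<le> dist (translate g f) f"
proof (rule ccontr)
  assume close: "\<not> ?thesis"
  let ?s = "support f :: F2_cubed set" and ?h = "act_inv g"
  note supp = support_level[OF f]
  have h: "?h \<in> level_set" "?h \<noteq> origin" using g by auto
  have "\<exists>v\<in>?s. 1 / 3 \<le> coord f v"
  proof (rule ccontr)
    assume "\<not> ?thesis"
    then have small: "coord f v < 1 / 3" if "v \<in> ?s" for v using that by force
    have ne: "?s \<noteq> {}" using supp(1) by (auto elim: simplexE)
    have "(\<Sum>v\<in>?s. coord f v) < (\<Sum>v\<in>?s. 1 / 3)"
      by (rule sum_strict_mono[OF supp(3) ne small])
    also have "\<dots> \<le> 1" using card_simplex(2)[OF supp(1)] by auto
    finally show False using simplex_hull_coord(3)[OF supp(4,3)] by simp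
  qed
  then obtain v where v: "v \<in> ?s" "1 / 3 \<le> coord f v" by blast
  have vl: "v \<in> level_set" using v supp(2) by blast
  have step: "coord f (act ?h w) > coord f w - 1 / 6" if "w \<in> level_set" for w
  proof -
    have "\<bar>coord (translate g f) w - coord f w\<bar> < 1 / 6"
      using abs_coord_diff[of "translate g f" w f] close by linarith
    then have "\<bar>coord f (act ?h w) - coord f w\<bar> < 1 / 6"
      using that by (simp add: coord_translate[OF f g(1)])
    then show ?thesis by linarith
  qed
  have 1: "1 / 6 < coord f (act ?h v)" using step[OF vl] v(2) by simp
  have "act ?h v \<in> level_set" using h vl by simp
  from step[OF this] 1 have 2: "0 < coord f (act ?h (act ?h v))" by simp
  have "?h = origin"
    by (rule act_free[OF supp(1) v(1) _ _ h(1)]) (use 1 2 in \<open>auto simp: support_def\<close>)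
  then show False using h by simp
qed

interpretation action: isometric_action stallings_group level_complex translate "1 / 6"
proof
  show "dist (translate g y) (translate g z) = dist y z"
    if "g \<in> level_set" "y \<in> level_complex" "z \<in> level_complex" for g y z
  proof (rule antisym)
    show "dist (translate g y) (translate g z) \<le> dist y z"
      by (rule dist_translate_le) (use that in auto)
    have "dist (translate (act_inv g) (translate g y)) (translate (act_inv g) (translate g z))
        \<le> dist (translate g y) (translate g z)"
      by (rule dist_translate_le) (use that translate_in in auto)
    then show "dist y z \<le> dist (translate g y) (translate g z)"
      using that by (simp add: translate_mult[symmetric] translate_one)
  qed
qed (use group_stallings translate_in translate_one translate_mult translate_separated in auto)

abbreviation quotient_map :: "linfty \<Rightarrow> linfty" where
  "quotient_map \<equiv> action.orbit_map rational_point"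

definition presentation_complex :: "linfty set" where
  "presentation_complex = quotient_map ` level_complex"

lemma rational_point_dense_level: "y \<in> level_complex \<Longrightarrow> 0 < e \<Longrightarrow> \<exists>n. dist (rational_point n) y < e"
  using rational_point_dense[OF support_level(4,3)] by blast

lemma quotient_map_translate:
  "y \<in> level_complex \<Longrightarrow> g \<in> level_set \<Longrightarrow> quotient_map (translate g y) = quotient_map y"
  by (rule action.orbit_map_act[OF rational_point_dense_level])

lemma quotient_map_eqD:
  "y \<in> level_complex \<Longrightarrow> z \<in> level_complex \<Longrightarrow> quotient_map y = quotient_map z
    \<Longrightarrow> \<exists>g\<in>level_set. y = translate g z"
  by (rule action.orbit_map_eqD[OF rational_point_dense_level])

lemma continuous_quotient_map: "continuous_on level_complex quotient_map"
  by (rule action.continuous_orbit_map[OF rational_point_dense_level])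

lemma covering_quotient_map: "covering_space level_complex quotient_map presentation_complex"
  unfolding presentation_complex_def
    by (rule action.covering_orbit_map[OF rational_point_dense_level])

lemma path_connected_level_complex: "path_connected level_complex"
  unfolding level_complex_def
  by (rule level.path_connected_body) (use conn_level_region[of "[]" "[]"
    "[]"] in \<open>simp add: level_region_Nil\<close>)

lemma simply_connected_level_complex: "simply_connected level_complex"
  unfolding simply_connected_eq_contractible_path
proof (intro conjI allI impI)
  fix p :: "real \<Rightarrow> linfty" assume p: "path p \<and> path_image p \<subseteq> level_complex
    \<and> pathfinish p = pathstart p"
  show "homotopic_paths level_complex p (linepath (pathstart p) (pathstart p))"
    unfolding level_complex_def
  proof (rule level.body_loop_nullhomotopic[OF order_refl])
    fix F :: "F2_cubed \<Rightarrow> (real \<Rightarrow> linfty) set set" and t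
    assume "local_system is_simplex level_set F t"
    then interpret level_local_system level_set F t by unfold_locales (auto simp: local_system_def)
    show "good level_set"
      using good_level_region[of "[]" "[]" "[]"] by (simp add: level_region_Nil Nil_in_words)
  qed (use p in \<open>auto simp: level_complex_def\<close>)
qed (rule path_connected_level_complex)

lemma far_loop_nullhomotopic:
  assumes "path p" "path_image p \<subseteq> level.body (far (Suc n))" "pathfinish p = pathstart p"
  shows "homotopic_paths (level.body (far n)) p (linepath (pathstart p) (pathstart p))"
proof (rule level.body_loop_nullhomotopic[OF _ _ assms])
  show "far (Suc n) \<subseteq> far n" by (auto simp: far_def)
  fix F :: "F2_cubed \<Rightarrow> (real \<Rightarrow> linfty) set set" and t
  assume "local_system is_simplex (far n) F t"
  then interpret level_local_system "far n" F t by unfold_locales (auto simp: local_system_def)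
  show "good (far (Suc n))" by (rule good_far) simp
qed

lemma vert_level: "v \<in> level_set \<Longrightarrow> vert v \<in> level_complex"
  unfolding level_complex_def by (rule level.vert_body[OF simplex_singleton]) auto

lemma support_vert: "support (vert v) = {v}"
  by (auto simp: support_def coord_vert)

lemma translate_vert: "translate g (vert v) = vert (act g v)"
  by (simp add: translate_def support_vert coord_vert)

section \<open>The fundamental group\<close>

lemma fundamental_group_mult:
  assumes "p \<in> loops_at X a" "q \<in> loops_at X a"
  shows "homotopy_class X p \<otimes>\<^bsub>fundamental_group X a\<^esub> homotopy_class X q
    = homotopy_class X (p +++ q)"
proof -
  let ?P = "homotopy_class X p" and ?Q = "homotopy_class X q"
  have "homotopy_class X (p' +++ q') = homotopy_class X (p +++ q)" if "p' \<in> ?P" "q' \<in> ?Q" for p' q'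
    using that assms
    by (intro homotopy_class_eq[symmetric] homotopic_paths_join) (auto simp: homotopy_class_def
      loops_at_def)
  then have "(\<Union>\<gamma>\<in>?P. \<Union>\<delta>\<in>?Q. homotopy_class X (\<gamma> +++ \<delta>))
    = (\<Union>\<gamma>\<in>?P. \<Union>\<delta>\<in>?Q. homotopy_class X (p +++ q))"
    by (intro SUP_cong refl)
  moreover have "p \<in> ?P" "q \<in> ?Q"
    using assms by (auto simp: homotopy_class_def loops_at_def)
  then have "?P \<noteq> {}" "?Q \<noteq> {}" by blast+
  ultimately show ?thesis by (simp add: fundamental_group_def)
qed

definition basepoint :: linfty where
  "basepoint = vert (([], [], []) :: F2_cubed)"

lemma basepoint_in: "basepoint \<in> level_complex"
  unfolding basepoint_def by (rule vert_level) (simp add: level_set_iff Nil_in_words)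

lemma translate_basepoint: "g \<in> level_set \<Longrightarrow> translate g basepoint = vert g"
  unfolding basepoint_def one_stallings[symmetric] translate_vert by simp

lemma quotient_map_vert: "g \<in> level_set \<Longrightarrow> quotient_map (vert g) = quotient_map basepoint"
  using quotient_map_translate[OF basepoint_in] translate_basepoint by metis

text \<open>An element \<open>g\<close> corresponds to the image of a path from the basepoint to
  \<open>vert g\<close>, unique up to homotopy by simple connectivity. Injectivity is monodromy of
  the covering, surjectivity is path lifting.\<close>

theorem fundamental_group_presentation_complex:
  "fundamental_group presentation_complex (quotient_map basepoint) \<cong> stallings_group"
proof -
  let ?Y = level_complex and ?A = presentation_complex and ?q = quotient_map
    and ?a = "quotient_map basepoint"
  let ?\<pi> = "fundamental_group presentation_complex (quotient_map basepoint)"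
  have qY: "?q ` ?Y = ?A" by (simp add: presentation_complex_def)
  have cont: "continuous_on ?Y ?q" by (rule continuous_quotient_map)
  have "\<exists>p. path p \<and> path_image p \<subseteq> ?Y \<and> pathstart p = basepoint \<and> pathfinish p = vert g"
    if "g \<in> level_set" for g
    using path_connected_level_complex basepoint_in vert_level[OF that] unfolding path_connected_def
      by blast
  then obtain \<gamma> where \<gamma>: "path (\<gamma> g)" "path_image (\<gamma> g) \<subseteq> ?Y" "pathstart (\<gamma> g) = basepoint"
    "pathfinish (\<gamma> g) = vert g"
    if "g \<in> level_set" for g by metis
  have sc: "homotopic_paths ?Y p r"
    if "path p" "path_image p \<subseteq> ?Y" "path r" "path_image r \<subseteq> ?Y" "pathstart r = pathstart p"
      "pathfinish r = pathfinish p" for p r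
    using simply_connected_level_complex that unfolding simply_connected_eq_homotopic_paths by blast
  have push: "homotopic_paths ?A (?q \<circ> p) (?q \<circ> r)" if "homotopic_paths ?Y p r" for p r
    by (rule homotopic_paths_continuous_image[OF that cont]) (use qY in auto)
  have loop: "?q \<circ> p \<in> loops_at ?A ?a"
    if "path p" "path_image p \<subseteq> ?Y" "pathstart p = basepoint" "pathfinish p = vert g"
      "g \<in> level_set" for p g
    unfolding loops_at_def
  proof (intro CollectI conjI)
    show "path (?q \<circ> p)" by (rule path_continuous_image[OF that(1) continuous_on_subset[OF cont
      that(2)]])
    show "path_image (?q \<circ> p) \<subseteq> ?A" using that(2) qY by (auto simp: path_image_compose)
    show "pathstart (?q \<circ> p) = ?a" "pathfinish (?q \<circ> p) = ?a"
      using that quotient_map_vert by (simp_all add: pathstart_compose pathfinish_compose)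
  qed
  note loop\<gamma> = loop[OF \<gamma>]
  define \<Phi> where "\<Phi> g = homotopy_class ?A (?q \<circ> \<gamma> g)" for g
  have carrier: "carrier ?\<pi> = homotopy_class ?A ` loops_at ?A ?a"
    by (simp add: fundamental_group_def)
  have hom: "\<Phi> (act g h) = \<Phi> g \<otimes>\<^bsub>?\<pi>\<^esub> \<Phi> h" if gh: "g \<in> level_set" "h \<in> level_set" for g h
  proof -
    \<comment> \<open>This path starts where \<open>\<gamma> g\<close> ends, finishes at the vertex
      of the product, and has the same image in the quotient as \<open>\<gamma> h\<close>. Since the
      action is from the left, the order of the factors is preserved.\<close>
    let ?r = "translate g \<circ> \<gamma> h"
    have gh': "act g h \<in> level_set" using gh by simp
    have "continuous_on ?Y (translate g)"
      unfolding continuous_on_iff using dist_translate_le[OF gh(1)] by (meson le_less_trans)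
    then have "path ?r" by (intro path_continuous_image \<gamma>(1) gh continuous_on_subset[OF _ \<gamma>(2)[OF
      gh(2)]])
    moreover have "path_image ?r \<subseteq> ?Y" "pathstart ?r = vert g" "pathfinish ?r = vert (act g h)"
      using \<gamma>[OF gh(2)] translate_in[OF _ gh(1)] translate_basepoint[OF gh(1)]
      by (auto simp: path_image_compose pathstart_compose pathfinish_compose translate_vert)
    ultimately have r: "path ?r" "path_image ?r \<subseteq> ?Y" "pathstart ?r = vert g"
      "pathfinish ?r = vert (act g h)" .
    have "homotopic_paths ?Y (\<gamma> (act g h)) (\<gamma> g +++ ?r)"
      using \<gamma>[OF gh'] \<gamma>[OF gh(1)] r by (intro sc) (auto simp: path_image_join)
    then have "homotopic_paths ?A (?q \<circ> \<gamma> (act g h)) ((?q \<circ> \<gamma> g) +++ (?q \<circ> ?r))"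
      using push by (metis path_compose_join)
    also have "homotopic_paths ?A \<dots> ((?q \<circ> \<gamma> g) +++ (?q \<circ> \<gamma> h))"
    proof (rule homotopic_paths_join)
      show "homotopic_paths ?A (?q \<circ> ?r) (?q \<circ> \<gamma> h)"
      proof (rule homotopic_paths_sym[OF homotopic_paths_eq])
        show "path (?q \<circ> \<gamma> h)" "path_image (?q \<circ> \<gamma> h) \<subseteq> ?A"
          using loop\<gamma>[OF gh(2)] gh(2) by (auto simp: loops_at_def)
        show "(?q \<circ> \<gamma> h) t = (?q \<circ> ?r) t" if "t \<in> {0..1}" for t
        proof -
          have "\<gamma> h t \<in> ?Y" using \<gamma>(2)[OF gh(2)] that unfolding path_image_def by blast
          then show ?thesis using quotient_map_translate[OF _ gh(1)] by simp
        qed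
      qed
    qed (use loop\<gamma>[OF gh(1)] gh r quotient_map_vert in \<open>auto simp: loops_at_def pathstart_compose\<close>)
    finally have "\<Phi> (act g h) = homotopy_class ?A ((?q \<circ> \<gamma> g) +++ (?q \<circ> \<gamma> h))"
      unfolding \<Phi>_def by (rule homotopy_class_eq)
    then show ?thesis
      unfolding \<Phi>_def using fundamental_group_mult[OF loop\<gamma> loop\<gamma>] gh by simp
  qed
  have inj: "inj_on \<Phi> level_set"
  proof (rule inj_onI)
    fix g h assume gh: "g \<in> level_set" "h \<in> level_set" "\<Phi> g = \<Phi> h"
    note lg = loop\<gamma>[OF gh(1) gh(1) gh(1) gh(1) gh(1)]
      and lh = loop\<gamma>[OF gh(2) gh(2) gh(2) gh(2) gh(2)]
    have "homotopic_paths ?A (?q \<circ> \<gamma> g) (?q \<circ> \<gamma> h)"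
      using gh(3) lh unfolding \<Phi>_def loops_at_def by (intro homotopy_class_eqD) auto
    then have "pathfinish (\<gamma> g) = pathfinish (\<gamma> h)"
      using lg lh \<gamma>[OF gh(1)] \<gamma>[OF gh(2)] unfolding loops_at_def
      by (intro covering_space_monodromy[OF covering_quotient_map, of "?q \<circ> \<gamma> g" "?q \<circ> \<gamma> h"]) auto
    then show "g = h" using \<gamma>(4) gh inj_vert by (metis injD)
  qed
  have surj: "\<Phi> ` level_set = carrier ?\<pi>"
    unfolding carrier
  proof (intro equalityI subsetI)
    fix P assume "P \<in> \<Phi> ` level_set"
    then show "P \<in> homotopy_class ?A ` loops_at ?A ?a" using loop\<gamma> by (auto simp: \<Phi>_def)
  next
    fix P assume "P \<in> homotopy_class ?A ` loops_at ?A ?a"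
    then obtain p where p: "P = homotopy_class ?A p" "path p" "path_image p \<subseteq> ?A" "pathstart p = ?a"
      "pathfinish p = ?a"
      by (auto simp: loops_at_def)
    obtain r where r: "path r" "path_image r \<subseteq> ?Y" "pathstart r = basepoint"
      "\<And>t. t \<in> {0..1} \<Longrightarrow> ?q (r t) = p t"
      using covering_space_lift_path_strong[OF covering_quotient_map basepoint_in p(2,3,4)] by metis
    have end_in: "pathfinish r \<in> ?Y" using r(2) pathfinish_in_path_image by blast
    have "?q (pathfinish r) = ?a" using r(4)[of 1] p(5) by (simp add: pathfinish_def)
    then obtain g where g: "g \<in> level_set" "pathfinish r = vert g"
      using quotient_map_eqD[OF end_in basepoint_in] translate_basepoint by metis
    have "homotopic_paths ?Y r (\<gamma> g)" using r \<gamma>[OF g(1)] g(2) by (intro sc) auto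
    then have "homotopic_paths ?A (?q \<circ> r) (?q \<circ> \<gamma> g)" by (rule push)
    moreover have "homotopic_paths ?A p (?q \<circ> r)" using p r(4) by (intro homotopic_paths_eq) auto
    ultimately have "P = \<Phi> g" unfolding p(1) \<Phi>_def
      by (meson homotopic_paths_trans homotopy_class_eq)
    then show "P \<in> \<Phi> ` level_set" using g by blast
  qed
  have "\<Phi> \<in> iso stallings_group ?\<pi>"
    unfolding iso_def hom_def bij_betw_def using hom inj surj by auto
  then have "stallings_group \<cong> ?\<pi>" unfolding is_iso_def by blast
  then show ?thesis by (rule stallings.iso_sym)
qed

section \<open>Barycentric coordinates on discs\<close>

lemma homeomorphism_on_saturated:
  fixes f :: "'a::topological_space \<Rightarrow> 'b::t2_space"
  assumes K: "compact K" and f: "continuous_on K f" and U: "U \<subseteq> K" "inj_on f U"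
    "f ` U \<inter> f ` (K - U) = {}"
  shows "\<exists>g. homeomorphism U (f ` U) f g"
proof -
  let ?g = "inv_into U f"
  have "continuous_on (f ` U) ?g"
  proof (rule continuous_on_inverse_closed_map[OF continuous_on_subset[OF f U(1)] refl])
    show "?g (f x) = x" if "x \<in> U" for x using that U(2) by simp
    fix C assume "closedin (top_of_set U) C"
    then obtain C' where C: "closed C'" "C = U \<inter> C'" by (auto simp: closedin_closed)
    have "f ` C = f ` U \<inter> f ` (K \<inter> C')" using U C(2) by blast
    moreover have "compact (f ` (K \<inter> C'))"
      using K C(1) f by (intro compact_continuous_image continuous_on_subset[OF f]) auto
    ultimately show "closedin (top_of_set (f ` U)) (f ` C)"
      unfolding closedin_closed using compact_imp_closed by blast
  qed
  then have "homeomorphism U (f ` U) f ?g"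
    using continuous_on_subset[OF f U(1)] U(2)
      by (auto simp: homeomorphism_def inv_into_into image_iff)
  then show ?thesis by blast
qed

text \<open>Characteristic maps start from round discs while the cells are simplices. The functions
  \<open>b\<close> are the coordinates of a homeomorphism from the disc to the standard simplex that
  carries the open disc to the points with all coordinates positive.\<close>

definition barycentric :: "nat \<Rightarrow> ((nat \<Rightarrow> real) \<Rightarrow> nat \<Rightarrow> real) \<Rightarrow> bool" where
  "barycentric n b \<longleftrightarrow>
     (\<forall>i. continuous_on (cw_disc n) (\<lambda>x. b x i)) \<and>
     (\<forall>x\<in>cw_disc n. (\<forall>i\<le>n. 0 \<le> b x i) \<and> (\<Sum>i\<le>n. b x i) = 1) \<and>
     (\<forall>c. (\<forall>i\<le>n. 0 \<le> c i) \<and> (\<Sum>i\<le>n. c i) = 1 \<longrightarrow> (\<exists>x\<in>cw_disc n. \<forall>i\<le>n. b x i = c i)) \<and>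
     (\<forall>x\<in>cw_disc n. \<forall>y\<in>cw_disc n. (\<forall>i\<le>n. b x i = b y i) \<longrightarrow> x = y) \<and>
     (\<forall>x\<in>cw_disc n. x \<in> cw_open_disc n \<longleftrightarrow> (\<forall>i\<le>n. 0 < b x i))"

lemma mem_cw_disc: "x \<in> cw_disc n \<longleftrightarrow> (\<forall>i\<ge>n. x i = 0) \<and> (\<Sum>i<n. (x i)\<^sup>2) \<le> 1"
  by (auto simp: cw_disc_def topspace_Euclidean_space)

lemma mem_cw_open_disc: "x \<in> cw_open_disc n \<longleftrightarrow> (\<forall>i\<ge>n. x i = 0) \<and> (\<Sum>i<n. (x i)\<^sup>2) < 1"
  by (auto simp: cw_open_disc_def topspace_Euclidean_space)

lemma barycentric_0: "barycentric 0 (\<lambda>x i. 1)" "compact (cw_disc 0)"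
proof -
  have disc: "cw_disc 0 = {\<lambda>_. 0}" "cw_open_disc 0 = {\<lambda>_. 0}"
    by (auto simp: mem_cw_disc mem_cw_open_disc)
  then show "barycentric 0 (\<lambda>x i. 1)" "compact (cw_disc 0)" by (auto simp: barycentric_def)
qed

lemma cw_disc_1: "x \<in> cw_disc 1 \<longleftrightarrow> (\<forall>i\<ge>1. x i = 0) \<and> \<bar>x 0\<bar> \<le> 1"
  by (auto simp: mem_cw_disc abs_square_le_1)

lemma barycentric_1: "barycentric 1 (\<lambda>x i.
  if i = 0 then (1 - x 0) / 2 else (1 + x 0) / 2)" (is "barycentric 1 ?b")
  "compact (cw_disc 1)"
proof -
  have sum: "(\<Sum>i\<le>1. c i) = c 0 + c 1" for c :: "nat \<Rightarrow> real" by (simp add: atMost_Suc)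
  have all: "(\<forall>i\<le>1. P i) \<longleftrightarrow> P 0 \<and> P 1" for P :: "nat \<Rightarrow> bool" using le_Suc_eq by auto
  have eqI: "x = y" if "x \<in> cw_disc 1" "y \<in> cw_disc 1" "x 0 = y 0" for x y
  proof
    fix i show "x i = y i" using that[unfolded cw_disc_1] by (cases "i = 0") auto
  qed
  have cont: "continuous_on A (\<lambda>x::nat \<Rightarrow> real. x 0)" for A
    by (rule continuous_on_subset[OF continuous_on_product_coordinates subset_UNIV])
  show "barycentric 1 ?b"
    unfolding barycentric_def sum all
  proof (intro conjI ballI allI impI)
    show "continuous_on (cw_disc 1) (\<lambda>x. ?b x i)" for i
      by (cases "i = 0") (auto intro!: continuous_intros cont)
    fix c :: "nat \<Rightarrow> real" assume c: "(0 \<le> c 0 \<and> 0 \<le> c 1) \<and> c 0 + c 1 = 1"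
    have "(\<lambda>i. if i = 0 then c 1 - c 0 else 0) \<in> cw_disc 1" unfolding cw_disc_1 using c by auto
    then show "\<exists>x\<in>cw_disc 1. ?b x 0 = c 0 \<and> ?b x 1 = c 1"
      by (rule bexI[rotated]) (use c in auto)
  next
    show "x \<in> cw_open_disc 1 \<longleftrightarrow> 0 < ?b x 0 \<and> 0 < ?b x 1" if "x \<in> cw_disc 1" for x
      using that[unfolded cw_disc_1] by (auto simp: mem_cw_open_disc abs_square_less_1 abs_less_iff)
  next
    fix x y :: "nat \<Rightarrow> real" assume "x \<in> cw_disc 1" "y \<in> cw_disc 1"
      "?b x 0 = ?b y 0 \<and> ?b x 1 = ?b y 1"
    then show "x = y" by (intro eqI) auto
  next
    fix x :: "nat \<Rightarrow> real" assume "x \<in> cw_disc 1"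
    then have "\<bar>x 0\<bar> \<le> 1" unfolding cw_disc_1 by blast
    then show "0 \<le> ?b x 0" "0 \<le> ?b x 1" "?b x 0 + ?b x 1 = 1" by (auto simp: field_simps)
  qed
  have "cw_disc 1 = (\<lambda>t i. if i = 0 then t else 0) ` {- 1..1}"
  proof (intro equalityI subsetI)
    fix x assume x: "x \<in> cw_disc 1"
    then have x0: "\<bar>x 0\<bar> \<le> 1" and "x = (\<lambda>i. if i = 0 then x 0 else 0)" unfolding cw_disc_1 by auto
    then show "x \<in> (\<lambda>t i. if i = 0 then t else 0) ` {- 1..1}"
      by (intro image_eqI[of _ _ "x 0"]) auto
  next
    fix x :: "nat \<Rightarrow> real" assume "x \<in> (\<lambda>t i. if i = 0 then t else 0) ` {- 1..1}"
    then show "x \<in> cw_disc 1" unfolding cw_disc_1 by auto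
  qed
  moreover have "continuous_on {- 1..1} (\<lambda>t i::nat. if i = 0 then t else 0 :: real)"
  proof (rule continuous_on_coordinatewise_then_product)
    show "continuous_on {- 1..1} (\<lambda>t. if i = 0 then t else 0 :: real)" for i :: nat
      by (cases "i = 0") auto
  qed
  ultimately show "compact (cw_disc 1)" using compact_continuous_image by fastforce
qed

text \<open>The disc is moved to the complex plane, where any compact convex set with nonempty
  interior is homeomorphic to the closed ball. Nothing is known about that homeomorphism, so
  invariance of domain is used in both directions to see that it matches the interiors.\<close>

lemma barycentric_2: "\<exists>b. barycentric 2 b" "compact (cw_disc 2)"
proof -
  define \<iota> where "\<iota> x = Complex (x 0) (x 1)" for x :: "nat \<Rightarrow> real"
  define \<kappa> where "\<kappa> z = (\<lambda>i::nat. if i = 0 then Re z else if i = 1 then Im z else 0)" for z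
  have \<iota>\<kappa>: "\<iota> (\<kappa> z) = z" for z by (simp add: \<iota>_def \<kappa>_def)
  have \<kappa>\<iota>: "\<kappa> (\<iota> x) = x" if "x \<in> cw_disc 2" for x
    using that by (auto simp: \<iota>_def \<kappa>_def mem_cw_disc)
  have sum2: "(\<Sum>i<2. c i) = c 0 + c 1" for c :: "nat \<Rightarrow> real" by (simp add: numeral_2_eq_2)
  have norm: "(\<Sum>i<2. (x i)\<^sup>2) = (norm (\<iota> x))\<^sup>2" for x
    unfolding sum2 cmod_power2 by (simp add: \<iota>_def)
  have disc: "x \<in> cw_disc 2 \<longleftrightarrow> (\<forall>i\<ge>2. x i = 0) \<and> norm (\<iota> x) \<le> 1" for x
    unfolding mem_cw_disc norm by (simp add: power_le_one_iff)
  have odisc: "x \<in> cw_open_disc 2 \<longleftrightarrow> (\<forall>i\<ge>2. x i = 0) \<and> norm (\<iota> x) < 1" for x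
    unfolding mem_cw_open_disc norm by (simp add: power_less_one_iff)
  have \<kappa>_disc: "\<kappa> z \<in> cw_disc 2 \<longleftrightarrow> z \<in> cball 0 1" for z
    unfolding disc \<iota>\<kappa> by (auto simp: \<kappa>_def)
  have \<iota>_cont: "continuous_on A \<iota>" for A
  proof -
    have c: "continuous_on A (\<lambda>x::nat \<Rightarrow> real. x i)" for i
      by (rule continuous_on_subset[OF continuous_on_product_coordinates subset_UNIV])
    show ?thesis unfolding \<iota>_def Complex_eq by (intro continuous_intros c)
  qed
  have \<kappa>_cont: "continuous_on A \<kappa>" for A
  proof (rule continuous_on_coordinatewise_then_product)
    show "continuous_on A (\<lambda>z. \<kappa> z i)" for i
      by (cases "i = 0"; cases "i = 1") (auto simp: \<kappa>_def intro!: continuous_intros)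
  qed
  have "cw_disc 2 = \<kappa> ` cball 0 1"
  proof (intro equalityI subsetI)
    fix x assume x: "x \<in> cw_disc 2"
    have "\<kappa> (\<iota> x) \<in> \<kappa> ` cball 0 1" by (rule imageI) (use x in \<open>simp add: disc\<close>)
    then show "x \<in> \<kappa> ` cball 0 1" unfolding \<kappa>\<iota>[OF x] .
  next
    fix x assume "x \<in> \<kappa> ` cball 0 1"
    then obtain z where "x = \<kappa> z" "z \<in> cball 0 1" by blast
    then show "x \<in> cw_disc 2" using \<kappa>_disc[of z] by simp
  qed
  then show "compact (cw_disc 2)" using compact_continuous_image[OF \<kappa>_cont compact_cball] by simp
  define T where "T = {z. 0 \<le> Re z \<and> 0 \<le> Im z \<and> Re z + Im z \<le> 1}"
  define T' where "T' = {z. 0 < Re z \<and> 0 < Im z \<and> Re z + Im z < 1}"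
  have T_eq: "T = {z. 0 \<le> Re z} \<inter> {z. 0 \<le> Im z} \<inter> {z. Re z + Im z \<le> 1}" by (auto simp: T_def)
  have "closed T" unfolding T_eq
    by (intro closed_Int closed_Collect_le continuous_intros)
  have "T \<subseteq> cball 0 2"
  proof
    fix z assume "z \<in> T"
    then have "\<bar>Re z\<bar> + \<bar>Im z\<bar> \<le> 2" by (auto simp: T_def)
    then show "z \<in> cball 0 2" using cmod_le[of z] by simp
  qed
  then have "compact T" using \<open>closed T\<close> bounded_subset[OF bounded_cball] compact_eq_bounded_closed
    by blast
  have "convex T"
  proof (rule convexI)
    fix x y :: complex and u v :: real
    assume "x \<in> T" "y \<in> T" and uv: "0 \<le> u" "0 \<le> v" "u + v = 1"
    then have *: "0 \<le> Re x" "0 \<le> Im x" "Re x + Im x \<le> 1" "0 \<le> Re y" "0 \<le> Im y" "Re y + Im y \<le> 1"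
      by (auto simp: T_def)
    have "u * (Re x + Im x) + v * (Re y + Im y) \<le> u * 1 + v * 1"
      using * uv by (intro add_mono mult_left_mono) auto
    then show "u *\<^sub>R x + v *\<^sub>R y \<in> T"
      using * uv by (simp add: T_def algebra_simps)
  qed
  have T'_open: "open T'"
  proof -
    have "T' = {z. 0 < Re z} \<inter> {z. 0 < Im z} \<inter> {z. Re z + Im z < 1}" by (auto simp: T'_def)
    then show ?thesis by (simp add: open_Int open_Collect_less continuous_intros)
  qed
  have T'T: "T' \<subseteq> T" by (auto simp: T_def T'_def)
  have int_sub: "V \<subseteq> T'" if V: "open V" "V \<subseteq> T" for V
  proof
    fix z assume z: "z \<in> V"
    then obtain e where e: "0 < e" "ball z e \<subseteq> V" using V(1) open_contains_ball by blast
    have mem: "z + of_real t * w \<in> T" if "norm w \<le> 1" "\<bar>t\<bar> < e" for w t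
    proof -
      have "norm (of_real t * w) \<le> \<bar>t\<bar> * 1" unfolding norm_mult
        using that(1) by (intro mult_mono) auto
      then show ?thesis using that(2) e V(2) by (auto simp: dist_norm subset_iff)
    qed
    \<comment> \<open>Each of the three displacements stays in \<open>T\<close> and turns one of the
      three defining inequalities of the triangle into a strict one at \<open>z\<close>.\<close>
    have "z + of_real (- (e / 2)) * 1 \<in> T" "z + of_real (- (e / 2)) * \<i> \<in> T"
      "z + of_real (e / 2) * 1 \<in> T"
      using e(1) by (intro mem; simp)+
    then show "z \<in> T'" using e(1) by (auto simp: T_def T'_def)
  qed
  have "Complex (1/4) (1/4) \<in> T'" by (simp add: T'_def)
  then have "interior T \<noteq> {}" using interior_maximal[OF T'T T'_open] by blast
  then have "T homeomorphic cball (0 :: complex) 1"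
    using homeomorphic_convex_compact_cball[OF \<open>convex T\<close> \<open>compact T\<close>] by simp
  then obtain k h where hom: "homeomorphism T (cball (0 :: complex) 1) k h"
    unfolding homeomorphic_def by blast
  have kh: "\<And>z. z \<in> cball 0 1 \<Longrightarrow> k (h z) = z" "\<And>z. z \<in> T \<Longrightarrow> h (k z) = z"
    using homeomorphism_apply1[OF hom] homeomorphism_apply2[OF hom] by auto
  have h: "continuous_on (cball 0 1) h" "h ` cball 0 1 = T" "inj_on h (cball 0 1)"
    using homeomorphism_cont2[OF hom] homeomorphism_image2[OF hom] inj_on_inverseI[of "cball 0 1" k
      h, OF kh(1)] by blast+
  have k: "continuous_on T k" "k ` T = cball 0 1" "inj_on k T"
    using homeomorphism_cont1[OF hom] homeomorphism_image1[OF hom] inj_on_inverseI[of T h k, OF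
      kh(2)] by blast+
  have "open (h ` ball 0 1)"
    using h continuous_on_subset[OF h(1) ball_subset_cball] inj_on_subset[OF h(3) ball_subset_cball]
    by (intro invariance_of_domain) auto
  then have hb: "h ` ball 0 1 \<subseteq> T'" using h(2) ball_subset_cball by (intro int_sub) auto
  have "open (k ` T')"
    using k continuous_on_subset[OF k(1) T'T] inj_on_subset[OF k(3) T'T] T'_open
      by (intro invariance_of_domain) auto
  then have "k ` T' \<subseteq> ball 0 1"
    using interior_maximal[of "k ` T'" "cball 0 1"] k(2) T'T by (metis image_mono interior_cball)
  then have h_int: "h z \<in> T' \<longleftrightarrow> z \<in> ball 0 1" if "z \<in> cball 0 1" for z
    using hb kh(1)[OF that] by (metis image_eqI subsetD)
  define b where "b x i = (if i = 0 then Re (h (\<iota> x)) else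
    if i = 1 then Im (h (\<iota> x)) else 1 - Re (h (\<iota> x)) - Im (h (\<iota> x)))" for x and i :: nat
  have sum: "(\<Sum>i\<le>2. c i) = c 0 + c 1 + c 2" for c :: "nat \<Rightarrow> real" by (simp add: numeral_2_eq_2)
  have all: "(\<forall>i\<le>2. P i) \<longleftrightarrow> P 0 \<and> P 1 \<and> P 2" for P :: "nat \<Rightarrow> bool"
    by (metis le_Suc_eq le_zero_eq numeral_2_eq_2 One_nat_def)
  have \<iota>_in: "\<iota> x \<in> cball 0 1" "h (\<iota> x) \<in> T" if "x \<in> cw_disc 2" for x
    using that h(2) by (auto simp: disc)
  have h\<iota>: "continuous_on (cw_disc 2) (\<lambda>x. h (\<iota> x))"
    by (rule continuous_on_compose2[OF h(1) \<iota>_cont]) (use \<iota>_in in auto)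
  have "barycentric 2 b"
    unfolding barycentric_def sum all
  proof (intro conjI ballI allI impI)
    show "continuous_on (cw_disc 2) (\<lambda>x. b x i)" for i
      unfolding b_def by (cases "i = 0"; cases "i = 1") (auto intro!: continuous_intros h\<iota>)
    fix c :: "nat \<Rightarrow> real" assume c: "(0 \<le> c 0 \<and> 0 \<le> c 1 \<and> 0 \<le> c 2) \<and> c 0 + c 1 + c 2 = 1"
    define z where "z = k (Complex (c 0) (c 1))"
    have cT: "Complex (c 0) (c 1) \<in> T" using c by (auto simp: T_def)
    then have z: "z \<in> cball 0 1" "h z = Complex (c 0) (c 1)" using k(2) kh(2) by (auto simp: z_def)
    show "\<exists>x\<in>cw_disc 2. b x 0 = c 0 \<and> b x 1 = c 1 \<and> b x 2 = c 2"
      by (rule bexI[of _ "\<kappa> z"]) (use z c \<kappa>_disc in \<open>auto simp: b_def \<iota>\<kappa>\<close>)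
  next
    fix x y assume xy: "x \<in> cw_disc 2" "y \<in> cw_disc 2"
      and eq: "b x 0 = b y 0 \<and> b x 1 = b y 1 \<and> b x 2 = b y 2"
    then have "h (\<iota> x) = h (\<iota> y)" by (simp add: b_def complex_eq_iff)
    then have "\<iota> x = \<iota> y" using inj_onD[OF h(3)] \<iota>_in xy by blast
    then show "x = y" using \<kappa>\<iota> xy by metis
  next
    fix x assume x: "x \<in> cw_disc 2"
    show "x \<in> cw_open_disc 2 \<longleftrightarrow> 0 < b x 0 \<and> 0 < b x 1 \<and> 0 < b x 2"
      using h_int[OF \<iota>_in(1)[OF x]] x by (auto simp: disc odisc T'_def b_def)
  next
    fix x assume "x \<in> cw_disc 2"
    then have "0 \<le> Re (h (\<iota> x))" "0 \<le> Im (h (\<iota> x))" "Re (h (\<iota> x)) + Im (h (\<iota> x)) \<le> 1"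
      using \<iota>_in(2) by (auto simp: T_def)
    then show "0 \<le> b x 0" "0 \<le> b x 1" "0 \<le> b x 2" "b x 0 + b x 1 + b x 2 = 1" by (auto simp: b_def)
  qed
  then show "\<exists>b. barycentric 2 b" by blast
qed

lemma cw_disc_small:
  assumes "n \<in> {0, 1, 2}" shows "\<exists>b. barycentric n b" "compact (cw_disc n)"
  using assms barycentric_0 barycentric_1 barycentric_2 by auto

section \<open>The cell structure\<close>

definition cell_coords :: "nat \<Rightarrow> (nat \<Rightarrow> real) \<Rightarrow> nat \<Rightarrow> real" where
  "cell_coords n = (SOME b. barycentric n b)"

definition enumeration :: "F2_cubed set \<Rightarrow> F2_cubed list" where
  "enumeration s = (SOME vs. distinct vs \<and> set vs = s)"

definition cell_dim :: "F2_cubed set \<Rightarrow> nat" where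
  "cell_dim s = card s - 1"

definition cell_map :: "F2_cubed set \<Rightarrow> (nat \<Rightarrow> real) \<Rightarrow> linfty" where
  "cell_map s x = (\<Sum>i\<le>cell_dim s. cell_coords (cell_dim s) x i *\<^sub>R vert (enumeration s ! i))"

definition open_simplex :: "F2_cubed set \<Rightarrow> linfty set" where
  "open_simplex s = {f \<in> simplex_hull s. support f = s}"

lemma cell_dim: "is_simplex s \<Longrightarrow> cell_dim s \<in> {0, 1, 2}" "is_simplex s \<Longrightarrow> card s = Suc (cell_dim s)"
  using card_simplex(2)[of s] by (auto simp: cell_dim_def)

lemma barycentric_cell_coords: "is_simplex s \<Longrightarrow> barycentric (cell_dim s) (cell_coords (cell_dim s))"
  unfolding cell_coords_def by (rule someI_ex[OF cw_disc_small(1)[OF cell_dim(1)]])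

lemma enumeration:
  assumes "is_simplex s"
  shows "distinct (enumeration s)" "set (enumeration s) = s"
    "length (enumeration s) = Suc (cell_dim s)"
proof -
  have "\<exists>vs. distinct vs \<and> set vs = s"
    using finite_distinct_list[OF card_simplex(1)[OF assms]] by blast
  then have "distinct (enumeration s) \<and> set (enumeration s) = s" unfolding enumeration_def
    by (rule someI_ex)
  then show d: "distinct (enumeration s)" "set (enumeration s) = s" by auto
  show "length (enumeration s) = Suc (cell_dim s)"
    using distinct_card[OF d(1)] cell_dim(2)[OF assms] d(2) by simp
qed

lemma bij_enumeration: "is_simplex s \<Longrightarrow> bij_betw (\<lambda>i. enumeration s ! i) {..cell_dim s} s"
  using bij_betw_nth[OF enumeration(1), of s "{..cell_dim s}" s] enumeration(2,3)[of s]
  by (simp add: lessThan_Suc_atMost)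

lemma coord_cell_map:
  assumes s: "is_simplex s" and i: "i \<le> cell_dim s"
  shows "coord (cell_map s x) (enumeration s ! i) = cell_coords (cell_dim s) x i"
    and "\<And>v. v \<notin> s \<Longrightarrow> coord (cell_map s x) v = 0"
proof -
  note bij = bij_enumeration[OF s]
  define c where "c v = cell_coords (cell_dim s) x (inv_into {..cell_dim s} (\<lambda>i. enumeration s ! i)
    v)" for v
  have c: "c (enumeration s ! j) = cell_coords (cell_dim s) x j" if "j \<le> cell_dim s" for j
    unfolding c_def using inv_into_f_f[OF bij_betw_imp_inj_on[OF bij]] that by simp
  have eq: "cell_map s x = (\<Sum>v\<in>s. c v *\<^sub>R vert v)"
    unfolding cell_map_def sum.reindex_bij_betw[OF bij, symmetric]
      by (intro sum.cong) (simp_all add: c)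
  have "enumeration s ! i \<in> s" using bij i by (auto simp: bij_betw_def)
  then show "coord (cell_map s x) (enumeration s ! i) = cell_coords (cell_dim s) x i"
    unfolding eq coord_point[OF card_simplex(1)[OF s]] using c[OF i] by simp
  show "coord (cell_map s x) v = 0" if "v \<notin> s" for v
    unfolding eq coord_point[OF card_simplex(1)[OF s]] using that by simp
qed

lemma cell_map_hull:
  assumes s: "is_simplex s" and x: "x \<in> cw_disc (cell_dim s)"
  shows "cell_map s x \<in> simplex_hull s"
proof -
  have b: "\<forall>i\<le>cell_dim s. 0 \<le> cell_coords (cell_dim s) x i"
    "(\<Sum>i\<le>cell_dim s. cell_coords (cell_dim s) x i) = 1"
    using barycentric_cell_coords[OF s] x unfolding barycentric_def by blast+
  have "vert (enumeration s ! i) \<in> simplex_hull s" if "i \<le> cell_dim s" for i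
    using bij_enumeration[OF s] that by (intro vert_in_hull) (auto simp: bij_betw_def)
  then show ?thesis
    unfolding cell_map_def using b by (intro convex_sum convex_simplex_hull) auto
qed

lemma cell_map_surj:
  assumes s: "is_simplex s" and f: "f \<in> simplex_hull s"
  obtains x where "x \<in> cw_disc (cell_dim s)" "cell_map s x = f"
proof -
  note fin = card_simplex(1)[OF s] and bij = bij_enumeration[OF s]
  have "(\<Sum>i\<le>cell_dim s. coord f (enumeration s ! i)) = 1"
    using simplex_hull_coord(3)[OF f fin] sum.reindex_bij_betw[OF bij, of "coord f"] by simp
  moreover have "0 \<le> coord f (enumeration s ! i)" for i by (rule simplex_hull_coord(2)[OF f fin])
  ultimately obtain x where x: "x \<in> cw_disc (cell_dim s)"
    "\<forall>i\<le>cell_dim s. cell_coords (cell_dim s) x i = coord f (enumeration s ! i)"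
    using barycentric_cell_coords[OF s] unfolding barycentric_def by (metis (no_types, lifting))
  have "cell_map s x = (\<Sum>i\<le>cell_dim s. coord f (enumeration s ! i) *\<^sub>R vert (enumeration s ! i))"
    unfolding cell_map_def using x(2) by (intro sum.cong) auto
  also have "\<dots> = (\<Sum>v\<in>s. coord f v *\<^sub>R vert v)"
    by (rule sum.reindex_bij_betw[OF bij])
  also have "\<dots> = f" by (rule simplex_hull_coord(1)[OF f fin, symmetric])
  finally show ?thesis using that x(1) by blast
qed

lemma cell_map_open:
  assumes s: "is_simplex s" and x: "x \<in> cw_disc (cell_dim s)"
  shows "x \<in> cw_open_disc (cell_dim s) \<longleftrightarrow> support (cell_map s x) = s"
proof -
  have "x \<in> cw_open_disc (cell_dim s) \<longleftrightarrow> (\<forall>i\<le>cell_dim s. 0 < cell_coords (cell_dim s) x i)"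
    using barycentric_cell_coords[OF s] x unfolding barycentric_def by blast
  also have "\<dots> \<longleftrightarrow> (\<forall>i\<in>{..cell_dim s}. enumeration s ! i \<in> support (cell_map s x))"
  proof -
    have "0 \<le> cell_coords (cell_dim s) x i" if "i \<le> cell_dim s" for i
      using barycentric_cell_coords[OF s] x that unfolding barycentric_def by blast
    then have "0 < cell_coords (cell_dim s) x i \<longleftrightarrow> enumeration s ! i \<in> support (cell_map s x)"
      if "i \<le> cell_dim s" for i
      using coord_cell_map(1)[OF s that, of x] that by (simp add: support_def order_less_le)
    then show ?thesis by auto
  qed
  also have "\<dots> \<longleftrightarrow> s \<subseteq> support (cell_map s x)"
    using image_subset_iff[of "\<lambda>i. enumeration s ! i" "{..cell_dim s}" "support (cell_map s x)"]
    unfolding bij_betw_imp_surj_on[OF bij_enumeration[OF s]] by simp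
  also have "\<dots> \<longleftrightarrow> support (cell_map s x) = s"
    using simplex_hull_coord(4)[OF cell_map_hull[OF s x] card_simplex(1)[OF s]] by blast
  finally show ?thesis .
qed

lemma cell_map_inj: assumes s: "is_simplex s" shows "inj_on (cell_map s) (cw_disc (cell_dim s))"
proof (rule inj_onI)
  fix x y assume xy: "x \<in> cw_disc (cell_dim s)" "y \<in> cw_disc (cell_dim s)"
    and eq: "cell_map s x = cell_map s y"
  have "\<forall>i\<le>cell_dim s. cell_coords (cell_dim s) x i = cell_coords (cell_dim s) y i"
    using coord_cell_map(1)[OF s, of _ x] coord_cell_map(1)[OF s, of _ y] eq by simp
  then show "x = y" using barycentric_cell_coords[OF s] xy unfolding barycentric_def by blast
qed

lemma cell_map_image:
  assumes s: "is_simplex s"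
  shows "cell_map s ` cw_disc (cell_dim s) = simplex_hull s"
    "cell_map s ` cw_open_disc (cell_dim s) = open_simplex s"
    "cell_map s ` (cw_disc (cell_dim s) - cw_open_disc (cell_dim s))
      = simplex_hull s - open_simplex s"
proof -
  have sub: "cw_open_disc (cell_dim s) \<subseteq> cw_disc (cell_dim s)"
    by (auto simp: cw_open_disc_def cw_disc_def)
  show 1: "cell_map s ` cw_disc (cell_dim s) = simplex_hull s"
  proof (intro equalityI subsetI)
    fix f assume "f \<in> simplex_hull s"
    then obtain x where "x \<in> cw_disc (cell_dim s)" "cell_map s x = f"
      using cell_map_surj[OF s] by blast
    then show "f \<in> cell_map s ` cw_disc (cell_dim s)" by blast
  qed (use cell_map_hull[OF s] in blast)
  have "open_simplex s \<subseteq> cell_map s ` cw_open_disc (cell_dim s)"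
  proof
    fix f assume f: "f \<in> open_simplex s"
    then obtain x where "x \<in> cw_disc (cell_dim s)" "cell_map s x = f"
      using cell_map_surj[OF s, of f] by (auto simp: open_simplex_def)
    then show "f \<in> cell_map s ` cw_open_disc (cell_dim s)"
      using cell_map_open[OF s] f by (auto simp: open_simplex_def)
  qed
  moreover have "cell_map s ` cw_open_disc (cell_dim s) \<subseteq> open_simplex s"
    using cell_map_open[OF s] cell_map_hull[OF s] sub by (auto simp: open_simplex_def)
  ultimately show 2: "cell_map s ` cw_open_disc (cell_dim s) = open_simplex s" by blast
  show "cell_map s ` (cw_disc (cell_dim s) - cw_open_disc (cell_dim s))
    = simplex_hull s - open_simplex s"
    using inj_on_image_set_diff[OF cell_map_inj[OF s], of "cw_disc (cell_dim s)"
      "cw_open_disc (cell_dim s)"] sub 1 2 by simp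
qed

lemma continuous_cell_map: assumes "is_simplex s" shows "continuous_on (cw_disc (cell_dim s))
  (cell_map s)"
  using barycentric_cell_coords[OF assms] unfolding barycentric_def cell_map_def
  by (intro continuous_on_sum continuous_on_scaleR continuous_on_const) blast

lemma hull_level: "is_simplex s \<Longrightarrow> simplex_hull s \<subseteq> level_complex"
  unfolding level_complex_def by (rule level.hull_body) (auto elim: simplexE)

lemma open_simplexI: "f \<in> level_complex \<Longrightarrow> f \<in> open_simplex (support f)"
  using support_level(4) by (simp add: open_simplex_def)

lemma hull_iff: "is_simplex s \<Longrightarrow> f \<in> simplex_hull s \<longleftrightarrow> f \<in> level_complex \<and> support f \<subseteq> s"
  using hull_level support_level(4) simplex_hull_mono simplex_hull_coord(4)[OF _ card_simplex(1)]
    by blast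

lemma open_simplex_iff: "is_simplex s \<Longrightarrow> f \<in> open_simplex s \<longleftrightarrow> f \<in> level_complex \<and> support f = s"
  unfolding open_simplex_def using hull_iff by auto

section \<open>Orbits of simplices and the cells of the quotient\<close>

definition simplex_orbit :: "F2_cubed set \<Rightarrow> F2_cubed set set" where
  "simplex_orbit s = (\<lambda>g. act g ` s) ` level_set"

text \<open>The choice is made from the orbit, so it is the same for all simplices of an orbit.
  Asking for \<open>origin\<close> places all representatives among the finitely many simplices at
  one vertex.\<close>

definition representative :: "F2_cubed set \<Rightarrow> F2_cubed set" where
  "representative s = (SOME r. r \<in> simplex_orbit s \<and> origin \<in> r)"

definition representatives :: "F2_cubed set set" where
  "representatives = representative ` {s. is_simplex s}"

lemma act_image_image: "g \<in> level_set \<Longrightarrow> h \<in> level_set \<Longrightarrow> s \<subseteq> level_set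
  \<Longrightarrow> act g ` (act h ` s) = act (act g h) ` s"
  by (force simp: image_image stallings.m_assoc subset_iff)

lemma act_image_one: "s \<subseteq> level_set \<Longrightarrow> act origin ` s = s"
  by (force simp: subset_iff)

lemma simplex_orbit_eq:
  assumes s: "s \<subseteq> level_set" "g \<in> level_set" shows "simplex_orbit (act g ` s) = simplex_orbit s"
proof -
  have "act h ` (act g ` s) \<in> simplex_orbit s" if "h \<in> level_set" for h
    unfolding act_image_image[OF that s(2,1)] simplex_orbit_def using that s by auto
  moreover have "act h ` s \<in> simplex_orbit (act g ` s)" if h: "h \<in> level_set" for h
  proof -
    let ?k = "act h (act_inv g)"
    have "act ?k ` (act g ` s) = act (act ?k g) ` s" using h s by (intro act_image_image) auto
    also have "act ?k g = h" using h s by (simp add: stallings.m_assoc)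
    finally have eq: "act ?k ` (act g ` s) = act h ` s" .
    have "act ?k ` (act g ` s) \<in> simplex_orbit (act g ` s)"
      unfolding simplex_orbit_def by (rule imageI) (use h s in simp)
    then show ?thesis unfolding eq .
  qed
  ultimately show ?thesis by (auto simp: simplex_orbit_def)
qed

lemma representative:
  assumes s: "is_simplex s"
  shows "representative s \<in> simplex_orbit s" "origin \<in> representative s"
    "is_simplex (representative s)" "\<exists>g\<in>level_set. s = act g ` representative s"
proof -
  have sub: "s \<subseteq> level_set" using s by (auto elim: simplexE)
  obtain v where v: "v \<in> s" using s unfolding is_simplex_def by blast
  then have vl: "v \<in> level_set" using sub by blast
  have "act (act_inv v) v \<in> act (act_inv v) ` s" using v by (rule imageI)
  then have "\<exists>r. r \<in> simplex_orbit s \<and> origin \<in> r"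
    using vl unfolding simplex_orbit_def by (intro exI[of _ "act (act_inv v) ` s"]) simp
  then have "representative s \<in> simplex_orbit s \<and> origin \<in> representative s"
    unfolding representative_def by (rule someI_ex)
  then show r: "representative s \<in> simplex_orbit s" "origin \<in> representative s" by auto
  then obtain g where g: "g \<in> level_set" "representative s = act g ` s"
    by (auto simp: simplex_orbit_def)
  show "is_simplex (representative s)" unfolding g(2) by (rule simplex_act[OF s g(1)])
  have "act (act_inv g) ` representative s = s"
    unfolding g(2) using act_image_image[of "act_inv g" g s] act_image_one[OF sub] g(1) sub by simp
  then show "\<exists>g\<in>level_set. s = act g ` representative s" using g(1) by (metis stallings.inv_closed)
qed

lemma representatives_simplex: "r \<in> representatives \<Longrightarrow> is_simplex r"
  using representative(3) by (auto simp: representatives_def)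

lemma finite_representatives: "finite representatives"
  by (rule finite_subset[OF _ finite_simplices_at[of "origin"]])
    (use representative(2,3) in \<open>auto simp: representatives_def\<close>)

lemma representatives_unique:
  assumes "r \<in> representatives" "r' \<in> representatives" "r' = act g ` r" "g \<in> level_set"
  shows "r' = r"
proof -
  have *: "representative q = q" if q: "q \<in> representatives" for q
  proof -
    obtain s where s: "is_simplex s" "q = representative s"
      using q by (auto simp: representatives_def)
    have "s \<subseteq> level_set" using s by (auto elim: simplexE)
    moreover obtain g where "g \<in> level_set" "q = act g ` s"
      using representative(1)[OF s(1)] unfolding s(2)[symmetric] simplex_orbit_def by blast
    ultimately have "simplex_orbit q = simplex_orbit s" using simplex_orbit_eq by simp
    then show ?thesis using s(2) by (simp add: representative_def)
  qed
  have "r \<subseteq> level_set" using representatives_simplex[OF assms(1)] by (auto elim: simplexE)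
  then have "simplex_orbit r' = simplex_orbit r" using simplex_orbit_eq assms(3,4) by simp
  then have "representative r' = representative r" by (simp add: representative_def)
  then show ?thesis using * assms by metis
qed

definition cell :: "F2_cubed set \<Rightarrow> linfty cell" where
  "cell r = (cell_dim r, quotient_map \<circ> cell_map r)"

definition cells :: "linfty cell set" where
  "cells = cell ` representatives"

lemma cell_image:
  assumes r: "is_simplex r"
  shows "closed_cell (cell r) = quotient_map ` simplex_hull r"
    "open_cell (cell r) = quotient_map ` open_simplex r"
    "cell_boundary (cell r) = quotient_map ` (simplex_hull r - open_simplex r)"
  unfolding closed_cell_def open_cell_def cell_boundary_def cell_def fst_conv snd_conv
    image_comp[symmetric]
    cell_map_image[OF r] by (rule refl)+

lemma continuous_cell: "is_simplex r \<Longrightarrow> continuous_on (cw_disc (cell_dim r)) (quotient_map \<circ> cell_map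
  r)"
  by (intro continuous_on_compose continuous_cell_map continuous_on_subset[OF
    continuous_quotient_map])
    (simp_all add: cell_map_image(1) hull_level)

lemma quotient_map_open_simplex:
  assumes y: "y \<in> open_simplex s" "is_simplex s" and z: "z \<in> level_complex"
    "quotient_map y = quotient_map z"
  obtains g where "g \<in> level_set" "y = translate g z" "s = act g ` support z"
proof -
  have "y \<in> level_complex" "support y = s" using y open_simplex_iff by auto
  then show ?thesis using that quotient_map_eqD[OF _ z] support_translate[OF z(1)] by metis
qed

text \<open>The simplex carrying \<open>y\<close> is translated onto its representative. Its
  cardinality is kept because it determines the dimension, which places boundary points in cells of
  lower dimension.\<close>

lemma open_cell_cover:
  assumes y: "y \<in> level_complex"
  obtains r where "r \<in> representatives" "quotient_map y \<in> open_cell (cell r)"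
    "card r = card (support y :: F2_cubed set)"
proof -
  note t = support_level(1)[OF y]
  let ?q = "representative (support y)"
  obtain g where g: "g \<in> level_set" "support y = act g ` ?q" using representative(4)[OF t] by blast
  note q = representative(3)[OF t]
  have q_sub: "?q \<subseteq> level_set" using q by (auto elim: simplexE)
  let ?z = "translate (act_inv g) y"
  have gi: "act_inv g \<in> level_set" using g(1) by simp
  have "support ?z = act (act_inv g) ` act g ` ?q"
    using support_translate[OF y gi] arg_cong[OF g(2), of "\<lambda>t. act (act_inv g) ` t"] by (rule trans)
  also have "\<dots> = ?q"
    using act_image_image[OF gi g(1) q_sub] act_image_one[OF q_sub] g(1) by simp
  finally have "?z \<in> open_simplex ?q" using translate_in[OF y gi] open_simplex_iff[OF q] by blast
  then have "quotient_map ?z \<in> open_cell (cell ?q)" unfolding cell_image(2)[OF q] by (rule imageI)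
  then have "quotient_map y \<in> open_cell (cell ?q)" unfolding quotient_map_translate[OF y gi] .
  moreover have "card ?q = card (support y :: F2_cubed set)"
    using card_image[OF inj_on_subset[OF act_inj[OF g(1)] q_sub]] arg_cong[OF g(2), of card] by simp
  ultimately show ?thesis using that t by (auto simp: representatives_def)
qed

lemma cw_complex_presentation: "cw_complex presentation_complex cells"
  unfolding cw_complex_def
proof (intro conjI ballI impI allI)
  show "Hausdorff_space (top_of_set presentation_complex)"
    by (intro Hausdorff_space_subtopology Hausdorff_space_euclidean)
next
  fix e assume "e \<in> cells"
  then obtain r where r: "r \<in> representatives" "e = cell r" by (auto simp: cells_def)
  note s = representatives_simplex[OF r(1)]
  note disc = cw_disc_small(2)[OF cell_dim(1)[OF s]]
  show "continuous_on (cw_disc (fst e)) (snd e)" unfolding r(2) cell_def fst_conv snd_conv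
    by (rule continuous_cell[OF s])
  show "\<exists>g. homeomorphism (cw_open_disc (fst e)) (open_cell e) (snd e) g"
    unfolding open_cell_def r(2) cell_def fst_conv snd_conv
  proof (rule homeomorphism_on_saturated[OF disc continuous_cell[OF s]])
    show sub: "cw_open_disc (cell_dim r) \<subseteq> cw_disc (cell_dim r)"
      by (auto simp: cw_open_disc_def cw_disc_def)
    \<comment> \<open>No identification touches an open simplex: if \<open>g\<close> carries
      \<open>z\<close> to \<open>y\<close>, it carries the support of \<open>z\<close> onto
      \<open>r\<close>. That support is contained in \<open>r\<close> and has as many elements, so
      it equals \<open>r\<close>; then \<open>g\<close> stabilizes \<open>r\<close> and is
      trivial.\<close>
    have stab: "y = z" if yz: "y \<in> open_simplex r" "z \<in> simplex_hull r"
      "quotient_map y = quotient_map z" for y z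
    proof -
      have z: "z \<in> level_complex" "support z \<subseteq> r" using yz(2) hull_iff[OF s] by auto
      obtain g where g: "g \<in> level_set" "y = translate g z" "r = act g ` support z"
        using quotient_map_open_simplex[OF yz(1) s z(1) yz(3)] .
      have "card r \<le> card (support z :: F2_cubed set)"
        unfolding g(3) by (rule card_image_le[OF support_level(3)[OF z(1)]])
      then have "support z = r" using z(2) card_simplex(1)[OF s] by (metis card_seteq)
      then have "g = origin" using simplex_stabilizer[OF s _ g(1)] g(3) by simp
      then show ?thesis using g(2) translate_one[OF z(1)] by simp
    qed
    have open_in: "cell_map r x \<in> open_simplex r" if "x \<in> cw_open_disc (cell_dim r)" for x
      using that cell_map_image(2)[OF s] by blast
    have hull_in: "cell_map r x \<in> simplex_hull r" if "x \<in> cw_disc (cell_dim r)" for x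
      using that cell_map_hull[OF s] by blast
    have eq: "x = y" if "x \<in> cw_open_disc (cell_dim r)" "y \<in> cw_disc (cell_dim r)"
      "quotient_map (cell_map r x) = quotient_map (cell_map r y)" for x y
      using stab[OF open_in[OF that(1)] hull_in[OF that(2)] that(3)] inj_onD[OF cell_map_inj[OF s]]
        that(1,2) sub by blast
    show "inj_on (quotient_map \<circ> cell_map r) (cw_open_disc (cell_dim r))"
      by (rule inj_onI) (use eq sub in auto)
    show "(quotient_map \<circ> cell_map r) ` cw_open_disc (cell_dim r) \<inter>
        (quotient_map \<circ> cell_map r) ` (cw_disc (cell_dim r) - cw_open_disc (cell_dim r)) = {}"
      using eq by fastforce
  qed
  show "\<exists>F. finite F \<and> F \<subseteq> {e' \<in> cells. fst e' < fst e} \<and> cell_boundary e \<subseteq> \<Union> (open_cell ` F)"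
  \<comment> \<open>Through \<open>subset_refl\<close>, the witness is taken to be the set of all
    cells of smaller dimension.\<close>
  proof (intro exI conjI subset_refl)
    show "finite {e' \<in> cells. fst e' < fst e}" using finite_representatives by (simp add: cells_def)
    show "cell_boundary e \<subseteq> \<Union> (open_cell ` {e' \<in> cells. fst e' < fst e})"
    proof
      fix x assume "x \<in> cell_boundary e"
      then obtain y where y: "y \<in> simplex_hull r" "y \<notin> open_simplex r" "x = quotient_map y"
        unfolding r(2) cell_image(3)[OF s] by blast
      then have yl: "y \<in> level_complex" "support y \<subset> r"
        using hull_iff[OF s] open_simplex_iff[OF s] by auto
      obtain q where q: "q \<in> representatives" "quotient_map y \<in> open_cell (cell q)"
        "card q = card (support y :: F2_cubed set)"
        using open_cell_cover[OF yl(1)] .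
      have "card (support y :: F2_cubed set) < card r"
        using yl(2) card_simplex(1)[OF s] by (rule psubset_card_mono[rotated])
      then have "cell_dim q < cell_dim r"
        using cell_dim(2)[OF representatives_simplex[OF q(1)]] cell_dim(2)[OF s] q(3) by simp
      moreover have "cell q \<in> cells" using q(1) by (simp add: cells_def)
      moreover have "x \<in> open_cell (cell q)" using q(2) y(3) by simp
      ultimately show "x \<in> \<Union> (open_cell ` {e' \<in> cells. fst e' < fst e})" unfolding r(2)
        by (auto simp: cell_def)
    qed
  qed blast
  show "closed_cell e \<subseteq> presentation_complex"
    unfolding r(2) cell_image(1)[OF s] presentation_complex_def using hull_level[OF s] by blast
next
  show "\<Union> (open_cell ` cells) = presentation_complex"
  proof (intro equalityI subsetI)
    fix x assume "x \<in> \<Union> (open_cell ` cells)"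
    then obtain r where r: "r \<in> representatives" "x \<in> open_cell (cell r)" by (auto simp: cells_def)
    note s = representatives_simplex[OF r(1)]
    show "x \<in> presentation_complex"
      using r(2) open_simplex_iff[OF s] unfolding cell_image(2)[OF s] presentation_complex_def
        by blast
  next
    fix x assume "x \<in> presentation_complex"
    then obtain y where y: "y \<in> level_complex" "x = quotient_map y"
      by (auto simp: presentation_complex_def)
    obtain q where "q \<in> representatives" "quotient_map y \<in> open_cell (cell q)"
      using open_cell_cover[OF y(1)] .
    then show "x \<in> \<Union> (open_cell ` cells)" using y(2) by (auto simp: cells_def)
  qed
next
  fix e e' assume e: "e \<in> cells" "e' \<in> cells" "e \<noteq> e'"
  then obtain r r' where r: "r \<in> representatives" "e = cell r" "r' \<in> representatives" "e' = cell r'"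
    by (auto simp: cells_def)
  note s = representatives_simplex[OF r(1)] representatives_simplex[OF r(3)]
  show "open_cell e \<inter> open_cell e' = {}"
  proof (rule ccontr)
    assume "open_cell e \<inter> open_cell e' \<noteq> {}"
    then obtain y z where yz: "y \<in> open_simplex r" "z \<in> open_simplex r'"
      "quotient_map y = quotient_map z"
      unfolding r(2,4) cell_image(2)[OF s(1)] cell_image(2)[OF s(2)] by blast
    then have z: "z \<in> level_complex" "support z = r'" using open_simplex_iff[OF s(2)] by auto
    obtain g where "g \<in> level_set" "r = act g ` support z"
      using quotient_map_open_simplex[OF yz(1) s(1) z(1) yz(3)] .
    then have "r = r'" using representatives_unique[OF r(3,1)] z(2) by simp
    then show False using e(3) r by simp
  qed
next
  fix T assume T: "T \<subseteq> presentation_complex"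
  have comp: "compact (closed_cell e)" if e: "e \<in> cells" for e
  proof -
    obtain r where r: "r \<in> representatives" "e = cell r" using e by (auto simp: cells_def)
    note s = representatives_simplex[OF r(1)]
    show ?thesis unfolding closed_cell_def r(2) cell_def fst_conv snd_conv
      by (rule compact_continuous_image[OF continuous_cell[OF s] cw_disc_small(2)[OF cell_dim(1)[OF
        s]]])
  qed
  have sub: "closed_cell e \<subseteq> presentation_complex" if e: "e \<in> cells" for e
  proof -
    obtain r where r: "r \<in> representatives" "e = cell r" using e by (auto simp: cells_def)
    note s = representatives_simplex[OF r(1)]
    show ?thesis unfolding r(2) cell_image(1)[OF s] presentation_complex_def
      using hull_level[OF s] by blast
  qed
  have cover: "presentation_complex \<subseteq> \<Union> (closed_cell ` cells)"
  proof
    fix x assume "x \<in> presentation_complex"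
    then obtain y where y: "y \<in> level_complex" "x = quotient_map y"
      by (auto simp: presentation_complex_def)
    obtain q where q: "q \<in> representatives" "quotient_map y \<in> open_cell (cell q)"
      using open_cell_cover[OF y(1)] .
    note t = representatives_simplex[OF q(1)]
    have "open_cell (cell q) \<subseteq> closed_cell (cell q)"
      unfolding cell_image(1)[OF t] cell_image(2)[OF t] by (auto simp: open_simplex_def)
    then show "x \<in> \<Union> (closed_cell ` cells)" using q y(2) by (auto simp: cells_def)
  qed
  show "closedin (top_of_set presentation_complex) T
    \<longleftrightarrow> (\<forall>e\<in>cells. closedin (top_of_set (closed_cell e)) (T \<inter> closed_cell e))"
  proof
    assume "closedin (top_of_set presentation_complex) T"
    then obtain C where C: "closed C" "T = presentation_complex \<inter> C" by (auto simp: closedin_closed)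
    show "\<forall>e\<in>cells. closedin (top_of_set (closed_cell e)) (T \<inter> closed_cell e)"
      unfolding closedin_closed using C sub by blast
  next
    assume *: "\<forall>e\<in>cells. closedin (top_of_set (closed_cell e)) (T \<inter> closed_cell e)"
    \<comment> \<open>A set closed in a compact cell is closed outright, and finitely many cells
      cover the complex.\<close>
    have "closed (T \<inter> closed_cell e)" if "e \<in> cells" for e
      using * that comp closedin_closed_trans compact_imp_closed by blast
    then have "closed (\<Union>e\<in>cells. T \<inter> closed_cell e)"
      using finite_representatives by (intro closed_UN) (auto simp: cells_def)
    moreover have "(\<Union>e\<in>cells. T \<inter> closed_cell e) = T" using T cover by blast
    ultimately show "closedin (top_of_set presentation_complex) T"
      using T by (simp add: closed_subset)
  qed
qed

section \<open>Simple connectivity at infinity\<close>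

abbreviation level_cells :: "linfty cell set" where
  "level_cells \<equiv> lifted_cells level_complex quotient_map cells"

text \<open>The restriction makes the map \<open>undefined\<close> off the disc, as membership in
  \<open>lifted_cells\<close> demands.\<close>

definition lifted_cell :: "F2_cubed \<Rightarrow> F2_cubed set \<Rightarrow> linfty cell" where
  "lifted_cell g r = (cell_dim r, restrict (translate g \<circ> cell_map r) (cw_disc (cell_dim r)))"

lemma translate_simplex_hull:
  assumes s: "is_simplex s" and g: "g \<in> level_set"
  shows "translate g ` simplex_hull s = simplex_hull (act g ` s)"
    "translate g ` open_simplex s = open_simplex (act g ` s)"
proof -
  have s_sub: "s \<subseteq> level_set" using s by (auto elim: simplexE)
  have gs: "is_simplex (act g ` s)" by (rule simplex_act[OF s g])
  have gi: "act_inv g \<in> level_set" using g by simp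
  have act_back: "act (act_inv g) ` act g ` s = s"
    using act_image_image[OF gi g s_sub] act_image_one[OF s_sub] g by simp
  have surj: "translate g (translate (act_inv g) f) = f" if "f \<in> level_complex" for f
    using translate_mult[OF g gi that] translate_one[OF that] g by simp
  have fwd: "translate h f \<in> level_complex \<and> support (translate h f) = act h ` support f"
    if "f \<in> level_complex" "h \<in> level_set" for f h
    using translate_in[OF that] support_translate[OF that] by simp
  show "translate g ` simplex_hull s = simplex_hull (act g ` s)"
  proof (intro equalityI subsetI)
    fix f assume "f \<in> translate g ` simplex_hull s"
    then obtain y where "y \<in> level_complex" "support y \<subseteq> s" "f = translate g y"
      using hull_iff[OF s] by blast
    then show "f \<in> simplex_hull (act g ` s)" unfolding hull_iff[OF gs]
      using fwd[OF _ g] by (metis image_mono)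
  next
    fix f assume "f \<in> simplex_hull (act g ` s)"
    then have f: "f \<in> level_complex" "support f \<subseteq> act g ` s" unfolding hull_iff[OF gs] by auto
    have "act (act_inv g) ` support f \<subseteq> s"
      using image_mono[OF f(2), of "act (act_inv g)"] act_back by simp
    then have "translate (act_inv g) f \<in> simplex_hull s" unfolding hull_iff[OF s]
      using fwd[OF f(1) gi] by simp
    then show "f \<in> translate g ` simplex_hull s" using surj[OF f(1)] by (metis imageI)
  qed
  show "translate g ` open_simplex s = open_simplex (act g ` s)"
  proof (intro equalityI subsetI)
    fix f assume "f \<in> translate g ` open_simplex s"
    then obtain y where "y \<in> level_complex" "support y = s" "f = translate g y"
      using open_simplex_iff[OF s] by blast
    then show "f \<in> open_simplex (act g ` s)" unfolding open_simplex_iff[OF gs]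
      using fwd[OF _ g] by simp
  next
    fix f assume "f \<in> open_simplex (act g ` s)"
    then have f: "f \<in> level_complex" "support f = act g ` s" unfolding open_simplex_iff[OF gs]
      by auto
    then have "translate (act_inv g) f \<in> open_simplex s" unfolding open_simplex_iff[OF s]
      using fwd[OF f(1) gi] act_back by simp
    then show "f \<in> translate g ` open_simplex s" using surj[OF f(1)] by (metis imageI)
  qed
qed

lemma lifted_cell_image:
  assumes r: "is_simplex r" and g: "g \<in> level_set"
  shows "closed_cell (lifted_cell g r) = simplex_hull (act g ` r)"
    "open_cell (lifted_cell g r) = open_simplex (act g ` r)"
proof -
  have sub: "cw_open_disc (cell_dim r) \<subseteq> cw_disc (cell_dim r)"
    by (auto simp: cw_open_disc_def cw_disc_def)
  have restr: "restrict f K ` A = f ` A" if "A \<subseteq> K" for f :: "(nat \<Rightarrow> real) \<Rightarrow> linfty" and A K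
    using that by (auto simp: restrict_def image_iff subset_iff)
  show "closed_cell (lifted_cell g r) = simplex_hull (act g ` r)"
    unfolding closed_cell_def lifted_cell_def fst_conv snd_conv restr[OF subset_refl]
      image_comp[symmetric]
      cell_map_image(1)[OF r] by (rule translate_simplex_hull(1)[OF r g])
  show "open_cell (lifted_cell g r) = open_simplex (act g ` r)"
    unfolding open_cell_def lifted_cell_def fst_conv snd_conv restr[OF sub] image_comp[symmetric]
      cell_map_image(2)[OF r] by (rule translate_simplex_hull(2)[OF r g])
qed

lemma continuous_translate: "g \<in> level_set \<Longrightarrow> continuous_on level_complex (translate g)"
  unfolding continuous_on_iff using dist_translate_le by (meson le_less_trans)

lemma lifted_cell_in:
  assumes r: "r \<in> representatives" and g: "g \<in> level_set"
  shows "lifted_cell g r \<in> level_cells"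
proof -
  note s = representatives_simplex[OF r]
  let ?K = "cw_disc (cell_dim r)" and ?\<psi> = "restrict (translate g \<circ> cell_map r) (cw_disc (cell_dim
    r))"
  have in_level: "cell_map r x \<in> level_complex" if "x \<in> ?K" for x
    using cell_map_hull[OF s that] hull_level[OF s] by blast
  have "continuous_on ?K (translate g \<circ> cell_map r)"
    by (intro continuous_on_compose continuous_cell_map[OF s] continuous_on_subset[OF
      continuous_translate[OF g]])
      (use in_level in auto)
  then have "continuous_on ?K ?\<psi>" by (rule continuous_on_eq) simp
  moreover have "?\<psi> ` ?K \<subseteq> level_complex" using in_level translate_in[OF _ g] by auto
  moreover have "\<forall>x\<in>?K. quotient_map (?\<psi> x) = (quotient_map \<circ> cell_map r) x"
    using in_level quotient_map_translate[OF _ g] by simp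
  moreover have "(cell_dim r, quotient_map \<circ> cell_map r) \<in> cells"
    using r by (auto simp: cells_def cell_def)
  ultimately show ?thesis unfolding lifted_cells_def lifted_cell_def by blast
qed

text \<open>Finitely many open stars cover \<open>C\<close>. A point in the open star of
  \<open>v\<close> has only neighbours of \<open>v\<close> in its support, and every vertex has
  finitely many neighbours.\<close>

lemma compact_imp_finite_support:
  assumes C: "compact C" "C \<subseteq> level_complex"
  obtains K :: "F2_cubed set" where "finite K" "\<And>f. f \<in> C \<Longrightarrow> support f \<subseteq> K"
proof -
  have "C \<subseteq> (\<Union>v\<in>(UNIV :: F2_cubed set). {f. 0 < coord f v})"
  proof
    fix f assume f: "f \<in> C"
    then have fl: "f \<in> level_complex" using C(2) by blast
    obtain v :: F2_cubed where "v \<in> support f"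
      using support_level(1)[OF fl] unfolding is_simplex_def by blast
    then have "0 < coord f v" using support_level(5)[OF fl, of v] by (simp add: support_def)
    then show "f \<in> (\<Union>v\<in>(UNIV :: F2_cubed set). {f. 0 < coord f v})" by blast
  qed
  then obtain V :: "F2_cubed set" where V: "finite V" "C \<subseteq> (\<Union>v\<in>V. {f. 0 < coord f v})"
    using compactE_image[OF C(1), of UNIV "\<lambda>v::F2_cubed. {f. 0 < coord f v}"] open_coord_pos
      by metis
  show ?thesis
  proof (rule that)
    show "finite (\<Union>v\<in>V. {w. is_simplex {v, w}})" using V(1) finite_star by blast
    fix f assume f: "f \<in> C"
    then obtain v where v: "v \<in> V" "0 < coord f v" using V(2) by blast
    have fl: "f \<in> level_complex" using f C(2) by blast
    have "v \<in> support f" using v(2) by (simp add: support_def)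
    then have "is_simplex {v, w}" if "w \<in> support f" for w
      using simplex_subset[OF support_level(1)[OF fl], of "{v, w}"] that by simp
    then show "support f \<subseteq> (\<Union>v\<in>V. {w. is_simplex {v, w}})" using v(1) by blast
  qed
qed

lemma finite_subcomplex_compact:
  assumes "finite_subcomplex (level_cells) C"
  shows "compact C" "C \<subseteq> level_complex"
proof -
  obtain F where F: "finite F" "F \<subseteq> level_cells" "C = \<Union> (open_cell ` F)" "\<forall>e\<in>F. closed_cell e \<subseteq> C"
    using assms unfolding finite_subcomplex_def by blast
  have cell: "compact (closed_cell e) \<and> closed_cell e \<subseteq> level_complex" if e: "e \<in> F" for e
  proof -
    obtain n \<psi> \<phi> where \<psi>: "e = (n, \<psi>)" "continuous_on (cw_disc n) \<psi>" "\<psi> ` cw_disc n \<subseteq> level_complex"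
      "(n, \<phi>) \<in> cells"
      using e F(2) unfolding lifted_cells_def by blast
    obtain r where "r \<in> representatives" "n = cell_dim r"
      using \<psi>(4) by (auto simp: cells_def cell_def)
    then have "compact (cw_disc n)"
      using cw_disc_small(2)[OF cell_dim(1)[OF representatives_simplex]] by simp
    then show ?thesis using \<psi> compact_continuous_image[OF \<psi>(2)] by (simp add: closed_cell_def)
  qed
  have "open_cell e \<subseteq> closed_cell e" for e :: "linfty cell"
    unfolding open_cell_def closed_cell_def
      by (rule image_mono) (auto simp: cw_open_disc_def cw_disc_def)
  then have "C = \<Union> (closed_cell ` F)" using F(3,4) by blast
  then show "compact C" "C \<subseteq> level_complex" using F(1) cell by (auto intro: compact_UN)
qed

text \<open>Every simplex is a translate of a representative and hence underlies a lifted cell.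
  Closure of \<open>T\<close> under faces keeps the closed cells inside the union of the open
  ones.\<close>

lemma finite_subcomplexI:
  assumes fin: "finite T" and T: "\<And>t. t \<in> T \<Longrightarrow> is_simplex t"
    "\<And>t t'. t \<in> T \<Longrightarrow> t' \<subseteq> t \<Longrightarrow> t' \<noteq> {} \<Longrightarrow> t' \<in> T"
  shows "finite_subcomplex (level_cells) {f \<in> level_complex. support f \<in> T}"
proof -
  have "\<exists>g r. g \<in> level_set \<and> r \<in> representatives \<and> t = act g ` r" if t: "t \<in> T" for t
  proof -
    obtain g where "g \<in> level_set" "t = act g ` representative t"
      using representative(4)[OF T(1)[OF t]] by blast
    moreover have "representative t \<in> representatives"
      using T(1)[OF t] by (simp add: representatives_def)
    ultimately show ?thesis by blast
  qed
  then obtain \<gamma> \<rho> where gr: "\<And>t. t \<in> T \<Longrightarrow> \<gamma> t \<in> level_set" "\<And>t. t \<in> T \<Longrightarrow> \<rho> t \<in> representatives"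
    "\<And>t. t \<in> T \<Longrightarrow> t = act (\<gamma> t) ` \<rho> t" by metis
  let ?F = "(\<lambda>t. lifted_cell (\<gamma> t) (\<rho> t)) ` T"
  have img: "closed_cell (lifted_cell (\<gamma> t) (\<rho> t)) = simplex_hull t"
    "open_cell (lifted_cell (\<gamma> t) (\<rho> t)) = open_simplex t" if t: "t \<in> T" for t
    using lifted_cell_image[OF representatives_simplex[OF gr(2)[OF t]] gr(1)[OF t]] gr(3)[OF t]
      by simp_all
  show ?thesis
    unfolding finite_subcomplex_def
  proof (intro exI[of _ ?F] conjI ballI)
    show "finite ?F" using fin by simp
    show "?F \<subseteq> level_cells" using lifted_cell_in gr(1,2) by blast
    show "{f \<in> level_complex. support f \<in> T} = \<Union> (open_cell ` ?F)"
    proof (intro equalityI subsetI)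
      fix f assume "f \<in> {f \<in> level_complex. support f \<in> T}"
      then have "f \<in> open_cell (lifted_cell (\<gamma> (support f)) (\<rho> (support f)))" "support f \<in> T"
        using img(2) open_simplexI by auto
      then show "f \<in> \<Union> (open_cell ` ?F)" by blast
    next
      fix f assume "f \<in> \<Union> (open_cell ` ?F)"
      then obtain t where t: "t \<in> T" "f \<in> open_simplex t" using img(2) by auto
      then show "f \<in> {f \<in> level_complex. support f \<in> T}" using open_simplex_iff[OF T(1)] by simp
    qed
    fix e assume "e \<in> ?F"
    then obtain t where t: "t \<in> T" "closed_cell e = simplex_hull t" using img(1) by auto
    have "support f \<in> T" if f: "f \<in> level_complex" "support f \<subseteq> t" for f
    proof -
      have "support f \<noteq> ({} :: F2_cubed set)"
        using support_level(1)[OF f(1)] unfolding is_simplex_def by blast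
      then show ?thesis using T(2)[OF t(1) f(2)] by simp
    qed
    then show "closed_cell e \<subseteq> {f \<in> level_complex. support f \<in> T}"
      using t(2) hull_iff[OF T(1)[OF t(1)]] by blast
  qed
qed

lemma loops_trivial_at_infinity_level:
  "loops_trivial_at_infinity level_complex (level_cells)"
  unfolding loops_trivial_at_infinity_def
proof (intro allI impI)
  fix C assume C: "finite_subcomplex (level_cells) C"
  obtain K :: "F2_cubed set" where K: "finite K" "\<And>f. f \<in> C \<Longrightarrow> support f \<subseteq> K"
    using compact_imp_finite_support[OF finite_subcomplex_compact[OF C]] by blast
  obtain n where n: "K \<inter> far n = {}" using finite_imp_near[OF K(1)] by blast
  define B where "B = level_set - far (Suc n)"
  \<comment> \<open>All simplices meeting the finite set \<open>B\<close>, with faces added to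
    obtain a subcomplex. A point off it has its whole support outside \<open>B\<close>, that is in
    \<open>far (Suc n)\<close>, where its loops contract in the realization of \<open>far n\<close>
    and so avoid \<open>C\<close>.\<close>
  define T where "T = {t. is_simplex t \<and> (\<exists>s. is_simplex s \<and> t \<subseteq> s \<and> s \<inter> B \<noteq> {})}"
  have "T \<subseteq> (\<Union>v\<in>B. \<Union>s\<in>{s. is_simplex s \<and> v \<in> s}. Pow s)" by (auto simp: T_def)
  moreover have "finite (\<Union>v\<in>B. \<Union>s\<in>{s. is_simplex s \<and> v \<in> s}. Pow s)"
    using finite_near[of "Suc n"] finite_simplices_at card_simplex(1) by (auto simp: B_def)
  ultimately have "finite T" by (rule finite_subset)
  then have D: "finite_subcomplex (level_cells) {f \<in> level_complex. support f \<in> T}"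
  proof (rule finite_subcomplexI)
    show "is_simplex t" if "t \<in> T" for t using that by (simp add: T_def)
    show "t' \<in> T" if t: "t \<in> T" "t' \<subseteq> t" "t' \<noteq> {}" for t t'
      using t simplex_subset[of t t'] unfolding T_def by blast
  qed
  have "homotopic_paths (level_complex - C) p (\<lambda>_. pathstart p)"
    if p: "path p" "pathfinish p = pathstart p" "path_image p \<subseteq> level_complex - {f \<in> level_complex.
      support f \<in> T}" for p
  proof (rule homotopic_paths_subset)
    have "path_image p \<subseteq> level.body (far (Suc n))"
    proof
      fix f assume "f \<in> path_image p"
      then have f: "f \<in> level_complex" "support f \<notin> T" using p(3) by auto
      then have "support f \<inter> B = {}" using support_level(1)[OF f(1)] by (auto simp: T_def)
      then have "support f \<subseteq> far (Suc n)" using support_level(2)[OF f(1)] by (auto simp: B_def)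
      then show "f \<in> level.body (far (Suc n))"
        using level.body_subsetI f(1) unfolding level_complex_def by blast
    qed
    then show "homotopic_paths (level.body (far n)) p (\<lambda>_. pathstart p)"
      using far_loop_nullhomotopic[OF p(1) _ p(2)] by (simp add: linepath_refl)
    show "level.body (far n) \<subseteq> level_complex - C"
    proof
      fix f assume f: "f \<in> level.body (far n)"
      have "far n \<subseteq> level_set" by (auto simp: far_def)
      then have "f \<in> level_complex" unfolding level_complex_def using level.body_mono f by blast
      moreover have "f \<notin> C" using K(2)[of f] n level.body_support(2,5)[OF f] by blast
      ultimately show "f \<in> level_complex - C" by simp
    qed
  qed
  then show "\<exists>D. finite_subcomplex (level_cells) D \<and>
      (\<forall>p. path p \<and> pathfinish p = pathstart p \<and> path_image p \<subseteq> level_complex - D \<longrightarrow>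
        homotopic_paths (level_complex - C) p (\<lambda>_. pathstart p))"
    using D by blast
qed

theorem theorem1p1:
  shows "simply_connected_at_infinity stallings_group"
  unfolding simply_connected_at_infinity_def
proof (intro conjI exI)
  show "one_ended stallings_group" by (rule one_ended_stallings)
  show "cw_complex presentation_complex cells" by (rule cw_complex_presentation)
  show "finite cells" using finite_representatives by (simp add: cells_def)
  show "connected presentation_complex"
    unfolding presentation_complex_def
    by (rule connected_continuous_image[OF continuous_quotient_map path_connected_imp_connected[OF
      path_connected_level_complex]])
  show "\<exists>a\<in>presentation_complex. fundamental_group presentation_complex a \<cong> stallings_group"
    using fundamental_group_presentation_complex basepoint_in unfolding presentation_complex_def
      by blast
  show "universal_covering level_complex quotient_map presentation_complex"
    unfolding universal_covering_def
      using covering_quotient_map simply_connected_level_complex by blast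
  show "loops_trivial_at_infinity level_complex (level_cells)"
    by (rule loops_trivial_at_infinity_level)
qed

end
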